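(* Let $X$ be a Banach space, let $K\subset X^*$ be $w^*$-compact, and let $\xi$ be an ordinal. (i) If $Sz(K)\leqslant \omega^\xi$, then $Dz(K)\leqslant \omega^{1+\xi}$. (ii) Suppose that $K$ is convex. Then $Dz(K)\leqslant \omega\, Sz(K)$, and if $Sz(K)\geqslant \omega^\omega$, then $Dz(K)=Sz(K)$.
   Context: Let $X$ be a Banach space and $K\subset X^*$. Diameters are with respect to the norm of $X^*$. For $\varepsilon>0$, $s_\varepsilon(K)$ denotes the set of those $x^*\in K$ such that for every $w^*$-neighborhood $V$ of $x^*$, $\mathrm{diam}(V\cap K)>\varepsilon$. A $w^*$-open slice is a subset of $X^*$ of the form $\{y^*: \mathrm{Re}\, y^*(x)>a\}$ for some $x\in X$ and $a\in\mathbb{R}$; $d_\varepsilon(K)$ denotes the set of those $x^*\in K$ such that for every $w^*$-open slice $S$ containing $x^*$, $\mathrm{diam}(S\cap K)>\varepsilon$. Define $s_\varepsilon^0(K)=K$, $s_\varepsilon^{\xi+1}(K)=s_\varepsilon(s_\varepsilon^\xi(K))$, and $s_\varepsilon^\xi(K)=\bigcap_{\zeta<\xi}s_\varepsilon^\zeta(K)$ when $\xi$ is a limit ordinal. Let $Sz(K,\varepsilon)=\min\{\xi: s_\varepsilon^\xi(K)=\varnothing\}$ if this class of ordinals is non-empty, and $Sz(K,\varepsilon)=\infty$ otherwise. The Szlenk index is $Sz(K)=\sup_{\varepsilon>0}Sz(K,\varepsilon)$, with the convention $\xi<\infty$ for all ordinals $\xi$. The iterates $d_\varepsilon^\xi(K)$,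 the quantities $Dz(K,\varepsilon)$ and the $w^*$-dentability index $Dz(K)$ are defined in the same way with $d_\varepsilon$ in place of $s_\varepsilon$. Products and powers are in the sense of ordinal arithmetic, with the convention $\omega\infty=\infty$. *)

theory Defs
  imports "HOL-Analysis.Analysis"
begin

section \<open>Ordinals\<close>

text \<open>
  \<open>'u ordinal\<close> is the initial segment of the ordinals consisting of all ordinals of cardinality
  at most \<open>\<kappa> = max(|'u|, aleph_0)\<close>; that is, it is a copy of the ordinal \<open>\<kappa>\<^sup>+\<close>, carried by the
  well-order \<^const>\<open>cardSuc\<close>. It is closed under successors and under suprema of at most \<open>\<kappa>\<close> many
  elements (\<open>bdd_above_small\<close> below), hence under the arithmetic operations, and it contains the
  order type of every well-order on \<open>'u\<close> (\<open>ordinal_of_Well_order\<close> below).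
\<close>

abbreviation ordinal_rel :: "'u itself \<Rightarrow> ('u + nat) set rel" where
  "ordinal_rel _ \<equiv> cardSuc (card_of (UNIV :: ('u + nat) set))"

typedef 'u ordinal = "Field (ordinal_rel TYPE('u))"
  using Field_cardSuc_not_empty[OF card_of_Card_order] by blast

lemma Well_order_ordinal_rel: "Well_order (ordinal_rel TYPE('u))"
  by (simp add: cardSuc_Well_order card_of_Card_order)

instantiation ordinal :: (type) wellorder
begin

definition
  "(\<alpha> :: 'a ordinal) \<le> \<beta> \<longleftrightarrow> (Rep_ordinal \<alpha>, Rep_ordinal \<beta>) \<in> ordinal_rel TYPE('a)"

definition
  "(\<alpha> :: 'a ordinal) < \<beta> \<longleftrightarrow> \<alpha> \<le> \<beta> \<and> \<alpha> \<noteq> \<beta>"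

instance
proof
  let ?r = "ordinal_rel TYPE('a)"
  have lin: "Linear_order ?r" and wf: "wf (?r - Id)"
    using Well_order_ordinal_rel[where 'u='a] by (auto simp: well_order_on_def)
  have tr: "trans ?r" and as: "antisym ?r" and re: "refl_on (Field ?r) ?r" and tot: "total_on (Field ?r) ?r"
    using lin by (auto simp: order_on_defs)
  fix x y z :: "'a ordinal"
  show "x \<le> x"
    using re Rep_ordinal[of x] by (auto simp: less_eq_ordinal_def refl_on_def)
  show "x \<le> z" if "x \<le> y" "y \<le> z"
    using that tr by (auto simp: less_eq_ordinal_def dest: transD)
  show anti: "x = y" if "x \<le> y" "y \<le> x"
    using that as by (auto simp: less_eq_ordinal_def Rep_ordinal_inject dest: antisymD)
  show "(x < y) = (x \<le> y \<and> \<not> y \<le> x)"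
    using anti \<open>x \<le> x\<close> by (auto simp: less_ordinal_def)
  show "x \<le> y \<or> y \<le> x"
    using tot re Rep_ordinal[of x] Rep_ordinal[of y]
    by (auto simp: less_eq_ordinal_def total_on_def refl_on_def Rep_ordinal_inject) metis
next
  fix P :: "'a ordinal \<Rightarrow> bool" and a :: "'a ordinal"
  assume step: "\<And>x. (\<And>y. y < x \<Longrightarrow> P y) \<Longrightarrow> P x"
  let ?r = "ordinal_rel TYPE('a)"
  have "wf (?r - Id)"
    using Well_order_ordinal_rel[where 'u='a] by (auto simp: well_order_on_def)
  then have "wf (inv_image (?r - Id) Rep_ordinal)"
    by (rule wf_inv_image)
  then show "P a"
  proof (induction a rule: wf_induct_rule)
    case (less x)
    show ?case
      by (rule step, rule less)
        (auto simp: less_ordinal_def less_eq_ordinal_def Rep_ordinal_inject)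
  qed
qed

end

instantiation ordinal :: (type) conditionally_complete_linorder
begin

definition "inf (\<alpha> :: 'a ordinal) \<beta> = min \<alpha> \<beta>"
definition "sup (\<alpha> :: 'a ordinal) \<beta> = max \<alpha> \<beta>"
definition "Inf (A :: 'a ordinal set) = (LEAST \<alpha>. \<alpha> \<in> A)"
definition "Sup (A :: 'a ordinal set) = (LEAST \<beta>. \<forall>\<alpha>\<in>A. \<alpha> \<le> \<beta>)"

instance
proof
  fix x z :: "'a ordinal" and X :: "'a ordinal set"
  show "Inf X \<le> x" if "x \<in> X" "bdd_below X"
    using that by (simp add: Inf_ordinal_def Least_le)
  show "z \<le> Inf X" if "X \<noteq> {}" "\<And>y. y \<in> X \<Longrightarrow> z \<le> y"
    using that unfolding Inf_ordinal_def ex_in_conv[symmetric] by (rule LeastI2_ex)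
  show "x \<le> Sup X" if "x \<in> X" "bdd_above X"
    using that LeastI_ex[of "\<lambda>b. \<forall>a\<in>X. a \<le> b"]
    by (auto simp: Sup_ordinal_def bdd_above_def)
  show "Sup X \<le> z" if "X \<noteq> {}" "\<And>y. y \<in> X \<Longrightarrow> y \<le> z"
    using that by (auto simp: Sup_ordinal_def intro: Least_le)
qed (auto simp: inf_ordinal_def sup_ordinal_def)

end

lemma bdd_above_small:
  includes cardinal_syntax
  fixes A :: "'u ordinal set"
  assumes "|A| \<le>o |UNIV :: ('u + nat) set|"
  shows "bdd_above A"
proof -
  let ?c = "|UNIV :: ('u + nat) set|"
  let ?r = "ordinal_rel TYPE('u)"
  define B where "B = Rep_ordinal ` A"
  define As where "As i = {j. (j, i) \<in> ?r}" for i
  have lin: "trans ?r" "refl_on (Field ?r) ?r"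
    using Well_order_ordinal_rel[where 'u='u] by (auto simp: order_on_defs)
  have "B \<subseteq> (\<Union>i\<in>Field ?r. As i)"
    using lin Rep_ordinal by (fastforce simp: B_def As_def refl_on_def)
  moreover have "relChain ?r As"
    using lin by (auto simp: relChain_def As_def dest: transD)
  moreover have "|B| \<le>o ?c"
    unfolding B_def using card_of_image assms ordLeq_transitive by blast
  moreover have "\<not> finite (Field ?c)"
    by (simp add: card_of_Field_ordIso Field_card_of finite_Plus_UNIV_iff)
  ultimately obtain i where i: "i \<in> Field ?r" "B \<subseteq> As i"
    using cardSuc_UNION[OF card_of_Card_order] by metis
  then have "a \<le> Abs_ordinal i" if "a \<in> A" for a
    using that by (auto simp: less_eq_ordinal_def Abs_ordinal_inverse B_def As_def)
  then show ?thesis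
    by (auto simp: bdd_above_def)
qed

lemma ordinal_of_Well_order:
  fixes r :: "'u rel"
  assumes "Well_order r"
  shows "\<exists>\<alpha> :: 'u ordinal. \<exists>f. bij_betw f (Field r) {..<\<alpha>} \<and>
           (\<forall>x\<in>Field r. \<forall>y\<in>Field r. (x, y) \<in> r \<longleftrightarrow> f x \<le> f y)"
proof -
  include cardinal_syntax
  let ?c = "|UNIV :: ('u + nat) set|"
  let ?r = "ordinal_rel TYPE('u)"
  note wo = Well_order_ordinal_rel[where 'u='u]
  have "r <o ?r"
  proof (rule ccontr)
    assume "\<not> r <o ?r"
    then have "?r \<le>o r"
      using assms wo not_ordLess_iff_ordLeq by blast
    then have "|Field ?r| \<le>o |Field r|"
      by (rule card_of_mono2)
    moreover have "|Field r| \<le>o ?c"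
      by (rule card_of_ordLeqI[where f=Inl]) auto
    moreover have "?r =o |Field ?r|"
      using card_of_Field_ordIso[OF cardSuc_Card_order[OF card_of_Card_order]] ordIso_symmetric by blast
    ultimately have "?r \<le>o ?c"
      using ordIso_ordLeq_trans ordLeq_transitive by blast
    then show False
      using cardSuc_greater[OF card_of_Card_order] not_ordLess_ordLeq by blast
  qed
  then obtain a where a: "a \<in> Field ?r" "r =o Restr ?r (underS ?r a)"
    using ordLess_iff_ordIso_Restr[OF wo assms] by blast
  let ?p = "Restr ?r (underS ?r a)"
  have F: "Field ?p = underS ?r a"
    using wo by (simp add: wo_rel_def wo_rel.underS_ofilter Field_Restr_ofilter)
  obtain f where f: "iso r ?p f"
    using a by (auto simp: ordIso_def)
  then have bij: "bij_betw f (Field r) (underS ?r a)"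
    and ord: "\<forall>x\<in>Field r. \<forall>y\<in>Field r. (x, y) \<in> r \<longleftrightarrow> (f x, f y) \<in> ?p"
    unfolding iso_iff2 F by auto
  have sub: "underS ?r a \<subseteq> Field ?r"
    by (auto simp: underS_def Field_def)
  have fx: "f x \<in> underS ?r a" "f x \<in> Field ?r" if "x \<in> Field r" for x
    using bij that sub by (auto simp: bij_betw_def)
  have "bij_betw Abs_ordinal (underS ?r a) {..<Abs_ordinal a}"
    by (rule bij_betw_byWitness[where f' = Rep_ordinal])
      (use sub a in \<open>auto simp: Abs_ordinal_inverse Rep_ordinal_inverse subset_iff underS_def
        less_ordinal_def less_eq_ordinal_def Abs_ordinal_inject\<close>)
  then have "bij_betw (Abs_ordinal \<circ> f) (Field r) {..<Abs_ordinal a}"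
    using bij bij_betw_trans by blast
  moreover have "\<forall>x\<in>Field r. \<forall>y\<in>Field r. (x, y) \<in> r \<longleftrightarrow> (Abs_ordinal \<circ> f) x \<le> (Abs_ordinal \<circ> f) y"
    using ord fx by (auto simp: less_eq_ordinal_def Abs_ordinal_inverse)
  ultimately show ?thesis
    by blast
qed

lemma ex_greater_ordinal: "\<exists>\<beta>. (\<alpha> :: 'u ordinal) < \<beta>"
proof -
  let ?r = "ordinal_rel TYPE('u)"
  have "\<not> finite (Field ?r)"
    by (simp add: cardSuc_finite[OF card_of_Card_order] Field_card_of finite_Plus_UNIV_iff)
  then obtain b where "b \<in> Field ?r" "Rep_ordinal \<alpha> \<noteq> b" "(Rep_ordinal \<alpha>, b) \<in> ?r"
    using infinite_Card_order_limit[OF cardSuc_Card_order[OF card_of_Card_order] _ Rep_ordinal] by blast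
  then have "\<alpha> < Abs_ordinal b"
    by (auto simp: less_ordinal_def less_eq_ordinal_def Abs_ordinal_inverse)
  then show ?thesis ..
qed

definition osuc :: "'u ordinal \<Rightarrow> 'u ordinal" where
  "osuc \<alpha> = (LEAST \<beta>. \<alpha> < \<beta>)"

lemma less_osuc [simp]: "\<alpha> < osuc \<alpha>"
  unfolding osuc_def using ex_greater_ordinal by (rule LeastI_ex)

lemma less_osuc_iff: "\<alpha> < osuc \<beta> \<longleftrightarrow> \<alpha> \<le> \<beta>"
  by (metis less_osuc not_less_Least not_le osuc_def order.strict_trans1)

lemma osuc_inject [simp]: "osuc \<alpha> = osuc \<beta> \<longleftrightarrow> \<alpha> = \<beta>"
  by (metis less_osuc less_osuc_iff order_antisym)

instantiation ordinal :: (type) "{zero, one}"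
begin

definition "0 = (LEAST \<alpha> :: 'a ordinal. True)"
definition "1 = osuc (0 :: 'a ordinal)"

instance ..

end

lemma zero_le_ordinal [simp]: "0 \<le> (\<alpha> :: 'u ordinal)"
  by (simp add: zero_ordinal_def Least_le)

text \<open>Transfinite recursion with separate clauses for zero, successors and limits.\<close>

function ord_rec :: "'b \<Rightarrow> ('b \<Rightarrow> 'b) \<Rightarrow> ('b set \<Rightarrow> 'b) \<Rightarrow> 'u ordinal \<Rightarrow> 'b" where
  "ord_rec z s l \<xi> =
     (if \<xi> = 0 then z
      else if \<exists>\<eta>. \<xi> = osuc \<eta> then s (ord_rec z s l (THE \<eta>. \<xi> = osuc \<eta>))
      else l (ord_rec z s l ` {..<\<xi>}))"
  by auto
termination
  by (relation "inv_image {(\<eta>, \<xi>). \<eta> < \<xi>} (\<lambda>(z, s, l, \<xi>). \<xi>)")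
    (auto intro: wf_inv_image wellorder_class.wf)

declare ord_rec.simps [simp del]

definition limit_ordinal :: "'u ordinal \<Rightarrow> bool" where
  "limit_ordinal \<xi> \<longleftrightarrow> \<xi> \<noteq> 0 \<and> (\<nexists>\<eta>. \<xi> = osuc \<eta>)"

lemma ord_rec_0: "ord_rec z s l 0 = z"
  by (simp add: ord_rec.simps)

lemma ord_rec_osuc: "ord_rec z s l (osuc \<xi>) = s (ord_rec z s l \<xi>)"
proof -
  have "osuc \<xi> \<noteq> 0"
    by (metis less_osuc not_le zero_le_ordinal)
  then show ?thesis
    by (subst ord_rec.simps) auto
qed

lemma ord_rec_limit: "limit_ordinal \<xi> \<Longrightarrow> ord_rec z s l \<xi> = l (ord_rec z s l ` {..<\<xi>})"
  unfolding limit_ordinal_def by (subst ord_rec.simps) simp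

instantiation ordinal :: (type) "{plus, times}"
begin

definition "\<alpha> + \<beta> = ord_rec (\<alpha> :: 'a ordinal) osuc Sup \<beta>"
definition "\<alpha> * \<beta> = ord_rec (0 :: 'a ordinal) (\<lambda>\<gamma>. \<gamma> + \<alpha>) Sup \<beta>"

instance ..

end

definition omega :: "'u ordinal" where
  "omega = Sup (range (\<lambda>n. (osuc ^^ n) 0))"

lemma less_omega_iff: "(\<alpha> :: 'u ordinal) < omega \<longleftrightarrow> (\<exists>n. \<alpha> = (osuc ^^ n) 0)"
proof -
  include cardinal_syntax
  let ?A = "range (\<lambda>n. (osuc ^^ n) (0 :: 'u ordinal))"
  have "|?A| \<le>o |UNIV :: nat set|"
    by (rule card_of_image)
  moreover have "|UNIV :: nat set| \<le>o |UNIV :: ('u + nat) set|"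
    by (rule card_of_ordLeqI[where f=Inr]) auto
  ultimately have "bdd_above ?A"
    by (intro bdd_above_small) (rule ordLeq_transitive)
  then have iff: "\<alpha> < omega \<longleftrightarrow> (\<exists>n. \<alpha> < (osuc ^^ n) 0)" for \<alpha> :: "'u ordinal"
    unfolding omega_def by (subst less_cSup_iff) auto
  have "\<exists>m. \<alpha> = (osuc ^^ m) 0" if "\<alpha> < (osuc ^^ n) 0" for n
    using that
  proof (induction n)
    case 0
    then show ?case
      by (simp add: leD)
  next
    case (Suc n)
    then show ?case
      by (auto simp: less_osuc_iff le_less)
  qed
  moreover have "(osuc ^^ n) 0 < (osuc ^^ Suc n) 0" for n
    by simp
  ultimately show ?thesis
    using iff by blast
qed

definition omega_power :: "'u ordinal \<Rightarrow> 'u ordinal" where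
  "omega_power \<xi> = ord_rec 1 (\<lambda>\<gamma>. \<gamma> * omega) Sup \<xi>"

subsection \<open>Ordinals with a largest element \<open>\<infinity>\<close>\<close>

datatype 'u xordinal = Ord "'u ordinal" | Infty

instantiation xordinal :: (type) linorder
begin

fun less_eq_xordinal :: "'a xordinal \<Rightarrow> 'a xordinal \<Rightarrow> bool" where
  "Ord \<alpha> \<le> Ord \<beta> \<longleftrightarrow> \<alpha> \<le> \<beta>"
| "x \<le> Infty \<longleftrightarrow> True"
| "Infty \<le> Ord \<beta> \<longleftrightarrow> False"

definition "(x :: 'a xordinal) < y \<longleftrightarrow> x \<le> y \<and> \<not> y \<le> x"

instance
proof
  fix x y z :: "'a xordinal"
  show "x \<le> x" by (cases x) auto
  show "x \<le> z" if "x \<le> y" "y \<le> z" using that by (cases x; cases y; cases z) auto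
  show "x = y" if "x \<le> y" "y \<le> x" using that by (cases x; cases y) auto
  show "x \<le> y \<or> y \<le> x" by (cases x; cases y) auto
qed (rule less_xordinal_def)

end

lemma ex_least_xordinal:
  fixes A :: "'u xordinal set"
  assumes "A \<noteq> {}"
  shows "\<exists>x\<in>A. \<forall>y\<in>A. x \<le> y"
proof (cases "\<exists>\<alpha>. Ord \<alpha> \<in> A")
  case True
  then have "Ord (LEAST \<alpha>. Ord \<alpha> \<in> A) \<in> A"
    by (rule LeastI_ex)
  moreover have "Ord (LEAST \<alpha>. Ord \<alpha> \<in> A) \<le> y" if "y \<in> A" for y
    using that by (cases y) (auto intro: Least_le)
  ultimately show ?thesis
    by blast
next
  case False
  then have "A = {Infty}"
    using assms by (metis (full_types) all_not_in_conv insertI1 singletonD subsetI subset_singletonD xordinal.exhaust)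
  then show ?thesis
    by auto
qed

instantiation xordinal :: (type) wellorder
begin

instance
proof
  fix P :: "'a xordinal \<Rightarrow> bool" and a
  assume step: "\<And>x. (\<And>y. y < x \<Longrightarrow> P y) \<Longrightarrow> P x"
  show "P a"
  proof (rule ccontr)
    assume "\<not> P a"
    then obtain x where "\<not> P x" "\<forall>y. \<not> P y \<longrightarrow> x \<le> y"
      using ex_least_xordinal[of "{x. \<not> P x}"] by auto
    then show False
      using step[of x] by (meson not_le)
  qed
qed

end

instantiation xordinal :: (type) complete_linorder
begin

definition "bot = Ord (0 :: 'a ordinal)"
definition "top = (Infty :: 'a xordinal)"
definition "inf (x :: 'a xordinal) y = min x y"
definition "sup (x :: 'a xordinal) y = max x y"
definition "Inf (A :: 'a xordinal set) = (if A = {} then Infty else LEAST x. x \<in> A)"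
definition "Sup (A :: 'a xordinal set) = (LEAST x. \<forall>y\<in>A. y \<le> x)"

instance
proof
  fix x z :: "'a xordinal" and A :: "'a xordinal set"
  show "Inf A \<le> x" if "x \<in> A"
    using that by (auto simp: Inf_xordinal_def Least_le)
  show "z \<le> Inf A" if "\<And>x. x \<in> A \<Longrightarrow> z \<le> x"
    using that LeastI_ex[of "\<lambda>x. x \<in> A"] by (auto simp: Inf_xordinal_def)
  show "x \<le> Sup A" if "x \<in> A"
    using that LeastI[of "\<lambda>x. \<forall>y\<in>A. y \<le> x" Infty] by (auto simp: Sup_xordinal_def)
  show "Sup A \<le> z" if "\<And>x. x \<in> A \<Longrightarrow> x \<le> z"
    using that by (auto simp: Sup_xordinal_def intro: Least_le)
  have "Ord 0 \<le> y" for y :: "'a xordinal"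
    by (cases y) auto
  then show "Sup {} = (bot :: 'a xordinal)"
    by (auto simp: Sup_xordinal_def bot_xordinal_def intro!: Least_equality)
  show "Inf {} = (top :: 'a xordinal)"
    by (simp add: Inf_xordinal_def top_xordinal_def)
qed (auto simp: inf_xordinal_def sup_xordinal_def)

end

fun omega_times :: "'u xordinal \<Rightarrow> 'u xordinal" where
  "omega_times (Ord \<alpha>) = Ord (omega * \<alpha>)"
| "omega_times Infty = Infty"


section \<open>Banach spaces over the real or complex numbers\<close>

text \<open>
  The sort \<open>{real_normed_field, euclidean_space}\<close> stands for the scalar field: it has the instances
  \<^typ>\<open>real\<close> and \<^typ>\<open>complex\<close>, and by the Frobenius theorem no others up to isometric isomorphism.
  In both cases \<open>c \<bullet> 1\<close> is the real part of \<open>c\<close>. Since the class \<^class>\<open>banach\<close> only provides the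
  underlying real Banach space, the multiplication by scalars is an explicit operation \<open>sm\<close>.
\<close>

definition scalar_mult ::
    "('k::{real_normed_field,euclidean_space} \<Rightarrow> 'a::banach \<Rightarrow> 'a) \<Rightarrow> bool" where
  "scalar_mult sm \<longleftrightarrow>
     vector_space sm \<and>
     (\<forall>r x. sm (of_real r) x = r *\<^sub>R x) \<and>
     (\<forall>c x. norm (sm c x) = norm c * norm x)"

definition re_part :: "'k::{real_normed_field,euclidean_space} \<Rightarrow> real" where
  "re_part c = c \<bullet> 1"

lemma re_part_real: "re_part (c :: real) = c"
  by (simp add: re_part_def)

lemma re_part_complex: "re_part (c :: complex) = Re c"
  by (simp add: re_part_def inner_complex_def)

lemma scalar_mult_real: "scalar_mult ((*\<^sub>R) :: real \<Rightarrow> 'a::banach \<Rightarrow> 'a)"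
  unfolding scalar_mult_def
  by (auto intro: real_vector.vector_space_axioms)

lemma scalar_mult_complex: "scalar_mult ((*) :: complex \<Rightarrow> complex \<Rightarrow> complex)"
  unfolding scalar_mult_def
  by (auto simp: vector_space_def algebra_simps norm_mult scaleR_conv_of_real)

text \<open>The dual space, with the norm it inherits from the real-linear bounded maps.\<close>

definition dual_space :: "('k::{real_normed_field,euclidean_space} \<Rightarrow> 'a::banach \<Rightarrow> 'a) \<Rightarrow>
    ('a \<Rightarrow>\<^sub>L 'k) set" where
  "dual_space sm = {f. \<forall>c x. blinfun_apply f (sm c x) = c * blinfun_apply f x}"

lemma dual_space_real: "dual_space ((*\<^sub>R) :: real \<Rightarrow> 'a::banach \<Rightarrow> 'a) = UNIV"
  by (auto simp: dual_space_def blinfun.scaleR_right)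


section \<open>Szlenk and dentability indices\<close>

text \<open>
  On \<open>'a \<Rightarrow>\<^sub>L 'k\<close> the strong operator topology is the topology of pointwise convergence, so on
  \<^const>\<open>dual_space\<close> it induces the weak-star topology. Neighbourhoods and slices are taken in the
  whole type \<open>'a \<Rightarrow>\<^sub>L 'k\<close>; only their intersections with subsets of the dual space matter.
  The library's \<^const>\<open>diameter\<close> is real-valued, hence meaningful for bounded sets only; weak-star
  compact sets are norm bounded by the uniform boundedness principle.
\<close>

abbreviation weak_star :: "('a::banach \<Rightarrow>\<^sub>L 'k::{real_normed_field,euclidean_space}) topology" where
  "weak_star \<equiv> strong_operator_topology"

definition weak_star_nbhd :: "('a::banach \<Rightarrow>\<^sub>L 'k::{real_normed_field,euclidean_space}) \<Rightarrow>
    ('a \<Rightarrow>\<^sub>L 'k) set \<Rightarrow> bool" where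
  "weak_star_nbhd f V \<longleftrightarrow> (\<exists>U. openin weak_star U \<and> f \<in> U \<and> U \<subseteq> V)"

definition weak_star_slice ::
    "('a::banach \<Rightarrow>\<^sub>L 'k::{real_normed_field,euclidean_space}) set \<Rightarrow> bool" where
  "weak_star_slice S \<longleftrightarrow> (\<exists>x a. S = {f. re_part (blinfun_apply f x) > a})"

definition szlenk_deriv :: "real \<Rightarrow>
    ('a::banach \<Rightarrow>\<^sub>L 'k::{real_normed_field,euclidean_space}) set \<Rightarrow> ('a \<Rightarrow>\<^sub>L 'k) set" where
  "szlenk_deriv \<epsilon> K = {f \<in> K. \<forall>V. weak_star_nbhd f V \<longrightarrow> diameter (V \<inter> K) > \<epsilon>}"

definition dent_deriv :: "real \<Rightarrow>
    ('a::banach \<Rightarrow>\<^sub>L 'k::{real_normed_field,euclidean_space}) set \<Rightarrow> ('a \<Rightarrow>\<^sub>L 'k) set" where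
  "dent_deriv \<epsilon> K = {f \<in> K. \<forall>S. weak_star_slice S \<and> f \<in> S \<longrightarrow> diameter (S \<inter> K) > \<epsilon>}"

definition iterated_deriv :: "('s set \<Rightarrow> 's set) \<Rightarrow> 's set \<Rightarrow> 'u ordinal \<Rightarrow> 's set" where
  "iterated_deriv D K \<xi> = ord_rec K D Inter \<xi>"

lemma iterated_deriv_0: "iterated_deriv D K 0 = K"
  and iterated_deriv_osuc: "iterated_deriv D K (osuc \<xi>) = D (iterated_deriv D K \<xi>)"
  and iterated_deriv_limit:
    "limit_ordinal \<xi> \<Longrightarrow> iterated_deriv D K \<xi> = (\<Inter>\<zeta>\<in>{..<\<xi>}. iterated_deriv D K \<zeta>)"
  unfolding iterated_deriv_def by (rule ord_rec_0 ord_rec_osuc ord_rec_limit; assumption?)+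

definition vanishing_index :: "('s set \<Rightarrow> 's set) \<Rightarrow> 's set \<Rightarrow> 'u xordinal" where
  "vanishing_index D K =
     (if \<exists>\<xi> :: 'u ordinal. iterated_deriv D K \<xi> = {}
      then Ord (LEAST \<xi>. iterated_deriv D K \<xi> = {}) else Infty)"

text \<open>
  The indices take values in the ordinals for the type \<open>'o + ('a \<Rightarrow>\<^sub>L 'k)\<close>. The iterates form a
  decreasing chain of subsets of \<open>'a \<Rightarrow>\<^sub>L 'k\<close>, strictly decreasing as long as it is not stationary,
  so if some iterate is empty, this happens at an ordinal of cardinality at most that of
  \<open>'a \<Rightarrow>\<^sub>L 'k\<close>. The supremum over \<open>\<epsilon>\<close> is the supremum of a sequence, by monotonicity
  in \<open>\<epsilon>\<close>, so it stays below \<open>\<kappa>\<^sup>+\<close> if all its terms are ordinals. Hence the value \<^const>\<open>Infty\<close> is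
  never an artefact of the choice of \<open>'o\<close>. The
  arbitrary type \<open>'o\<close> serves to make arbitrarily large ordinals available.
\<close>

definition Szlenk_index_at ::
    "('a::banach \<Rightarrow>\<^sub>L 'k::{real_normed_field,euclidean_space}) set \<Rightarrow> real \<Rightarrow>
     ('o + ('a \<Rightarrow>\<^sub>L 'k)) xordinal" where
  "Szlenk_index_at K \<epsilon> = vanishing_index (szlenk_deriv \<epsilon>) K"

definition Szlenk_index ::
    "('a::banach \<Rightarrow>\<^sub>L 'k::{real_normed_field,euclidean_space}) set \<Rightarrow>
     ('o + ('a \<Rightarrow>\<^sub>L 'k)) xordinal" where
  "Szlenk_index K = (SUP \<epsilon>\<in>{0<..}. Szlenk_index_at K \<epsilon>)"

definition dentability_index_at ::
    "('a::banach \<Rightarrow>\<^sub>L 'k::{real_normed_field,euclidean_space}) set \<Rightarrow> real \<Rightarrow>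
     ('o + ('a \<Rightarrow>\<^sub>L 'k)) xordinal" where
  "dentability_index_at K \<epsilon> = vanishing_index (dent_deriv \<epsilon>) K"

definition dentability_index ::
    "('a::banach \<Rightarrow>\<^sub>L 'k::{real_normed_field,euclidean_space}) set \<Rightarrow>
     ('o + ('a \<Rightarrow>\<^sub>L 'k)) xordinal" where
  "dentability_index K = (SUP \<epsilon>\<in>{0<..}. dentability_index_at K \<epsilon>)"

end

theory Submission
  imports Defs
begin

text \<open>
  The set \<open>K\<close> embeds into the barycentres of the state space of \<open>C(K)\<close>, where the Szlenk derivation
  can be convexified: a derivation of a set \<open>M\<close> of states keeps the closed convex hull of those
  states all of whose neighbourhoods in \<open>M\<close> have barycentres of norm diameter more than \<open>\<epsilon>\<close>.

  Two facts are combined. First, \<open>\<omega>\<close> dentability derivations of the set of barycentres of \<open>M\<close> lead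
  into the barycentres of the hull derivation of \<open>M\<close>; this is a compactness argument with exposed
  points in finitely many coordinates. Second, if the Szlenk derivation of order \<open>\<omega>\<^bsup>\<xi>\<^esup>\<close> empties \<open>K\<close>
  for every \<open>\<epsilon>\<close>, then the hull derivation of order \<open>\<omega>\<^bsup>\<xi>\<^esup>\<close> empties the state space: a state that
  is moved substantially by arbitrarily small perturbations must have a definite amount of mass whose
  Szlenk rank jumps, so that the integral of the rank, measured in multiples of \<open>\<omega>\<^bsup>\<zeta>\<^esup>\<close>, increases
  by a constant independent of \<open>\<zeta>\<close>. Hence \<open>Dz(K) \<le> \<omega> \<cdot> \<omega>\<^bsup>\<xi>\<^esup> = \<omega>\<^bsup>1+\<xi>\<^esup>\<close>.

  For convex \<open>K\<close>, a half-size copy of \<open>K\<close> centred at a surviving point survives as well, so \<open>Sz(K)\<close>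
  is additively indecomposable, that is, a power of \<open>\<omega>\<close>, and \<open>1 + \<xi> = \<xi>\<close> for \<open>\<xi> \<ge> \<omega>\<close>.
\<close>

section \<open>Ordinal arithmetic\<close>

text \<open>Convexifying inside the dual space would lose the ranks: a point of a closed convex hull
  does not record from which points of \<open>K\<close> it was formed. A state does, and a lower
  bound for an integral is an affine condition, so it passes from a set of states to its closed
  convex hull. Ranks are only upper semicontinuous, whereas states act on continuous functions;
  lower bounds for the integral of a rank are therefore stated for all continuous majorants. The
  induction on the exponent \<zeta> has unbounded depth, so any loss in the gained constant at one
  stage would be fatal. For \<zeta> > 0 the estimate is therefore averaged: arbitrarily many blocks
  of a smaller length \<omega>^\<zeta>' fit into \<omega>^\<zeta>, while the additive error stays
  fixed, and dividing by the number of blocks removes it. In the end the constant rank 1, whose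
  integral against every state is 1, would leave a positive lower bound for the integral of
  zero.\<close>

lemma bdd_above_image_lessThan:
  fixes f :: "'u ordinal \<Rightarrow> 'u ordinal"
  shows "bdd_above (f ` {..<\<xi>})"
proof -
  include cardinal_syntax
  let ?c = "|UNIV :: ('u + nat) set|"
  let ?r = "ordinal_rel TYPE('u)"
  \<comment> \<open>A proper initial segment of the cardinal successor of \<kappa> has at most
    \<kappa> elements, which brings its images within reach of
    \<open>bdd_above_small\<close>.\<close>
  have "|underS ?r (Rep_ordinal \<xi>)| <o ?r"
    by (rule card_of_underS[OF cardSuc_Card_order[OF card_of_Card_order] Rep_ordinal])
  then have "|underS ?r (Rep_ordinal \<xi>)| \<le>o ?c"
    using cardSuc_ordLeq_ordLess[OF card_of_Card_order card_of_Card_order] by blast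
  moreover have "Rep_ordinal ` {..<\<xi>} \<subseteq> underS ?r (Rep_ordinal \<xi>)"
    by (auto simp: underS_def less_ordinal_def less_eq_ordinal_def Rep_ordinal_inject)
  then have "|{..<\<xi>}| \<le>o |underS ?r (Rep_ordinal \<xi>)|"
    by (intro card_of_ordLeqI[where f = Rep_ordinal]) (auto simp: inj_on_def Rep_ordinal_inject)
  ultimately have "|{..<\<xi>}| \<le>o ?c"
    by (rule ordLeq_transitive[rotated])
  then have "|f ` {..<\<xi>}| \<le>o ?c"
    by (rule ordLeq_transitive[OF card_of_image])
  then show ?thesis
    by (rule bdd_above_small)
qed

lemma osuc_le_iff: "osuc \<alpha> \<le> \<beta> \<longleftrightarrow> \<alpha> < (\<beta> :: 'u ordinal)"
  by (metis less_osuc_iff not_le)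

lemma osuc_less_osuc_iff [simp]: "osuc \<alpha> < osuc \<beta> \<longleftrightarrow> \<alpha> < (\<beta> :: 'u ordinal)"
  by (metis less_osuc_iff osuc_le_iff)

lemma osuc_le_osuc_iff [simp]: "osuc \<alpha> \<le> osuc \<beta> \<longleftrightarrow> \<alpha> \<le> (\<beta> :: 'u ordinal)"
  by (meson not_le osuc_less_osuc_iff)

lemma osuc_neq_0 [simp]: "osuc \<alpha> \<noteq> (0 :: 'u ordinal)"
  by (metis less_osuc not_le zero_le_ordinal)

lemma not_less_0_ordinal [simp]: "\<not> \<alpha> < (0 :: 'u ordinal)"
  by (simp add: not_less)

lemma ordinal_gr_0: "0 < (\<alpha> :: 'u ordinal) \<longleftrightarrow> \<alpha> \<noteq> 0"
  by (metis antisym_conv2 zero_le_ordinal)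

lemma limit_ordinal_osuc_less: "limit_ordinal \<kappa> \<Longrightarrow> \<alpha> < \<kappa> \<Longrightarrow> osuc \<alpha> < \<kappa>"
  unfolding limit_ordinal_def by (metis osuc_le_iff order_le_less)

lemma limit_ordinal_gr_0: "limit_ordinal \<kappa> \<Longrightarrow> 0 < \<kappa>"
  by (simp add: limit_ordinal_def ordinal_gr_0)

lemma limit_ordinalI:
  "\<kappa> \<noteq> 0 \<Longrightarrow> (\<And>\<alpha>. \<alpha> < \<kappa> \<Longrightarrow> osuc \<alpha> < \<kappa>) \<Longrightarrow> limit_ordinal (\<kappa> :: 'u ordinal)"
  unfolding limit_ordinal_def by (metis less_irrefl less_osuc)

lemma ordinal_cases [case_names zero osuc limit]:
  fixes \<alpha> :: "'u ordinal"
  obtains "\<alpha> = 0" | \<beta> where "\<alpha> = osuc \<beta>" | "limit_ordinal \<alpha>"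
  unfolding limit_ordinal_def by blast

lemma ordinal_induct [case_names zero osuc limit]:
  fixes \<alpha> :: "'u ordinal"
  assumes "P 0" and "\<And>\<beta>. P \<beta> \<Longrightarrow> P (osuc \<beta>)"
    and "\<And>\<kappa>. limit_ordinal \<kappa> \<Longrightarrow> (\<And>\<beta>. \<beta> < \<kappa> \<Longrightarrow> P \<beta>) \<Longrightarrow> P \<kappa>"
  shows "P \<alpha>"
proof (induction \<alpha> rule: less_induct)
  case (less \<alpha>)
  then show ?case
    using assms by (cases \<alpha> rule: ordinal_cases) auto
qed

lemma cSup_le_ordinal:
  fixes A :: "'u ordinal set"
  shows "(\<And>x. x \<in> A \<Longrightarrow> x \<le> b) \<Longrightarrow> Sup A \<le> b"
  by (auto simp: Sup_ordinal_def intro: Least_le)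

lemma Sup_lessThan_limit:
  assumes "limit_ordinal (\<kappa> :: 'u ordinal)"
  shows "Sup {..<\<kappa>} = \<kappa>"
proof (rule antisym)
  show "Sup {..<\<kappa>} \<le> \<kappa>"
    by (rule cSup_le_ordinal) auto
  have "bdd_above {..<\<kappa>}"
    by auto
  then have "\<alpha> < Sup {..<\<kappa>}" if "\<alpha> < \<kappa>" for \<alpha>
    using that limit_ordinal_osuc_less[OF assms that] 
    by (metis cSup_upper lessThan_iff less_osuc order_less_le_trans)
  then show "\<kappa> \<le> Sup {..<\<kappa>}"
    using not_le by blast
qed

text \<open>Unlike usual, a normal function need not be strictly increasing: \<open>\<beta> \<mapsto> \<alpha> * \<beta>\<close> is to be normal
  for \<open>\<alpha> = 0\<close> as well.\<close>

definition normal_fun :: "('u ordinal \<Rightarrow> 'u ordinal) \<Rightarrow> bool" where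
  "normal_fun f \<longleftrightarrow> mono f \<and> (\<forall>\<kappa>. limit_ordinal \<kappa> \<longrightarrow> f \<kappa> = Sup (f ` {..<\<kappa>}))"

lemma normal_funI:
  fixes f :: "'u ordinal \<Rightarrow> 'u ordinal"
  assumes step: "\<And>\<alpha>. f \<alpha> \<le> f (osuc \<alpha>)"
    and lim: "\<And>\<kappa>. limit_ordinal \<kappa> \<Longrightarrow> f \<kappa> = Sup (f ` {..<\<kappa>})"
  shows "normal_fun f"
proof -
  have "\<alpha> \<le> \<beta> \<Longrightarrow> f \<alpha> \<le> f \<beta>" for \<alpha> \<beta>
  proof (induction \<beta> rule: ordinal_induct)
    case zero
    then show ?case
      by (metis order_antisym order_refl zero_le_ordinal)
  next
    case (osuc \<beta>)
    then show ?case
      using step[of \<beta>] by (metis less_osuc_iff order_le_less order_trans order_refl)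
  next
    case (limit \<kappa>)
    show ?case
    proof (cases "\<alpha> = \<kappa>")
      case False
      then have "\<alpha> < \<kappa>"
        using limit by auto
      then show ?thesis
        unfolding lim[OF limit(1)] by (intro cSup_upper bdd_above_image_lessThan) auto
    qed simp
  qed
  then show ?thesis
    using lim by (auto simp: normal_fun_def mono_def)
qed

lemma normal_fun_mono: "normal_fun f \<Longrightarrow> \<alpha> \<le> \<beta> \<Longrightarrow> f \<alpha> \<le> f \<beta>"
  by (simp add: normal_fun_def monoD)

lemma normal_fun_limit: "normal_fun f \<Longrightarrow> limit_ordinal \<kappa> \<Longrightarrow> f \<kappa> = Sup (f ` {..<\<kappa>})"
  by (simp add: normal_fun_def)

lemma normal_fun_less_limit:
  assumes "normal_fun f" "limit_ordinal \<kappa>" "\<alpha> < f \<kappa>"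
  obtains \<beta> where "\<beta> < \<kappa>" "\<alpha> < f \<beta>"
proof -
  have "\<not> (\<forall>\<beta><\<kappa>. f \<beta> \<le> \<alpha>)"
  proof
    assume "\<forall>\<beta><\<kappa>. f \<beta> \<le> \<alpha>"
    then have "f \<kappa> \<le> \<alpha>"
      unfolding normal_fun_limit[OF assms(1,2)] by (intro cSup_le_ordinal) auto
    then show False
      using assms(3) by simp
  qed
  then show ?thesis
    using that by (meson not_le)
qed

text \<open>As \<open>f\<close> need not be strictly increasing, it may reach
  \<open>f \<kappa>\<close> already below \<kappa>. Otherwise every \<alpha> below
  \<open>f \<kappa>\<close> is below some \<open>f \<beta>\<close> that is itself smaller than
  \<open>f \<kappa>\<close>, which leaves room for the successor of \<alpha>.\<close>

lemma normal_fun_limit_cases: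
  assumes "normal_fun f" "limit_ordinal \<kappa>"
  obtains \<beta> where "\<beta> < \<kappa>" "f \<kappa> = f \<beta>" | "limit_ordinal (f \<kappa>)"
proof (cases "\<exists>\<beta><\<kappa>. f \<kappa> \<le> f \<beta>")
  case True
  then show ?thesis
    using that(1) normal_fun_mono[OF assms(1)] by (meson less_imp_le order_antisym)
next
  case False
  have "limit_ordinal (f \<kappa>)"
  proof (rule limit_ordinalI)
    show "f \<kappa> \<noteq> 0"
      using False limit_ordinal_gr_0[OF assms(2)] by (metis zero_le_ordinal)
    fix \<alpha> assume "\<alpha> < f \<kappa>"
    then obtain \<beta> where "\<beta> < \<kappa>" "\<alpha> < f \<beta>"
      using normal_fun_less_limit[OF assms] by blast
    then show "osuc \<alpha> < f \<kappa>"
      using False by (metis not_le order_le_less_trans osuc_le_iff)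
  qed
  then show ?thesis
    by (rule that(2))
qed

lemma normal_fun_compose:
  assumes f: "normal_fun f" and g: "normal_fun g"
  shows "normal_fun (\<lambda>\<alpha>. f (g \<alpha>))"
proof -
  have "f (g \<kappa>) = Sup ((\<lambda>\<alpha>. f (g \<alpha>)) ` {..<\<kappa>})" if l: "limit_ordinal \<kappa>" for \<kappa>
  proof (rule antisym)
    have up: "f (g \<alpha>) \<le> Sup ((\<lambda>\<alpha>. f (g \<alpha>)) ` {..<\<kappa>})" if "\<alpha> < \<kappa>" for \<alpha>
      using that by (intro cSup_upper bdd_above_image_lessThan) auto
    show "Sup ((\<lambda>\<alpha>. f (g \<alpha>)) ` {..<\<kappa>}) \<le> f (g \<kappa>)"
      by (intro cSup_le_ordinal) (auto intro: normal_fun_mono[OF f normal_fun_mono[OF g]] less_imp_le)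
    show "f (g \<kappa>) \<le> Sup ((\<lambda>\<alpha>. f (g \<alpha>)) ` {..<\<kappa>})"
      using g l
    proof (cases rule: normal_fun_limit_cases)
      case 1
      then show ?thesis
        using up by metis
    next
      case 2
      show ?thesis
        unfolding normal_fun_limit[OF f 2]
      proof (rule cSup_le_ordinal)
        fix x assume "x \<in> f ` {..<g \<kappa>}"
        then obtain \<alpha> where "\<alpha> < g \<kappa>" "x = f \<alpha>"
          by auto
        then obtain \<beta> where "\<beta> < \<kappa>" "\<alpha> < g \<beta>"
          using normal_fun_less_limit[OF g l] by blast
        then show "x \<le> Sup ((\<lambda>\<alpha>. f (g \<alpha>)) ` {..<\<kappa>})"
          using up normal_fun_mono[OF f] \<open>x = f \<alpha>\<close> by (meson less_imp_le order_trans)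
      qed
    qed
  qed
  then show ?thesis
    using f g by (auto simp: normal_fun_def mono_def)
qed

text \<open>Limits take care of themselves, so an identity between normal functions reduces to zero
  and successors. Together with \<open>normal_fun_compose\<close> this yields associativity and
  distributivity.\<close>

lemma normal_fun_eqI:
  assumes f: "normal_fun f" and g: "normal_fun g" and "f 0 = g 0"
    and "\<And>\<beta>. f \<beta> = g \<beta> \<Longrightarrow> f (osuc \<beta>) = g (osuc \<beta>)"
  shows "f \<alpha> = g \<alpha>"
proof (induction \<alpha> rule: ordinal_induct)
  case (limit \<kappa>)
  then have "f ` {..<\<kappa>} = g ` {..<\<kappa>}"
    by auto
  then show ?case
    using limit(1) f g by (simp add: normal_fun_limit)
qed (use assms in auto)

section \<open>Ordinal addition and multiplication\<close>

lemma ordinal_add_0 [simp]: "\<alpha> + 0 = (\<alpha> :: 'u ordinal)"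
  by (simp add: plus_ordinal_def ord_rec_0)

lemma ordinal_add_osuc [simp]: "\<alpha> + osuc \<beta> = osuc (\<alpha> + \<beta> :: 'u ordinal)"
  by (simp add: plus_ordinal_def ord_rec_osuc)

lemma normal_fun_add: "normal_fun (\<lambda>\<beta>. \<alpha> + \<beta> :: 'u ordinal)"
  by (rule normal_funI) (auto simp: less_imp_le, simp add: plus_ordinal_def ord_rec_limit)

lemma normal_fun_id: "normal_fun (\<lambda>\<beta>. \<beta>)"
  by (auto simp: normal_fun_def mono_def Sup_lessThan_limit)

lemma ordinal_0_add [simp]: "0 + \<alpha> = (\<alpha> :: 'u ordinal)"
  by (rule normal_fun_eqI[OF normal_fun_add normal_fun_id]) auto

lemma ordinal_le_add: "\<alpha> \<le> \<alpha> + (\<beta> :: 'u ordinal)"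
  using normal_fun_mono[OF normal_fun_add, of 0 \<beta> \<alpha>] by simp

lemma ordinal_add_assoc: "(\<alpha> + \<beta>) + \<gamma> = \<alpha> + (\<beta> + \<gamma> :: 'u ordinal)"
  by (rule normal_fun_eqI[OF normal_fun_add normal_fun_compose[OF normal_fun_add normal_fun_add]])
    auto

lemma ordinal_add_strict_mono: "\<beta> < \<gamma> \<Longrightarrow> \<alpha> + \<beta> < \<alpha> + (\<gamma> :: 'u ordinal)"
  using normal_fun_mono[OF normal_fun_add, of "osuc \<beta>" \<gamma> \<alpha>] by (simp add: osuc_le_iff)

lemma ordinal_le_add2: "\<beta> \<le> \<alpha> + (\<beta> :: 'u ordinal)"
proof (induction \<beta> rule: ordinal_induct)
  case (limit \<kappa>)
  have "\<beta> < \<alpha> + \<kappa>" if "\<beta> < \<kappa>" for \<beta>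
    using limit(2)[OF that] ordinal_add_strict_mono[OF that, of \<alpha>] by simp
  then show ?case
    using not_le by blast
qed auto

lemma ordinal_add_left_mono: "\<alpha> \<le> \<beta> \<Longrightarrow> \<alpha> + \<gamma> \<le> \<beta> + (\<gamma> :: 'u ordinal)"
proof (induction \<gamma> rule: ordinal_induct)
  case (limit \<kappa>)
  have "\<alpha> + \<gamma> \<le> \<beta> + \<kappa>" if "\<gamma> < \<kappa>" for \<gamma>
    using limit(2)[OF that limit(3)] normal_fun_mono[OF normal_fun_add, of \<gamma> \<kappa> \<beta>] that
    by (meson less_imp_le order_trans)
  then show ?case
    unfolding normal_fun_limit[OF normal_fun_add limit(1), of \<alpha>]
    by (intro cSup_le_ordinal) auto
qed auto

lemma ordinal_mult_0 [simp]: "\<alpha> * 0 = (0 :: 'u ordinal)"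
  by (simp add: times_ordinal_def ord_rec_0)

lemma ordinal_mult_osuc [simp]: "\<alpha> * osuc \<beta> = \<alpha> * \<beta> + (\<alpha> :: 'u ordinal)"
  by (simp add: times_ordinal_def ord_rec_osuc)

lemma normal_fun_mult: "normal_fun (\<lambda>\<beta>. \<alpha> * \<beta> :: 'u ordinal)"
  by (rule normal_funI) (auto simp: ordinal_le_add, simp add: times_ordinal_def ord_rec_limit)

lemma ordinal_add_1: "\<alpha> + 1 = osuc (\<alpha> :: 'u ordinal)"
  by (simp add: one_ordinal_def)

lemma ordinal_mult_1 [simp]: "\<alpha> * 1 = (\<alpha> :: 'u ordinal)"
  by (simp add: one_ordinal_def)

lemma ordinal_1_mult [simp]: "1 * \<alpha> = (\<alpha> :: 'u ordinal)"
  by (rule normal_fun_eqI[OF normal_fun_mult normal_fun_id]) (auto simp: ordinal_add_1)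

lemma ordinal_distrib: "\<alpha> * (\<beta> + \<gamma>) = \<alpha> * \<beta> + \<alpha> * (\<gamma> :: 'u ordinal)"
  by (rule normal_fun_eqI[OF normal_fun_compose[OF normal_fun_mult normal_fun_add]
        normal_fun_compose[OF normal_fun_add normal_fun_mult]])
    (auto simp: ordinal_add_assoc)

lemma ordinal_mult_assoc: "(\<alpha> * \<beta>) * \<gamma> = \<alpha> * (\<beta> * \<gamma> :: 'u ordinal)"
  by (rule normal_fun_eqI[OF normal_fun_mult normal_fun_compose[OF normal_fun_mult normal_fun_mult]])
    (auto simp: ordinal_distrib)

section \<open>Powers of omega\<close>

lemma omega_power_0 [simp]: "omega_power 0 = 1"
  by (simp add: omega_power_def ord_rec_0)

lemma omega_power_osuc [simp]: "omega_power (osuc \<xi>) = omega_power \<xi> * omega"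
  by (simp add: omega_power_def ord_rec_osuc)

lemma less_omega: "(osuc ^^ n) 0 < omega"
  using less_omega_iff by blast

lemma limit_ordinal_omega: "limit_ordinal omega"
proof (rule limit_ordinalI)
  show "omega \<noteq> 0"
    by (metis less_omega not_less_0_ordinal)
  show "osuc \<alpha> < omega" if "\<alpha> < omega" for \<alpha>
    using that unfolding less_omega_iff by (metis funpow.simps(2) comp_apply)
qed

lemma ordinal_mult_omega_ge: "\<alpha> \<le> \<alpha> * (omega :: 'u ordinal)"
proof -
  have "1 < (omega :: 'u ordinal)"
    using less_omega[of 1] by (simp add: one_ordinal_def)
  then show ?thesis
    using normal_fun_mono[OF normal_fun_mult, of 1 omega \<alpha>] by (simp add: less_imp_le)
qed

lemma normal_fun_omega_power: "normal_fun omega_power"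
  by (rule normal_funI) (auto simp: ordinal_mult_omega_ge, simp add: omega_power_def ord_rec_limit)

lemma omega_power_ge_1: "1 \<le> omega_power \<xi>"
  using normal_fun_mono[OF normal_fun_omega_power, of 0 \<xi>] by simp

lemma omega_power_gr_0: "0 < omega_power \<xi>"
  using omega_power_ge_1[of \<xi>] by (simp add: one_ordinal_def osuc_le_iff)

lemma omega_power_less_osuc: "omega_power \<xi> < omega_power (osuc \<xi>)"
proof -
  have "omega_power \<xi> < omega_power \<xi> + omega_power \<xi>"
    using ordinal_add_strict_mono[OF omega_power_gr_0[of \<xi>], of "omega_power \<xi>"] by simp
  also have "\<dots> = omega_power \<xi> * (osuc ^^ 2) 0"
    by (simp add: numeral_2_eq_2)
  also have "\<dots> \<le> omega_power \<xi> * omega"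
    by (rule normal_fun_mono[OF normal_fun_mult less_imp_le[OF less_omega]])
  finally show ?thesis
    by simp
qed

lemma omega_power_strict_mono: "\<xi> < \<zeta> \<Longrightarrow> omega_power \<xi> < omega_power \<zeta>"
  using omega_power_less_osuc normal_fun_mono[OF normal_fun_omega_power] osuc_le_iff
  by (metis order_less_le_trans)

lemma le_omega_power: "\<xi> \<le> omega_power \<xi>"
proof (induction \<xi> rule: less_induct)
  case (less \<xi>)
  have "\<zeta> < omega_power \<xi>" if "\<zeta> < \<xi>" for \<zeta>
    using less[OF that] omega_power_strict_mono[OF that] by simp
  then show ?case
    using not_le by blast
qed

text \<open>Successor and limit exponents are put into one form, with \<open>n\<close> = 1 sufficing
  for a limit. This replaces fewer than \<omega>^\<xi> derivations by finitely many blocks of length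
  \<omega>^\<zeta>.\<close>

lemma less_omega_powerE:
  assumes "\<alpha> < omega_power \<xi>" "\<xi> \<noteq> 0"
  obtains \<zeta> n where "\<zeta> < \<xi>" "\<alpha> \<le> omega_power \<zeta> * (osuc ^^ n) 0"
proof (cases \<xi> rule: ordinal_cases)
  case (osuc \<zeta>)
  then have "\<alpha> < omega_power \<zeta> * omega"
    using assms by simp
  then obtain \<beta> where "\<beta> < omega" "\<alpha> < omega_power \<zeta> * \<beta>"
    using normal_fun_less_limit[OF normal_fun_mult limit_ordinal_omega] by blast
  then show ?thesis
    using that osuc unfolding less_omega_iff by (metis less_imp_le less_osuc)
next
  case limit
  then obtain \<zeta> where "\<zeta> < \<xi>" "\<alpha> < omega_power \<zeta>"
    using normal_fun_less_limit[OF normal_fun_omega_power limit] assms by blast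
  then show ?thesis
    using that[of \<zeta> 1] by (simp add: less_imp_le)
qed (use assms in auto)

lemma omega_power_mult_nat_less:
  assumes "\<zeta> < \<xi>"
  shows "omega_power \<zeta> * (osuc ^^ n) 0 < omega_power \<xi>"
proof -
  have "omega_power \<zeta> * (osuc ^^ n) 0 + 0 < omega_power \<zeta> * (osuc ^^ n) 0 + omega_power \<zeta>"
    by (rule ordinal_add_strict_mono[OF omega_power_gr_0])
  also have "\<dots> = omega_power \<zeta> * (osuc ^^ Suc n) 0"
    by simp
  also have "\<dots> \<le> omega_power \<zeta> * omega"
    by (rule normal_fun_mono[OF normal_fun_mult less_imp_le[OF less_omega]])
  also have "\<dots> \<le> omega_power \<xi>"
    using normal_fun_mono[OF normal_fun_omega_power, of "osuc \<zeta>" \<xi>] assms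
    by (simp add: osuc_le_iff)
  finally show ?thesis
    by simp
qed

lemma limit_ordinal_omega_power:
  assumes "\<xi> \<noteq> 0"
  shows "limit_ordinal (omega_power \<xi>)"
proof (rule limit_ordinalI)
  show "omega_power \<xi> \<noteq> 0"
    using omega_power_gr_0[of \<xi>] by auto
  fix \<alpha> assume "\<alpha> < omega_power \<xi>"
  then obtain \<zeta> n where z: "\<zeta> < \<xi>" "\<alpha> \<le> omega_power \<zeta> * (osuc ^^ n) 0"
    using less_omega_powerE assms by blast
  have "osuc \<alpha> \<le> omega_power \<zeta> * (osuc ^^ n) 0 + 1"
    using z by (simp add: ordinal_add_1)
  also have "\<dots> \<le> omega_power \<zeta> * (osuc ^^ Suc n) 0"
    using normal_fun_mono[OF normal_fun_add omega_power_ge_1] by simp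
  finally show "osuc \<alpha> < omega_power \<xi>"
    using omega_power_mult_nat_less[OF z(1)] order_le_less_trans by blast
qed

lemma omega_power_1: "omega_power 1 = omega"
  by (simp add: one_ordinal_def) (simp flip: one_ordinal_def)

text \<open>Both sides are normal in \<xi>, equal \<omega> at zero, and are multiplied by \<omega>
  on the right when \<xi> passes to its successor.\<close>

lemma omega_mult_omega_power: "omega * omega_power \<xi> = omega_power (1 + \<xi>)"
  by (rule normal_fun_eqI[OF normal_fun_compose[OF normal_fun_mult normal_fun_omega_power]
        normal_fun_compose[OF normal_fun_omega_power normal_fun_add]])
    (auto simp: omega_power_1 ordinal_mult_assoc[symmetric])

lemma one_add_absorb:
  assumes "omega \<le> \<xi>"
  shows "1 + \<xi> = (\<xi> :: 'u ordinal)"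
proof (rule antisym)
  show "1 + \<xi> \<le> \<xi>"
    using assms
  proof (induction \<xi> rule: ordinal_induct)
    case zero
    then show ?case
      using limit_ordinal_gr_0[OF limit_ordinal_omega] by (meson not_less_0_ordinal order_less_le_trans)
  next
    case (osuc \<beta>)
    then have "omega \<le> \<beta>"
      using limit_ordinal_omega unfolding limit_ordinal_def
      by (metis less_osuc_iff order_le_less)
    then show ?case
      using osuc by simp
  next
    case (limit \<kappa>)
    show ?case
      unfolding normal_fun_limit[OF normal_fun_add limit(1), of 1]
    proof (rule cSup_le_ordinal)
      fix x assume "x \<in> (+) 1 ` {..<\<kappa>}"
      then obtain \<beta> where b: "\<beta> < \<kappa>" "x = 1 + \<beta>"
        by auto
      show "x \<le> \<kappa>"
      \<comment> \<open>The induction hypothesis says nothing about finite \<beta>, which occur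
        below every limit; adding one keeps them finite, hence below \<omega>.\<close>
      proof (cases "omega \<le> \<beta>")
        case True
        then show ?thesis
          using limit b by fastforce
      next
        case False
        then obtain n where n: "\<beta> = (osuc ^^ n) 0"
          using less_omega_iff not_le by blast
        have "1 + (osuc ^^ n) 0 = (osuc ^^ Suc n) (0 :: 'u ordinal)"
          by (induction n) (auto simp: one_ordinal_def)
        then have "x < omega"
          using less_omega b n by metis
        then show ?thesis
          using limit(3) by simp
      qed
    qed
  qed
qed (rule ordinal_le_add2)

text \<open>For the least \<xi> with \<kappa> < \<omega>^\<xi> there is \<zeta> < \<xi> such that
  \<kappa> lies between \<omega>^\<zeta> and a finite multiple of it. If \<omega>^\<zeta> were
  smaller than \<kappa>, repeated addition would keep that multiple below \<kappa>.\<close>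

lemma additively_indecomposable_imp_omega_power:
  fixes \<kappa> :: "'u ordinal"
  assumes "\<kappa> \<noteq> 0" and indec: "\<And>\<alpha>. \<alpha> < \<kappa> \<Longrightarrow> \<alpha> + \<alpha> < \<kappa>"
  obtains \<xi> where "\<kappa> = omega_power \<xi>"
proof -
  define \<xi> where "\<xi> = (LEAST \<xi>. \<kappa> < omega_power \<xi>)"
  have "\<kappa> < omega_power (osuc \<kappa>)"
    using le_omega_power[of "osuc \<kappa>"] less_osuc order_less_le_trans by blast
  then have x: "\<kappa> < omega_power \<xi>"
    unfolding \<xi>_def by (rule LeastI)
  have least: "omega_power \<zeta> \<le> \<kappa>" if "\<zeta> < \<xi>" for \<zeta>
    using not_less_Least[of \<zeta> "\<lambda>\<xi>. \<kappa> < omega_power \<xi>"] that by (auto simp: \<xi>_def)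
  have "\<xi> \<noteq> 0"
    using x assms(1) by (auto simp: one_ordinal_def less_osuc_iff) (metis antisym zero_le_ordinal)
  then obtain \<zeta> n where z: "\<zeta> < \<xi>" "\<kappa> \<le> omega_power \<zeta> * (osuc ^^ n) 0"
    using less_omega_powerE x by blast
  have "\<kappa> = omega_power \<zeta>"
  proof (rule ccontr)
    assume "\<kappa> \<noteq> omega_power \<zeta>"
    then have lt: "omega_power \<zeta> < \<kappa>"
      using least[OF z(1)] by auto
    have add: "\<alpha> + \<beta> < \<kappa>" if "\<alpha> < \<kappa>" "\<beta> < \<kappa>" for \<alpha> \<beta>
    proof -
      have "\<alpha> + \<beta> \<le> max \<alpha> \<beta> + max \<alpha> \<beta>"
        by (meson max.cobounded1 max.cobounded2 normal_fun_add normal_fun_mono order_trans ordinal_add_left_mono)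
      also have "\<dots> < \<kappa>"
        using that by (intro indec) auto
      finally show ?thesis .
    qed
    have "omega_power \<zeta> * (osuc ^^ n) 0 < \<kappa>"
      using assms(1) lt by (induction n) (auto simp: ordinal_gr_0 intro: add)
    then show False
      using z(2) by simp
  qed
  then show ?thesis
    using that by blast
qed

section \<open>Transfinite iteration of derivations\<close>

lemma iterated_deriv_antimono:
  assumes "\<And>A. D A \<subseteq> A" and "\<alpha> \<le> \<beta>"
  shows "iterated_deriv D K \<beta> \<subseteq> iterated_deriv D K \<alpha>"
  using assms(2)
proof (induction \<beta> rule: ordinal_induct)
  case zero
  then show ?case
    by (metis order_antisym order_refl zero_le_ordinal)
next
  case (osuc \<beta>)
  show ?case
  proof (cases "\<alpha> \<le> \<beta>")
    case True
    then show ?thesis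
      using osuc(1) assms(1) by (fastforce simp: iterated_deriv_osuc)
  next
    case False
    then have "\<alpha> = osuc \<beta>"
      using osuc(2) by (metis less_osuc_iff order_le_less)
    then show ?thesis
      by simp
  qed
next
  case (limit \<kappa>)
  show ?case
  proof (cases "\<alpha> = \<kappa>")
    case False
    then show ?thesis
      using limit by (auto simp: iterated_deriv_limit)
  qed simp
qed

lemma iterated_deriv_subset: "(\<And>A. D A \<subseteq> A) \<Longrightarrow> iterated_deriv D K \<alpha> \<subseteq> K"
  using iterated_deriv_antimono[of D 0 \<alpha> K] by (simp add: iterated_deriv_0)

text \<open>Meant for lengths such as \<open>\<alpha> + \<kappa>\<close> and
  \<open>\<alpha> * \<kappa>\<close>, which are not limits by their form, so that
  \<open>iterated_deriv_limit\<close> does not apply to them directly.\<close>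

lemma iterated_deriv_normal_fun_limit:
  assumes D: "\<And>A. D A \<subseteq> A" and f: "normal_fun f" and l: "limit_ordinal \<kappa>"
  shows "iterated_deriv D K (f \<kappa>) = (\<Inter>\<alpha>\<in>{..<\<kappa>}. iterated_deriv D K (f \<alpha>))"
proof
  show "iterated_deriv D K (f \<kappa>) \<subseteq> (\<Inter>\<alpha>\<in>{..<\<kappa>}. iterated_deriv D K (f \<alpha>))"
    by (intro INT_greatest iterated_deriv_antimono D normal_fun_mono[OF f]) auto
  show "(\<Inter>\<alpha>\<in>{..<\<kappa>}. iterated_deriv D K (f \<alpha>)) \<subseteq> iterated_deriv D K (f \<kappa>)"
    using f l
  proof (cases rule: normal_fun_limit_cases)
    case (1 \<beta>)
    then show ?thesis
      by auto
  next
    case 2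
    have "x \<in> iterated_deriv D K \<gamma>"
      if x: "\<And>\<alpha>. \<alpha> < \<kappa> \<Longrightarrow> x \<in> iterated_deriv D K (f \<alpha>)" and "\<gamma> < f \<kappa>" for x \<gamma>
    proof -
      obtain \<beta> where "\<beta> < \<kappa>" "\<gamma> < f \<beta>"
        using normal_fun_less_limit[OF f l \<open>\<gamma> < f \<kappa>\<close>] by blast
      then show ?thesis
        using x[of \<beta>] iterated_deriv_antimono[OF D less_imp_le, of \<gamma> "f \<beta>" K] by auto
    qed
    then show ?thesis
      by (auto simp: iterated_deriv_limit[OF 2])
  qed
qed

lemma iterated_deriv_add:
  assumes D: "\<And>A. D A \<subseteq> A"
  shows "iterated_deriv D K (\<alpha> + \<beta>) = iterated_deriv D (iterated_deriv D K \<alpha>) \<beta>"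
proof (induction \<beta> rule: ordinal_induct)
  case (limit \<kappa>)
  then show ?case
    by (simp add: iterated_deriv_normal_fun_limit[OF D normal_fun_add] iterated_deriv_limit)
qed (auto simp: iterated_deriv_0 iterated_deriv_osuc)

lemma iterated_deriv_mono:
  assumes "\<And>A A'. A \<subseteq> A' \<Longrightarrow> D A \<subseteq> D' A'" and "K \<subseteq> K'"
  shows "iterated_deriv D K \<alpha> \<subseteq> iterated_deriv D' K' \<alpha>"
proof (induction \<alpha> rule: ordinal_induct)
  case (limit \<kappa>)
  then show ?case
    by (force simp: iterated_deriv_limit)
qed (use assms in \<open>simp_all add: iterated_deriv_0 iterated_deriv_osuc\<close>)

lemma iterated_deriv_nat:
  "iterated_deriv D K ((osuc ^^ n) 0) = (D ^^ n) K"
  by (induction n) (auto simp: iterated_deriv_0 iterated_deriv_osuc)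

lemma iterated_deriv_omega:
  "iterated_deriv D K (omega :: 'u ordinal) = (\<Inter>n. (D ^^ n) K)"
proof -
  have "{..<omega :: 'u ordinal} = range (\<lambda>n. (osuc ^^ n) 0)"
    by (auto simp: less_omega_iff)
  then show ?thesis
    by (simp add: iterated_deriv_limit limit_ordinal_omega iterated_deriv_nat)
qed

section \<open>Weak-star derivations of sets of real functions\<close>

lemma open_vimage_coordinate: "open W \<Longrightarrow> open ((\<lambda>h :: 'a \<Rightarrow> 'b::topological_space. h x) -` W)"
  by (rule open_vimage[OF _ continuous_on_product_coordinates])

text \<open>Distinct functions differ in a coordinate, and the separating open sets are pulled back
  along it. What matters later is the Hausdorff case: compact sets of functions are closed.\<close>

instance "fun" :: (type, t0_space) t0_space
proof
  fix f g :: "'a \<Rightarrow> 'b"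
  assume "f \<noteq> g"
  then obtain x where "f x \<noteq> g x"
    by auto
  then obtain U where "open U" "\<not> (f x \<in> U \<longleftrightarrow> g x \<in> U)"
    using t0_space_class.t0_space[OF \<open>f x \<noteq> g x\<close>] by blast
  then show "\<exists>U. open U \<and> \<not> (f \<in> U \<longleftrightarrow> g \<in> U)"
    by (intro exI[of _ "(\<lambda>h. h x) -` U"]) (simp add: open_vimage_coordinate)
qed

instance "fun" :: (type, t1_space) t1_space
proof
  fix f g :: "'a \<Rightarrow> 'b"
  assume "f \<noteq> g"
  then obtain x where "f x \<noteq> g x"
    by auto
  then obtain U where "open U" "f x \<in> U" "g x \<notin> U"
    using t1_space_class.t1_space[OF \<open>f x \<noteq> g x\<close>] by blast
  then show "\<exists>U. open U \<and> f \<in> U \<and> g \<notin> U"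
    by (intro exI[of _ "(\<lambda>h. h x) -` U"]) (simp add: open_vimage_coordinate)
qed

instance "fun" :: (type, t2_space) t2_space
proof
  fix f g :: "'a \<Rightarrow> 'b"
  assume "f \<noteq> g"
  then obtain x where "f x \<noteq> g x"
    by auto
  then obtain U V where "open U" "open V" "f x \<in> U" "g x \<in> V" "U \<inter> V = {}"
    using hausdorff[OF \<open>f x \<noteq> g x\<close>] by blast
  then show "\<exists>U V. open U \<and> open V \<and> f \<in> U \<and> g \<in> V \<and> U \<inter> V = {}"
    by (intro exI[of _ "(\<lambda>h. h x) -` U"] exI[of _ "(\<lambda>h. h x) -` V"])
      (auto simp: open_vimage_coordinate)
qed

lemma compact_iterated_deriv:
  fixes K :: "'s::t2_space set" and \<alpha> :: "'u ordinal"
  assumes "\<And>A. compact A \<Longrightarrow> compact (D A)" and "compact K"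
  shows "compact (iterated_deriv D K \<alpha>)"
proof (induction \<alpha> rule: ordinal_induct)
  case (limit \<kappa>)
  have "iterated_deriv D K \<kappa> = iterated_deriv D K (0 :: 'u ordinal) \<inter> (\<Inter>\<zeta>\<in>{..<\<kappa>}. iterated_deriv D K \<zeta>)"
    unfolding iterated_deriv_limit[OF limit(1)]
    by (rule Int_absorb1[symmetric], rule INT_lower) (simp add: limit_ordinal_gr_0 limit(1))
  moreover have "closed (\<Inter>\<zeta>\<in>{..<\<kappa>}. iterated_deriv D K \<zeta>)"
    using limit by (intro closed_INT ballI compact_imp_closed) auto
  moreover have "compact (iterated_deriv D K (0 :: 'u ordinal))"
    using limit limit_ordinal_gr_0 by blast
  ultimately show ?case
    by (simp add: compact_Int_closed)
qed (use assms in \<open>auto simp: iterated_deriv_0 iterated_deriv_osuc\<close>)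

lemma compact_chain_INT_nonempty:
  fixes A :: "'b::linorder \<Rightarrow> 's::t2_space set"
  assumes "\<And>i. i \<in> I \<Longrightarrow> compact (A i)" "\<And>i. i \<in> I \<Longrightarrow> A i \<noteq> {}"
    and mono: "\<And>i j. i \<in> I \<Longrightarrow> j \<in> I \<Longrightarrow> i \<le> j \<Longrightarrow> A j \<subseteq> A i" and "I \<noteq> {}"
  shows "(\<Inter>i\<in>I. A i) \<noteq> {}"
proof -
  obtain i0 where i0: "i0 \<in> I"
    using assms(4) by auto
  have "A i0 \<inter> (\<Inter>i\<in>I. A i) \<noteq> {}"
  proof (rule compact_imp_fip_image)
    fix J assume J: "finite J" "J \<subseteq> I"
    define m where "m = Max (insert i0 J)"
    have "m \<in> insert i0 J"
      unfolding m_def by (rule Max_in) (use J in auto)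
    then have "m \<in> I"
      using i0 J by auto
    moreover have "i \<le> m" if "i \<in> insert i0 J" for i
      using J that by (simp add: m_def)
    ultimately have "A m \<subseteq> A i0 \<inter> (\<Inter>i\<in>J. A i)"
      using mono[OF _ \<open>m \<in> I\<close>] i0 J by blast
    then show "A i0 \<inter> (\<Inter>i\<in>J. A i) \<noteq> {}"
      using assms(2)[OF \<open>m \<in> I\<close>] by blast
  next
    show "compact (A i0)" "\<And>i. i \<in> I \<Longrightarrow> closed (A i)"
      using assms(1) i0 by (simp_all add: compact_imp_closed)
  qed
  then show ?thesis
    by auto
qed

text \<open>Nested nonempty compact sets have a common point, so the iterates cannot become empty
  for the first time at a limit stage.\<close>

lemma iterated_deriv_limit_empty:
  fixes K :: "'s::t2_space set"
  assumes "\<And>A. D A \<subseteq> A" "\<And>A. compact A \<Longrightarrow> compact (D A)" "compact K"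
    and "limit_ordinal \<kappa>" "iterated_deriv D K \<kappa> = {}"
  obtains \<alpha> where "\<alpha> < \<kappa>" "iterated_deriv D K \<alpha> = {}"
proof (rule ccontr)
  assume "\<not> thesis"
  then have ne: "iterated_deriv D K \<alpha> \<noteq> {}" if "\<alpha> < \<kappa>" for \<alpha>
    using that \<open>\<And>\<alpha>. \<alpha> < \<kappa> \<Longrightarrow> iterated_deriv D K \<alpha> = {} \<Longrightarrow> thesis\<close> by blast
  have "(\<Inter>\<alpha>\<in>{..<\<kappa>}. iterated_deriv D K \<alpha>) \<noteq> {}"
  proof (rule compact_chain_INT_nonempty)
    show "compact (iterated_deriv D K \<alpha>)" for \<alpha> :: "'b ordinal"
      by (rule compact_iterated_deriv[OF assms(2,3)])
    show "iterated_deriv D K j \<subseteq> iterated_deriv D K i" if "i \<le> j" for i j :: "'b ordinal"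
      by (rule iterated_deriv_antimono[OF assms(1) that])
    show "{..<\<kappa>} \<noteq> {}"
      using limit_ordinal_gr_0[OF assms(4)] by blast
  qed (use ne in simp)
  then show False
    using assms(4,5) by (simp add: iterated_deriv_limit)
qed

text \<open>For bounded functionals and the unit ball \<open>B\<close>, smallness means having norm diameter at most
  \<open>e\<close>. Here \<open>B\<close> is any set of coordinates and no linear structure is present; the slices are
  then given by finite linear combinations of coordinates.\<close>

definition small :: "'i set \<Rightarrow> real \<Rightarrow> ('i \<Rightarrow> real) set \<Rightarrow> bool" where
  "small B e A \<longleftrightarrow> (\<forall>y\<in>A. \<forall>z\<in>A. \<forall>x\<in>B. y x - z x \<le> e)"

definition sder :: "'i set \<Rightarrow> real \<Rightarrow> ('i \<Rightarrow> real) set \<Rightarrow> ('i \<Rightarrow> real) set" where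
  "sder B e A = {y \<in> A. \<forall>U. open U \<and> y \<in> U \<longrightarrow> \<not> small B e (U \<inter> A)}"

definition slice :: "'i set \<Rightarrow> ('i \<Rightarrow> real) \<Rightarrow> real \<Rightarrow> ('i \<Rightarrow> real) set" where
  "slice F t a = {y. a < (\<Sum>x\<in>F. t x * y x)}"

definition dder :: "'i set \<Rightarrow> real \<Rightarrow> ('i \<Rightarrow> real) set \<Rightarrow> ('i \<Rightarrow> real) set" where
  "dder B e A = {y \<in> A. \<forall>F t a. finite F \<and> y \<in> slice F t a \<longrightarrow> \<not> small B e (slice F t a \<inter> A)}"

lemma continuous_on_coordinate [continuous_intros]:
  "continuous_on S (\<lambda>y :: 'i \<Rightarrow> real. y x)"
  by (rule continuous_on_subset[OF continuous_on_product_coordinates]) simp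

lemma open_slice: "open (slice F t a)"
  unfolding slice_def by (intro open_Collect_less continuous_intros)

lemma small_mono: "small B e A' \<Longrightarrow> A \<subseteq> A' \<Longrightarrow> e \<le> e' \<Longrightarrow> small B e' A"
  unfolding small_def by (meson order_trans subsetD)

lemma sder_subset: "sder B e A \<subseteq> A"
  by (auto simp: sder_def)

lemma dder_subset: "dder B e A \<subseteq> A"
  by (auto simp: dder_def)

lemma small_Int_mono: "small B e (U \<inter> A') \<Longrightarrow> A \<subseteq> A' \<Longrightarrow> small B e (U \<inter> A)"
  by (erule small_mono) auto

lemma sder_mono: "A \<subseteq> A' \<Longrightarrow> sder B e A \<subseteq> sder B e A'"
  unfolding sder_def using small_Int_mono[of B e _ A' A] by auto

lemma dder_mono:
  assumes "A \<subseteq> A'"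
  shows "dder B e A \<subseteq> dder B e A'"
proof
  fix y assume y: "y \<in> dder B e A"
  have "\<not> small B e (slice F t a \<inter> A')" if "finite F" "y \<in> slice F t a" for F t a
    using y that small_Int_mono[OF _ assms, of B e "slice F t a"] by (auto simp: dder_def)
  then show "y \<in> dder B e A'"
    using y assms by (auto simp: dder_def)
qed

lemma sder_subset_dder:
  assumes "A \<subseteq> A'"
  shows "sder B e A \<subseteq> dder B e A'"
proof -
  have "sder B e A \<subseteq> dder B e A"
    using open_slice by (auto simp: sder_def dder_def)
  then show ?thesis
    using dder_mono[OF assms] by (rule order_trans)
qed

lemma compact_sder:
  assumes "compact A"
  shows "compact (sder B e A)"
proof -
  have "sder B e A = A - \<Union>{U. open U \<and> small B e (U \<inter> A)}"
    by (auto simp: sder_def)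
  then show ?thesis
    using assms by (auto intro: compact_diff)
qed

lemma compact_dder:
  assumes "compact A"
  shows "compact (dder B e A)"
proof -
  have "dder B e A = A - \<Union>{slice F t a | F t a. finite F \<and> small B e (slice F t a \<inter> A)}"
    by (auto simp: dder_def)
  moreover have "open (\<Union>{slice F t a | F t a. finite F \<and> small B e (slice F t a \<inter> A)})"
    using open_slice by (intro open_Union) auto
  ultimately show ?thesis
    using assms by (auto intro: compact_diff)
qed

section \<open>Boxes in finitely many coordinates and exposed points\<close>

lemma open_fun_box:
  fixes U :: "('i \<Rightarrow> real) set"
  assumes "open U" "y \<in> U"
  obtains F r where "finite F" "r > 0" "{z. \<forall>x\<in>F. \<bar>z x - y x\<bar> < r} \<subseteq> U"
proof -
  obtain X where X: "y \<in> Pi\<^sub>E UNIV X" "\<And>i. open (X i)" "finite {i. X i \<noteq> UNIV}" "Pi\<^sub>E UNIV X \<subseteq> U"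
    using product_topology_open_contains_basis[of "\<lambda>i. euclidean" UNIV U y] assms
    by (auto simp: open_fun_def)
  define F where "F = {i. X i \<noteq> UNIV}"
  have "\<exists>r>0. \<forall>w. \<bar>w - y i\<bar> < r \<longrightarrow> w \<in> X i" for i
    using X(1,2) by (metis PiE_mem UNIV_I dist_real_def open_dist)
  then obtain r where r: "\<And>i. r i > 0" "\<And>i w. \<bar>w - y i\<bar> < r i \<Longrightarrow> w \<in> X i"
    by metis
  define s where "s = Min (insert 1 (r ` F))"
  have fin: "finite F"
    using X(3) by (simp add: F_def)
  then have "s > 0"
    using r(1) by (auto simp: s_def)
  moreover have "{z. \<forall>x\<in>F. \<bar>z x - y x\<bar> < s} \<subseteq> U"
  proof
    fix z assume z: "z \<in> {z. \<forall>x\<in>F. \<bar>z x - y x\<bar> < s}"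
    have "z i \<in> X i" for i
    proof (cases "i \<in> F")
      case True
      then have "s \<le> r i"
        using fin by (auto simp: s_def)
      then show ?thesis
        using z True r(2) by force
    qed (simp add: F_def)
    then show "z \<in> U"
      using X(4) by auto
  qed
  ultimately show ?thesis
    using that fin by blast
qed

text \<open>A Lebesgue number argument: the finite subcover consists of boxes of half the radius,
  and the other half is left for moving the centre.\<close>

lemma compact_uniform_box:
  fixes C :: "('i \<Rightarrow> real) set"
  assumes "compact C" and P: "\<And>y. y \<in> C \<Longrightarrow> \<exists>U. open U \<and> y \<in> U \<and> P U"
  obtains F r where "finite F" "r > 0"
    "\<And>y. y \<in> C \<Longrightarrow> \<exists>U. P U \<and> {z. \<forall>x\<in>F. \<bar>z x - y x\<bar> < r} \<subseteq> U"
proof -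
  define I where "I = {(y, F, r). y \<in> C \<and> finite F \<and> r > 0 \<and>
    (\<exists>U. P U \<and> {z. \<forall>x\<in>F. \<bar>z x - y x\<bar> < r} \<subseteq> U)}"
  define V where "V = (\<lambda>(y :: 'i \<Rightarrow> real, F, r). {z. \<forall>x\<in>F. \<bar>z x - y x\<bar> < r / 2})"
  have "open (V p)" if "p \<in> I" for p
  proof -
    obtain y F r where p: "p = (y, F, r)"
      by (rule prod_cases3)
    have "V p = {z. \<forall>x\<in>F. z (id x) \<in> ball (y x) (r / 2)}"
      by (auto simp: V_def p dist_real_def abs_minus_commute)
    then show ?thesis
      using product_topology_basis'[of F "\<lambda>x. ball (y x) (r / 2)" id] that by (simp add: I_def p)
  qed
  moreover have "C \<subseteq> (\<Union>p\<in>I. V p)"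
  proof
    fix y assume "y \<in> C"
    then obtain U where U: "open U" "y \<in> U" "P U"
      using P by blast
    obtain F r where "finite F" "r > 0" "{z. \<forall>x\<in>F. \<bar>z x - y x\<bar> < r} \<subseteq> U"
      by (rule open_fun_box[OF U(1,2)])
    then have "(y, F, r) \<in> I" "y \<in> V (y, F, r)"
      using \<open>y \<in> C\<close> U(3) by (auto simp: I_def V_def)
    then show "y \<in> (\<Union>p\<in>I. V p)"
      by (rule UN_I)
  qed
  ultimately obtain I' where I': "I' \<subseteq> I" "finite I'" "C \<subseteq> (\<Union>p\<in>I'. V p)"
    by (rule compactE_image[OF assms(1)])
  define G where "G = (\<Union>(y, F, r)\<in>I'. F)"
  define s where "s = Min (insert 1 ((\<lambda>(y, F, r). r / 2) ` I'))"
  show ?thesis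
  proof (rule that[of G s])
    show "finite G"
      unfolding G_def using I' by (intro finite_UN_I) (auto simp: I_def)
    have "0 < r / 2" if "(y, F, r) \<in> I'" for y F r
      using that I'(1) by (auto simp: I_def)
    then show "s > 0"
      using I'(2) by (auto simp: s_def)
    fix y assume "y \<in> C"
    then obtain y' F r where p: "(y', F, r) \<in> I'" "y \<in> V (y', F, r)"
      using I'(3) by auto
    have "r / 2 \<in> (\<lambda>(y, F, r). r / 2) ` I'"
      using p(1) by force
    then have s: "s \<le> r / 2"
      using I'(2) unfolding s_def by (intro Min_le) auto
    obtain U where U: "P U" "{z. \<forall>x\<in>F. \<bar>z x - y' x\<bar> < r} \<subseteq> U"
      using p(1) I'(1) by (auto simp: I_def)
    have "F \<subseteq> G"
      using p(1) by (force simp: G_def)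
    have "{z. \<forall>x\<in>G. \<bar>z x - y x\<bar> < s} \<subseteq> {z. \<forall>x\<in>F. \<bar>z x - y' x\<bar> < r}"
    proof (clarify)
      fix z x assume z: "\<forall>x\<in>G. \<bar>z x - y x\<bar> < s" and x: "x \<in> F"
      have "\<bar>z x - y x\<bar> < s" "\<bar>y x - y' x\<bar> < r / 2"
        using z x p(2) \<open>F \<subseteq> G\<close> by (auto simp: V_def)
      then show "\<bar>z x - y' x\<bar> < r"
        using s by linarith
    qed
    then show "\<exists>U. P U \<and> {z. \<forall>x\<in>G. \<bar>z x - y x\<bar> < s} \<subseteq> U"
      using U by blast
  qed
qed

lemma compact_funpow:
  fixes D :: "'s::topological_space set \<Rightarrow> 's set"
  shows "(\<And>A. compact A \<Longrightarrow> compact (D A)) \<Longrightarrow> compact A \<Longrightarrow> compact ((D ^^ n) A)"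
  by (induction n) auto

lemma funpow_antimono_subset:
  assumes "\<And>A. D A \<subseteq> A" "m \<le> n"
  shows "(D ^^ n) A \<subseteq> (D ^^ m) A"
  using assms(2)
proof (induction rule: dec_induct)
  case (step n)
  then show ?case
    using assms(1)[of "(D ^^ n) A"] by simp
qed simp

text \<open>The point \<open>p\<close> of the intersection that is farthest from a centre lying far away in the
  direction opposite to the slice is strictly exposed, so a slice at \<open>p\<close> of a late iterate is
  contained in a small box around \<open>p\<close>.\<close>

lemma dder_funpow_slice:
  assumes "compact A" and "finite F0" and z: "z \<in> (\<Inter>n. (dder B e ^^ n) A)"
    and zs: "z \<in> slice F0 t a"
  shows "sder B e A \<inter> slice F0 t a \<noteq> {}"
proof
  assume H: "sder B e A \<inter> slice F0 t a = {}"
  define f where "f y = (\<Sum>x\<in>F0. t x * y x)" for y :: "'a \<Rightarrow> real"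
  have fz: "a < f z"
    using zs by (simp add: slice_def f_def)
  \<comment> \<open>A level strictly between \<open>a\<close> and \<open>f z\<close>: the part
    \<open>C\<close> of \<open>A\<close> beyond it is closed in \<open>A\<close>, lies inside the
    slice and so avoids \<open>sder B e A\<close>, and \<open>z\<close> is strictly beyond
    it.\<close>
  define b where "b = (a + f z) / 2"
  have b: "a < b" "b < f z"
    using fz by (auto simp: b_def)
  define C where "C = A \<inter> {y. b \<le> f y}"
  have "closed {y. b \<le> f y}"
    unfolding f_def by (intro closed_Collect_le continuous_intros)
  then have "compact C"
    using assms(1) unfolding C_def by (rule compact_Int_closed[rotated])
  moreover have "\<exists>U. open U \<and> y \<in> U \<and> small B e (U \<inter> A)" if "y \<in> C" for y
  proof -
    have "y \<in> A" "y \<notin> sder B e A"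
      using H that b by (auto simp: C_def slice_def f_def)
    then show ?thesis
      by (auto simp: sder_def)
  qed
  ultimately obtain F r where F: "finite F" "r > 0"
    "\<And>y. y \<in> C \<Longrightarrow> \<exists>U. small B e (U \<inter> A) \<and> {z. \<forall>x\<in>F. \<bar>z x - y x\<bar> < r} \<subseteq> U"
    by (rule compact_uniform_box[where P = "\<lambda>U. small B e (U \<inter> A)"]) blast+
  define G where "G = F \<union> F0"
  have G: "finite G"
    using F assms(2) by (simp add: G_def)
  define t' where "t' x = (if x \<in> F0 then t x else 0)" for x
  have f_eq: "f y = (\<Sum>x\<in>G. t' x * y x)" for y
    unfolding f_def G_def t'_def using F(1) assms(2)
    by (intro sum.mono_neutral_cong_left) auto
  define An where "An n = (dder B e ^^ n) A" for n
  have An_compact: "compact (An n)" for n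
    unfolding An_def by (rule compact_funpow[OF compact_dder assms(1)])
  have An_anti: "An n \<subseteq> An m" if "m \<le> n" for m n
    unfolding An_def by (rule funpow_antimono_subset[OF dder_subset that])
  have An_sub: "An n \<subseteq> A" for n
    using An_anti[of 0 n] by (simp add: An_def)
  define A\<omega> where "A\<omega> = (\<Inter>n. An n)"
  have z\<omega>: "z \<in> A\<omega>"
    using z by (simp add: A\<omega>_def An_def)
  have "A\<omega> = An 0 \<inter> (\<Inter>n. An n)"
    by (auto simp: A\<omega>_def)
  then have A\<omega>_compact: "compact A\<omega>"
    using An_compact compact_Int_closed[OF An_compact[of 0] closed_INT, of UNIV An]
    by (simp add: compact_imp_closed)
  define q where "q y = (\<Sum>x\<in>G. (y x)\<^sup>2)" for y :: "'a \<Rightarrow> real"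
  have "continuous_on A q"
    unfolding q_def by (intro continuous_intros)
  then have "bounded (q ` A)"
    using assms(1) compact_continuous_image compact_imp_bounded by blast
  then obtain Q where Q: "\<And>y. y \<in> A \<Longrightarrow> q y \<le> Q"
    unfolding bounded_iff by (metis abs_ge_self imageI order_trans real_norm_def)
  have zA: "z \<in> A"
    using z\<omega> An_sub by (auto simp: A\<omega>_def)
  have q0: "q y \<ge> 0" for y
    unfolding q_def by (intro sum_nonneg) simp
  have Q0: "Q \<ge> 0"
    using Q[OF zA] q0[of z] by simp
  \<comment> \<open>\<open>N\<close> below is the squared distance, in the coordinates
    \<open>G\<close>, from the centre \<open>- S * t'\<close>. The size of \<open>S\<close> makes
    \<open>2 * S * (f z - b)\<close> exceed \<open>Q\<close>, the largest amount by which
    \<open>q\<close> can favour another point of \<open>A\<close>; hence the farthest point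
    \<open>p\<close> satisfies \<open>b < f p\<close>.\<close>
  define S where "S = (Q + 1) / (2 * (f z - b))"
  have "2 * ((Q + 1) / (2 * d)) * d = Q + 1" if "d > 0" for d
    using that by simp
  from this[of "f z - b"] have S: "2 * S * (f z - b) = Q + 1"
    unfolding S_def using b(2) by (simp only: diff_gt_0_iff_gt)
  have S0: "S > 0"
    using b Q0 by (auto simp: S_def)
  define N where "N y = (\<Sum>x\<in>G. (y x + S * t' x)\<^sup>2)" for y :: "'a \<Rightarrow> real"
  have N_eq: "N y = q y + 2 * S * f y + (\<Sum>x\<in>G. (S * t' x)\<^sup>2)" for y
    unfolding N_def q_def f_eq sum_distrib_left sum.distrib[symmetric]
    by (intro sum.cong) (auto simp: power2_eq_square algebra_simps)
  have N_cont: "continuous_on X N" for X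
    unfolding N_def by (intro continuous_intros)
  obtain p where p: "p \<in> A\<omega>" "\<And>y. y \<in> A\<omega> \<Longrightarrow> N y \<le> N p"
    using continuous_attains_sup[OF A\<omega>_compact _ N_cont] z\<omega> by blast
  have pA: "p \<in> A"
    using p(1) An_sub by (auto simp: A\<omega>_def)
  have "2 * S * (f z - f p) \<le> Q"
    using p(2)[OF z\<omega>] Q[OF pA] q0[of z] unfolding N_eq by (simp add: algebra_simps)
  then have "2 * S * (f z - f p) < 2 * S * (f z - b)"
    using S by simp
  then have "b < f p"
    using S0 by simp
  then have "p \<in> C"
    using pA by (simp add: C_def)
  \<comment> \<open>The squared distance from \<open>p\<close> is \<open>N y - N p\<close>, which is
    below \<eta> on a late iterate, minus twice an increment that exceeds -\<eta> on the slice.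
    Together this is less than 3\<eta>, which has to stay below the square of
    \<open>r\<close>.\<close>
  define \<eta> where "\<eta> = r\<^sup>2 / 4"
  have \<eta>: "\<eta> > 0" "3 * \<eta> < r\<^sup>2"
    using F(2) by (auto simp: \<eta>_def)
  have "\<exists>n. An n \<inter> {y. N p + \<eta> \<le> N y} = {}"
  proof (rule ccontr)
    assume "\<not> ?thesis"
    moreover have "closed {y. N p + \<eta> \<le> N y}"
      using N_cont by (intro closed_Collect_le continuous_intros)
    ultimately have "(\<Inter>n\<in>UNIV. An n \<inter> {y. N p + \<eta> \<le> N y}) \<noteq> {}"
      using An_anti by (intro compact_chain_INT_nonempty)
        (auto intro: compact_Int_closed An_compact)
    then obtain y where "y \<in> A\<omega>" "N p + \<eta> \<le> N y"
      by (auto simp: A\<omega>_def)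
    then show False
      using p(2)[of y] \<eta>(1) by simp
  qed
  then obtain n where n: "\<And>y. y \<in> An n \<Longrightarrow> N y < N p + \<eta>"
    by (force simp: not_le)
  define c where "c x = p x + S * t' x" for x
  define a' where "a' = (\<Sum>x\<in>G. c x * p x) - \<eta>"
  obtain U where U: "small B e (U \<inter> A)" "{z. \<forall>x\<in>F. \<bar>z x - p x\<bar> < r} \<subseteq> U"
    using F(3)[OF \<open>p \<in> C\<close>] by blast
  have "slice G c a' \<inter> An n \<subseteq> U \<inter> A"
  proof
    fix y assume y: "y \<in> slice G c a' \<inter> An n"
    have "(\<Sum>x\<in>G. (y x - p x)\<^sup>2) = N y - N p - 2 * ((\<Sum>x\<in>G. c x * y x) - (\<Sum>x\<in>G. c x * p x))"
      unfolding N_def c_def sum_distrib_left sum_subtractf[symmetric]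
      by (intro sum.cong) (auto simp: power2_eq_square algebra_simps)
    also have "\<dots> < 3 * \<eta>"
      using n[of y] y by (auto simp: slice_def a'_def)
    finally have lt: "(\<Sum>x\<in>G. (y x - p x)\<^sup>2) < r\<^sup>2"
      using \<eta>(2) by simp
    have "\<bar>y x - p x\<bar> < r" if "x \<in> F" for x
    proof -
      have "(y x - p x)\<^sup>2 \<le> (\<Sum>x\<in>G. (y x - p x)\<^sup>2)"
        using that G by (intro member_le_sum) (auto simp: G_def)
      then have "\<bar>y x - p x\<bar>\<^sup>2 < r\<^sup>2"
        using lt by simp
      then show ?thesis
        using F(2) by (intro power2_less_imp_less[of _ r]) auto
    qed
    then show "y \<in> U \<inter> A"
      using U(2) y An_sub by auto
  qed
  then have "small B e (slice G c a' \<inter> An n)"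
    using U(1) small_mono by blast
  moreover have "p \<in> slice G c a'"
    using \<eta>(1) by (simp add: slice_def a'_def)
  moreover have "p \<in> dder B e (An n)"
    using p(1) by (auto simp: A\<omega>_def An_def dest: spec[of _ "Suc n"])
  ultimately show False
    using G by (auto simp: dder_def)
qed

section \<open>States on a compact set\<close>

text \<open>States play the role of the regular Borel probability measures on \<open>K\<close>. A state vanishes on
  functions that are not continuous on \<open>K\<close>, which makes the set of states compact in the product
  topology.\<close>

definition states :: "'s::topological_space set \<Rightarrow> (('s \<Rightarrow> real) \<Rightarrow> real) set" where
  "states K = {\<nu>. (\<forall>f. \<not> continuous_on K f \<longrightarrow> \<nu> f = 0) \<and>
     (\<forall>f g. continuous_on K f \<and> continuous_on K g \<longrightarrow> \<nu> (\<lambda>y. f y + g y) = \<nu> f + \<nu> g) \<and>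
     (\<forall>c f. continuous_on K f \<longrightarrow> \<nu> (\<lambda>y. c * f y) = c * \<nu> f) \<and>
     (\<forall>f. continuous_on K f \<and> (\<forall>y\<in>K. 0 \<le> f y) \<longrightarrow> 0 \<le> \<nu> f) \<and>
     \<nu> (\<lambda>_. 1) = 1}"

lemma states_undefined: "\<nu> \<in> states K \<Longrightarrow> \<not> continuous_on K f \<Longrightarrow> \<nu> f = 0"
  and states_add: "\<nu> \<in> states K \<Longrightarrow> continuous_on K f \<Longrightarrow> continuous_on K g \<Longrightarrow>
     \<nu> (\<lambda>y. f y + g y) = \<nu> f + \<nu> g"
  and states_cmult: "\<nu> \<in> states K \<Longrightarrow> continuous_on K f \<Longrightarrow> \<nu> (\<lambda>y. c * f y) = c * \<nu> f"
  and states_nonneg: "\<nu> \<in> states K \<Longrightarrow> continuous_on K f \<Longrightarrow> (\<And>y. y \<in> K \<Longrightarrow> 0 \<le> f y) \<Longrightarrow> 0 \<le> \<nu> f"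
  and states_one: "\<nu> \<in> states K \<Longrightarrow> \<nu> (\<lambda>_. 1) = 1"
  by (auto simp: states_def)

lemma states_const: "\<nu> \<in> states K \<Longrightarrow> \<nu> (\<lambda>_. c) = c"
  using states_cmult[of \<nu> K "\<lambda>_. 1" c] states_one[of \<nu> K] by simp

lemma states_uminus: "\<nu> \<in> states K \<Longrightarrow> continuous_on K f \<Longrightarrow> \<nu> (\<lambda>y. - f y) = - \<nu> f"
  using states_cmult[of \<nu> K f "-1"] by simp

lemma states_diff:
  "\<nu> \<in> states K \<Longrightarrow> continuous_on K f \<Longrightarrow> continuous_on K g \<Longrightarrow> \<nu> (\<lambda>y. f y - g y) = \<nu> f - \<nu> g"
  using states_add[of \<nu> K f "\<lambda>y. - g y"] states_uminus[of \<nu> K g] by (simp add: continuous_on_minus)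

lemma states_mono:
  assumes "\<nu> \<in> states K" "continuous_on K f" "continuous_on K g" "\<And>y. y \<in> K \<Longrightarrow> f y \<le> g y"
  shows "\<nu> f \<le> \<nu> g"
  using states_nonneg[of \<nu> K "\<lambda>y. g y - f y"] states_diff[of \<nu> K g f] assms
  by (simp add: continuous_on_diff)

lemma states_sum:
  assumes "\<nu> \<in> states K" "\<And>i. i \<in> I \<Longrightarrow> continuous_on K (f i)"
  shows "\<nu> (\<lambda>y. \<Sum>i\<in>I. f i y) = (\<Sum>i\<in>I. \<nu> (f i))"
proof (cases "finite I")
  case True
  then show ?thesis
    using assms(2)
  proof (induction I)
    case empty
    then show ?case
      using states_const[OF assms(1), of 0] by simp
  next
    case (insert i I)
    then show ?case
      using states_add[OF assms(1), of "f i" "\<lambda>y. \<Sum>i\<in>I. f i y"] by (simp add: continuous_on_sum)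
  qed
qed (use states_const[OF assms(1), of 0] in simp)

lemma states_abs:
  assumes "\<nu> \<in> states K" "continuous_on K f"
  shows "\<bar>\<nu> f\<bar> \<le> \<nu> (\<lambda>y. \<bar>f y\<bar>)"
proof -
  have c: "continuous_on K (\<lambda>y. \<bar>f y\<bar>)"
    using assms(2) by (rule continuous_on_rabs)
  have "\<nu> f \<le> \<nu> (\<lambda>y. \<bar>f y\<bar>)"
    by (rule states_mono[OF assms c]) simp
  moreover have "\<nu> (\<lambda>y. - f y) \<le> \<nu> (\<lambda>y. \<bar>f y\<bar>)"
    by (rule states_mono[OF assms(1) continuous_on_minus[OF assms(2)] c]) simp
  ultimately show ?thesis
    using states_uminus[OF assms] by simp
qed

text \<open>Positivity bounds \<open>\<nu> f\<close> by a bound of \<open>f\<close> on the compact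
  set \<open>K\<close>, so the states form a closed subset of a product of compact
  intervals.\<close>

lemma compact_states:
  assumes "compact K"
  shows "compact (states K)"
proof -
  have "\<exists>b. \<forall>\<nu>\<in>states K. \<nu> f \<in> {-b..b}" for f :: "'a \<Rightarrow> real"
  proof (cases "continuous_on K f")
    case True
    then have "bounded (f ` K)"
      by (intro compact_imp_bounded compact_continuous_image assms)
    then obtain b where b: "\<And>y. y \<in> K \<Longrightarrow> \<bar>f y\<bar> \<le> b"
      unfolding bounded_iff by auto
    have "\<nu> f \<in> {-b..b}" if "\<nu> \<in> states K" for \<nu>
    proof -
      have "\<bar>\<nu> f\<bar> \<le> \<nu> (\<lambda>y. \<bar>f y\<bar>)"
        using that True by (rule states_abs)
      also have "\<dots> \<le> \<nu> (\<lambda>_. b)"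
        by (rule states_mono[OF that continuous_on_rabs[OF True] continuous_on_const]) (rule b)
      also have "\<dots> = b"
        using that by (rule states_const)
      finally show ?thesis
        by auto
    qed
    then show ?thesis
      by blast
  next
    case False
    then show ?thesis
      using states_undefined by (intro exI[of _ 0]) auto
  qed
  then obtain b where b: "\<And>f \<nu>. \<nu> \<in> states K \<Longrightarrow> \<nu> f \<in> {- b f..b f}"
    by metis
  have "compact (Pi\<^sub>E UNIV (\<lambda>f. {- b f..b f}))"
    using compactin_PiE[of "\<lambda>_. euclidean" UNIV "\<lambda>f. {- b f..b f}"]
    by (simp add: euclidean_product_topology)
  moreover have "closed (states K)"
  proof -
    have "states K =
      (\<Inter>f\<in>{f. \<not> continuous_on K f}. {\<nu>. \<nu> f = 0}) \<inter>
      (\<Inter>(f, g)\<in>{f. continuous_on K f} \<times> {f. continuous_on K f}.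
          {\<nu>. \<nu> (\<lambda>y. f y + g y) = \<nu> f + \<nu> g}) \<inter>
      (\<Inter>(c, f)\<in>UNIV \<times> {f. continuous_on K f}. {\<nu>. \<nu> (\<lambda>y. c * f y) = c * \<nu> f}) \<inter>
      (\<Inter>f\<in>{f. continuous_on K f \<and> (\<forall>y\<in>K. 0 \<le> f y)}. {\<nu>. 0 \<le> \<nu> f}) \<inter>
      {\<nu>. \<nu> (\<lambda>_. 1) = 1}"
      unfolding states_def by auto
    moreover have "closed \<dots>"
      by (intro closed_Int closed_INT ballI)
        (auto intro!: closed_Collect_eq closed_Collect_le continuous_intros)
    ultimately show ?thesis
      by simp
  qed
  ultimately have "compact (Pi\<^sub>E UNIV (\<lambda>f. {- b f..b f}) \<inter> states K)"
    by (rule compact_Int_closed)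
  moreover have "Pi\<^sub>E UNIV (\<lambda>f. {- b f..b f}) \<inter> states K = states K"
    using b by (auto simp: PiE_iff)
  ultimately show ?thesis
    by simp
qed

section \<open>Convex combinations and barycentres\<close>

definition mix :: "real \<Rightarrow> ('b \<Rightarrow> real) \<Rightarrow> ('b \<Rightarrow> real) \<Rightarrow> 'b \<Rightarrow> real" where
  "mix s \<nu> \<nu>' = (\<lambda>f. \<nu> f + s * (\<nu>' f - \<nu> f))"

definition mix_closed :: "('b \<Rightarrow> real) set \<Rightarrow> bool" where
  "mix_closed M \<longleftrightarrow> (\<forall>\<nu>\<in>M. \<forall>\<nu>'\<in>M. \<forall>s. 0 \<le> s \<and> s \<le> 1 \<longrightarrow> mix s \<nu> \<nu>' \<in> M)"

lemma mix_closed_states: "mix_closed (states (K :: 'a::topological_space set))"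
  unfolding mix_closed_def
proof (intro ballI allI impI)
  fix \<nu> \<nu>' and s :: real
  assume n: "\<nu> \<in> states K" "\<nu>' \<in> states K" and s: "0 \<le> s \<and> s \<le> 1"
  have eq: "mix s \<nu> \<nu>' f = (1 - s) * \<nu> f + s * \<nu>' f" for f :: "'a \<Rightarrow> real"
    by (simp add: mix_def algebra_simps)
  show "mix s \<nu> \<nu>' \<in> states K"
    unfolding states_def mem_Collect_eq eq
  proof (intro conjI allI impI)
    fix f :: "'a \<Rightarrow> real" assume "continuous_on K f \<and> (\<forall>y\<in>K. 0 \<le> f y)"
    then have "0 \<le> \<nu> f" "0 \<le> \<nu>' f"
      using states_nonneg[OF n(1), of f] states_nonneg[OF n(2), of f] by auto
    then show "0 \<le> (1 - s) * \<nu> f + s * \<nu>' f"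
      using s by simp
  qed (use n in \<open>auto simp: states_undefined states_add states_cmult states_one algebra_simps\<close>)
qed

lemma states_le_mix:
  assumes "\<nu> f \<le> a" "\<nu>' f \<le> a" "0 \<le> s" "s \<le> (1 :: real)"
  shows "mix s \<nu> \<nu>' f \<le> a"
proof -
  have "mix s \<nu> \<nu>' f = (1 - s) * \<nu> f + s * \<nu>' f"
    by (simp add: mix_def algebra_simps)
  also have "\<dots> \<le> (1 - s) * a + s * a"
    using assms by (intro add_mono mult_left_mono) auto
  finally show ?thesis
    by (simp add: algebra_simps)
qed

definition bary :: "((('i \<Rightarrow> real) \<Rightarrow> real) \<Rightarrow> real) \<Rightarrow> 'i \<Rightarrow> real" where
  "bary \<nu> = (\<lambda>x. \<nu> (\<lambda>y. y x))"

lemma continuous_on_bary: "continuous_on M bary"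
  unfolding bary_def by (intro continuous_intros)

lemma bary_mix: "bary (mix s \<nu> \<nu>') x = bary \<nu> x + s * (bary \<nu>' x - bary \<nu> x)"
  by (simp add: bary_def mix_def)

lemma subset_bary_states: "K \<subseteq> bary ` states K"
proof
  fix y assume y: "y \<in> K"
  \<comment> \<open>Evaluation at \<open>y\<close>, set to zero off the continuous functions as
    \<open>states\<close> demands.\<close>
  define \<nu> where "\<nu> f = (if continuous_on K f then f y else 0)" for f :: "('a \<Rightarrow> real) \<Rightarrow> real"
  have "\<nu> \<in> states K"
    using y by (auto simp: states_def \<nu>_def intro: continuous_intros)
  moreover have "bary \<nu> = y"
    by (simp add: bary_def \<nu>_def continuous_on_coordinate)
  ultimately show "y \<in> bary ` states K"
    by blast
qed

text \<open>Neighbourhoods are taken among states, which see where the mass lies, while size is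
  measured on barycentres only.\<close>

definition state_der :: "'i set \<Rightarrow> real \<Rightarrow> ((('i \<Rightarrow> real) \<Rightarrow> real) \<Rightarrow> real) set \<Rightarrow>
    ((('i \<Rightarrow> real) \<Rightarrow> real) \<Rightarrow> real) set" where
  "state_der B e M = {\<mu> \<in> M. \<forall>U. open U \<and> \<mu> \<in> U \<longrightarrow> \<not> small B e (bary ` (U \<inter> M))}"

text \<open>The closed convex hull of \<^const>\<open>state_der\<close>, described by the closed half-spaces
  containing it.\<close>

definition hull_der :: "('i \<Rightarrow> real) set \<Rightarrow> 'i set \<Rightarrow> real \<Rightarrow> ((('i \<Rightarrow> real) \<Rightarrow> real) \<Rightarrow> real) set \<Rightarrow>
    ((('i \<Rightarrow> real) \<Rightarrow> real) \<Rightarrow> real) set" where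
  "hull_der K B e M = {\<nu> \<in> M. \<forall>f a. continuous_on K f \<and> (\<forall>\<mu>\<in>state_der B e M. \<mu> f \<le> a) \<longrightarrow> \<nu> f \<le> a}"

lemma hull_der_subset: "hull_der K B e M \<subseteq> M"
  by (auto simp: hull_der_def)

lemma state_der_subset_hull_der: "state_der B e M \<subseteq> hull_der K B e M"
  by (auto simp: hull_der_def state_der_def)

lemma compact_hull_der:
  assumes "compact M"
  shows "compact (hull_der K B e M)"
proof -
  have "hull_der K B e M =
    M \<inter> (\<Inter>(f, a)\<in>{(f, a). continuous_on K f \<and> (\<forall>\<mu>\<in>state_der B e M. \<mu> f \<le> a)}. {\<nu>. \<nu> f \<le> a})"
    by (auto simp: hull_der_def)
  moreover have "closed (\<Inter>(f, a)\<in>{(f, a). continuous_on K f \<and> (\<forall>\<mu>\<in>state_der B e M. \<mu> f \<le> a)}.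
      {\<nu> :: (('a \<Rightarrow> real) \<Rightarrow> real) \<Rightarrow> real. \<nu> f \<le> a})"
    by (intro closed_INT) (auto intro!: closed_Collect_le continuous_intros)
  ultimately show ?thesis
    using assms by (simp add: compact_Int_closed)
qed

lemma mix_closed_hull_der: "mix_closed M \<Longrightarrow> mix_closed (hull_der K B e M)"
  unfolding mix_closed_def hull_der_def by (auto intro!: states_le_mix)

text \<open>The form in which convexity enters the rank argument: a lower bound for an integral
  survives the closed convex hull. Linearity of states turns it into the upper bounds used in
  \<open>hull_der\<close>.\<close>

lemma hull_der_ge:
  assumes "M \<subseteq> states K" "continuous_on K f" "\<And>\<mu>. \<mu> \<in> state_der B e M \<Longrightarrow> a \<le> \<mu> f"
    and "\<nu> \<in> hull_der K B e M"
  shows "a \<le> \<nu> f"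
proof -
  have neg: "\<mu> (\<lambda>y. - f y) = - \<mu> f" if "\<mu> \<in> M" for \<mu>
    using states_uminus that assms(1,2) by blast
  have "\<forall>\<mu>\<in>state_der B e M. \<mu> (\<lambda>y. - f y) \<le> - a"
  proof
    fix \<mu> assume "\<mu> \<in> state_der B e M"
    then show "\<mu> (\<lambda>y. - f y) \<le> - a"
      using assms(3)[of \<mu>] neg[of \<mu>] by (simp add: state_der_def)
  qed
  moreover have "continuous_on K (\<lambda>y. - f y)"
    using assms(2) by (rule continuous_on_minus)
  moreover have "\<nu> g \<le> b"
    if "continuous_on K g" "\<forall>\<mu>\<in>state_der B e M. \<mu> g \<le> b" for g b
    using assms(4) that by (simp add: hull_der_def)
  ultimately have "\<nu> (\<lambda>y. - f y) \<le> - a"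
    by blast
  then show ?thesis
    using neg[of \<nu>] assms(4) by (auto simp: hull_der_def)
qed

text \<open>The whole fibre over \<open>y\<close> has to be considered. If none of its states is in
  \<open>state_der\<close>, their small neighbourhoods cover it, and by compactness they contain all
  states whose barycentre is near \<open>y\<close>. Two such barycentres are compared through
  \<open>y\<close> itself, which costs the factor 2.\<close>

lemma sder_bary_subset:
  assumes "compact M"
  shows "sder B (2 * e) (bary ` M) \<subseteq> bary ` state_der B e M"
proof
  fix y assume y: "y \<in> sder B (2 * e) (bary ` M)"
  show "y \<in> bary ` state_der B e M"
  proof (rule ccontr)
    assume n: "y \<notin> bary ` state_der B e M"
    define W where "W = \<Union>{U. open U \<and> small B e (bary ` (U \<inter> M)) \<and> (\<exists>\<nu>\<in>U \<inter> M. bary \<nu> = y)}"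
    have W: "\<nu> \<in> W" if "\<nu> \<in> M" "bary \<nu> = y" for \<nu>
    proof -
      have "\<nu> \<notin> state_der B e M"
        using n that by auto
      then show ?thesis
        using that by (auto simp: state_der_def W_def)
    qed
    have "open W"
      unfolding W_def by (intro open_Union) auto
    then have "compact (M - W)"
      using assms by (intro compact_diff)
    then have "closed (bary ` (M - W))"
      by (intro compact_imp_closed compact_continuous_image continuous_on_bary)
    then have op: "open (- bary ` (M - W))"
      by (simp add: open_Compl)
    have yc: "y \<in> - bary ` (M - W)"
      using W by auto
    have near: "\<bar>y' x - y x\<bar> \<le> e"
      if y': "y' \<in> - bary ` (M - W) \<inter> bary ` M" and x: "x \<in> B" for y' x
    proof -
      obtain \<nu>' where n': "\<nu>' \<in> M" "y' = bary \<nu>'"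
        using y' by blast
      moreover have "\<nu>' \<in> W"
        using y' n' by blast
      ultimately obtain U \<nu> where "small B e (bary ` (U \<inter> M))" "\<nu> \<in> U \<inter> M" "bary \<nu> = y" "\<nu>' \<in> U \<inter> M"
        by (auto simp: W_def)
      then have "bary \<nu>' x - bary \<nu> x \<le> e" "bary \<nu> x - bary \<nu>' x \<le> e"
        using x unfolding small_def by blast+
      then show ?thesis
        using n' \<open>bary \<nu> = y\<close> by auto
    qed
    have "small B (2 * e) (- bary ` (M - W) \<inter> bary ` M)"
      unfolding small_def
    proof (intro ballI)
      fix y1 y2 x
      assume "y1 \<in> - bary ` (M - W) \<inter> bary ` M" "y2 \<in> - bary ` (M - W) \<inter> bary ` M" "x \<in> B"
      then show "y1 x - y2 x \<le> 2 * e"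
        using near[of y1 x] near[of y2 x] by linarith
    qed
    then show False
      using y op yc by (auto simp: sder_def)
  qed
qed

text \<open>\<open>z\<close> is apart from the closed image of \<open>H\<close> already in finitely
  many coordinates. There the nearest point of the convex image and its variational inequality give
  the half-space.\<close>

lemma bary_separation:
  assumes H: "compact H" "mix_closed H" and z: "z \<notin> bary ` H"
  obtains F t a where "finite F" "z \<in> slice F t a" "\<And>\<nu>. \<nu> \<in> H \<Longrightarrow> bary \<nu> \<notin> slice F t a"
proof (cases "H = {}")
  case True
  then show ?thesis
    \<comment> \<open>The empty sum exceeds -1, so this slice is the whole space.\<close>
    by (intro that[of "{}" undefined "-1"]) (auto simp: slice_def)
next
  case False
  have "closed (bary ` H)"
    by (intro compact_imp_closed compact_continuous_image continuous_on_bary H)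
  then have "open (- bary ` H)" "z \<in> - bary ` H"
    using z by (auto simp: open_Compl)
  then obtain F r where F: "finite F" "r > 0" "{y. \<forall>x\<in>F. \<bar>y x - z x\<bar> < r} \<subseteq> - bary ` H"
    by (rule open_fun_box)
  define g where "g \<nu> = (\<Sum>x\<in>F. (bary \<nu> x - z x)\<^sup>2)" for \<nu>
  have "continuous_on H g"
    unfolding g_def
    by (intro continuous_on_sum continuous_on_power continuous_on_diff continuous_on_const
        continuous_on_product_then_coordinatewise[OF continuous_on_bary])
  then obtain \<nu>0 where n0: "\<nu>0 \<in> H" "\<And>\<nu>. \<nu> \<in> H \<Longrightarrow> g \<nu>0 \<le> g \<nu>"
    using continuous_attains_inf[OF H(1) False, of g] by auto
  define u where "u x = bary \<nu>0 x - z x" for x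
  have "\<exists>x\<in>F. r \<le> \<bar>u x\<bar>"
    using F(3) n0(1) by (force simp: u_def not_less)
  then obtain x0 where x0: "x0 \<in> F" "r \<le> \<bar>u x0\<bar>"
    by blast
  have "0 < (u x0)\<^sup>2"
    using x0 F(2) by auto
  also have "\<dots> \<le> (\<Sum>x\<in>F. (u x)\<^sup>2)"
    using x0 F(1) by (intro member_le_sum) auto
  finally have upos: "0 < (\<Sum>x\<in>F. (u x)\<^sup>2)" .
  have key: "0 \<le> (\<Sum>x\<in>F. u x * (bary \<nu> x - bary \<nu>0 x))" if "\<nu> \<in> H" for \<nu>
  proof (rule ccontr)
    define w where "w x = bary \<nu> x - bary \<nu>0 x" for x
    define P where "P = (\<Sum>x\<in>F. u x * w x)"
    define W where "W = (\<Sum>x\<in>F. (w x)\<^sup>2)"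
    assume "\<not> ?thesis"
    then have P: "P < 0"
      by (simp add: P_def w_def)
    have W: "W \<ge> 0"
      by (auto simp: W_def intro: sum_nonneg)
    \<comment> \<open>So small that the quadratic term cannot compensate the linear one:
      \<open>2 * P + s * W\<close> is at most \<open>P\<close>, which is negative. The added 1
      covers \<open>W\<close> = 0.\<close>
    define s where "s = min 1 (- P / (W + 1))"
    have s: "0 < s" "s \<le> 1" "s \<le> - P / (W + 1)"
      using P W by (auto simp: s_def divide_neg_pos)
    have "s * W \<le> s * (W + 1)"
      using s by simp
    also have "\<dots> \<le> - P"
      using s(3) W pos_le_divide_eq[of "W + 1" s "- P"] by simp
    finally have sW: "s * W \<le> - P" .
    have "mix s \<nu>0 \<nu> \<in> H"
      using H(2) n0(1) that s by (auto simp: mix_closed_def)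
    then have "g \<nu>0 \<le> g (mix s \<nu>0 \<nu>)"
      by (rule n0(2))
    also have "\<dots> = g \<nu>0 + s * (2 * P + s * W)"
      unfolding g_def P_def W_def u_def w_def sum_distrib_left sum.distrib[symmetric] bary_mix
      by (intro sum.cong) (auto simp: power2_eq_square algebra_simps)
    finally have "0 \<le> 2 * P + s * W"
      using s(1) by (simp add: zero_le_mult_iff)
    then show False
      using sW P by linarith
  qed
  define a where "a = (\<Sum>x\<in>F. - u x * bary \<nu>0 x)"
  show ?thesis
  proof (rule that[of F "\<lambda>x. - u x" a])
    have "(\<Sum>x\<in>F. - u x * z x) - a = (\<Sum>x\<in>F. (u x)\<^sup>2)"
      unfolding a_def u_def sum_subtractf[symmetric]
      by (intro sum.cong) (auto simp: power2_eq_square algebra_simps)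
    then show "z \<in> slice F (\<lambda>x. - u x) a"
      using upos by (simp add: slice_def)
    fix \<nu> assume "\<nu> \<in> H"
    have "(\<Sum>x\<in>F. - u x * bary \<nu> x) - a = - (\<Sum>x\<in>F. u x * (bary \<nu> x - bary \<nu>0 x))"
      unfolding a_def sum_subtractf[symmetric] sum_negf[symmetric]
      by (intro sum.cong) (auto simp: algebra_simps)
    then show "bary \<nu> \<notin> slice F (\<lambda>x. - u x) a"
      using key[OF \<open>\<nu> \<in> H\<close>] by (simp add: slice_def)
  qed (rule F(1))
qed

lemma dder_omega_bary_subset:
  assumes "compact M" "mix_closed M"
  shows "(\<Inter>n. (dder B (2 * e) ^^ n) (bary ` M)) \<subseteq> bary ` hull_der K B e M"
proof
  fix z assume z: "z \<in> (\<Inter>n. (dder B (2 * e) ^^ n) (bary ` M))"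
  show "z \<in> bary ` hull_der K B e M"
  proof (rule ccontr)
    assume "z \<notin> bary ` hull_der K B e M"
    then obtain F t a where F: "finite F" "z \<in> slice F t a"
      "\<And>\<nu>. \<nu> \<in> hull_der K B e M \<Longrightarrow> bary \<nu> \<notin> slice F t a"
      using bary_separation[OF compact_hull_der[OF assms(1)] mix_closed_hull_der[OF assms(2)]]
      by blast
    have "compact (bary ` M)"
      by (intro compact_continuous_image continuous_on_bary assms)
    then have "sder B (2 * e) (bary ` M) \<inter> slice F t a \<noteq> {}"
      using F z by (intro dder_funpow_slice)
    then obtain \<mu> where "\<mu> \<in> state_der B e M" "bary \<mu> \<in> slice F t a"
      using sder_bary_subset[OF assms(1)] by blast
    then show False
      using F(3) state_der_subset_hull_der by blast
  qed
qed

lemma iterated_hull_der: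
  assumes "compact M" "mix_closed M"
  shows "compact (iterated_deriv (hull_der K B e) M \<alpha>)"
    and "mix_closed (iterated_deriv (hull_der K B e) M \<alpha>)"
proof -
  show "compact (iterated_deriv (hull_der K B e) M \<alpha>)"
    by (rule compact_iterated_deriv[OF compact_hull_der assms(1)])
  show "mix_closed (iterated_deriv (hull_der K B e) M \<alpha>)"
  proof (induction \<alpha> rule: ordinal_induct)
    case (limit \<kappa>)
    then show ?case
      by (auto simp: iterated_deriv_limit mix_closed_def)
  qed (use assms(2) mix_closed_hull_der in \<open>auto simp: iterated_deriv_0 iterated_deriv_osuc\<close>)
qed

text \<open>The factor 2 does not accumulate, because each block of \<omega> dentability derivations
  is compared afresh with one hull derivation of a set of states. At a limit the fibres over
  \<open>z\<close> are nested nonempty compact sets, so one state serves all earlier stages.\<close>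

lemma iterated_dder_bary_subset:
  fixes \<alpha> :: "'u ordinal"
  assumes M: "compact M" "mix_closed M"
  shows "iterated_deriv (dder B (2 * e)) (bary ` M) (omega * \<alpha>)
    \<subseteq> bary ` iterated_deriv (hull_der K B e) M \<alpha>"
proof (induction \<alpha> rule: ordinal_induct)
  case zero
  then show ?case
    by (simp add: iterated_deriv_0)
next
  case (osuc \<alpha>)
  let ?M = "iterated_deriv (hull_der K B e) M \<alpha>"
  have "iterated_deriv (dder B (2 * e)) (bary ` M) (omega * osuc \<alpha>) =
      iterated_deriv (dder B (2 * e)) (iterated_deriv (dder B (2 * e)) (bary ` M) (omega * \<alpha>)) (omega :: 'u ordinal)"
    by (simp add: iterated_deriv_add[OF dder_subset])
  also have "\<dots> \<subseteq> iterated_deriv (dder B (2 * e)) (bary ` ?M) (omega :: 'u ordinal)"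
    by (rule iterated_deriv_mono[OF dder_mono osuc])
  also have "\<dots> \<subseteq> bary ` hull_der K B e ?M"
    unfolding iterated_deriv_omega by (rule dder_omega_bary_subset[OF iterated_hull_der[OF M]])
  finally show ?case
    by (simp add: iterated_deriv_osuc)
next
  case (limit \<kappa>)
  show ?case
  proof
    fix z assume z: "z \<in> iterated_deriv (dder B (2 * e)) (bary ` M) (omega * \<kappa>)"
    let ?M = "\<lambda>\<alpha>. iterated_deriv (hull_der K B e) M \<alpha>"
    have ne: "?M \<alpha> \<inter> {\<nu>. bary \<nu> = z} \<noteq> {}" if "\<alpha> < \<kappa>" for \<alpha>
      using limit(2)[OF that] z that
      by (auto simp: iterated_deriv_normal_fun_limit[OF dder_subset normal_fun_mult limit(1)])
    have "closed {\<nu>. bary \<nu> = z}"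
      by (intro closed_Collect_eq continuous_on_bary continuous_on_const)
    then have c: "compact (?M \<alpha> \<inter> {\<nu>. bary \<nu> = z})" for \<alpha>
      using iterated_hull_der(1)[OF M] by (rule compact_Int_closed[rotated])
    have "(\<Inter>\<alpha>\<in>{..<\<kappa>}. ?M \<alpha> \<inter> {\<nu>. bary \<nu> = z}) \<noteq> {}"
    proof (rule compact_chain_INT_nonempty)
      show "{..<\<kappa>} \<noteq> {}"
        using limit_ordinal_gr_0[OF limit(1)] by blast
      show "?M \<beta> \<inter> {\<nu>. bary \<nu> = z} \<subseteq> ?M \<alpha> \<inter> {\<nu>. bary \<nu> = z}" if "\<alpha> \<le> \<beta>" for \<alpha> \<beta>
        using iterated_deriv_antimono[of "hull_der K B e", OF hull_der_subset that] by blast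
    qed (use ne c in simp_all)
    then obtain \<nu> where "\<And>\<alpha>. \<alpha> < \<kappa> \<Longrightarrow> \<nu> \<in> ?M \<alpha>" "bary \<nu> = z"
      using limit_ordinal_gr_0[OF limit(1)] by fastforce
    then show "z \<in> bary ` ?M \<kappa>"
      by (auto simp: iterated_deriv_limit[OF limit(1)])
  qed
qed

section \<open>Norm control of barycentres by ranks\<close>

lemma states_bary_near:
  assumes \<nu>: "\<nu> \<in> states K" and fin: "finite I"
    and f: "\<And>i. i \<in> I \<Longrightarrow> continuous_on K (f i)" "\<And>i y. i \<in> I \<Longrightarrow> y \<in> K \<Longrightarrow> 0 \<le> f i y"
      "\<And>y. y \<in> K \<Longrightarrow> (\<Sum>i\<in>I. f i y) = 1"
  shows "\<bar>bary \<nu> x - (\<Sum>i\<in>I. c i * \<nu> (f i))\<bar> \<le> \<nu> (\<lambda>y. \<Sum>i\<in>I. f i y * \<bar>y x - c i\<bar>)"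
proof -
  have cont: "continuous_on K (\<lambda>y. \<Sum>i\<in>I. c i * f i y)"
    "continuous_on K (\<lambda>y. \<Sum>i\<in>I. f i y * \<bar>y x - c i\<bar>)"
    using f(1) by (auto intro!: continuous_intros)
  have "(\<Sum>i\<in>I. c i * \<nu> (f i)) = \<nu> (\<lambda>y. \<Sum>i\<in>I. c i * f i y)"
    using f(1) by (simp add: states_sum[OF \<nu>] states_cmult[OF \<nu>] continuous_on_mult_left)
  then have "bary \<nu> x - (\<Sum>i\<in>I. c i * \<nu> (f i)) = \<nu> (\<lambda>y. y x - (\<Sum>i\<in>I. c i * f i y))"
    by (simp add: bary_def states_diff[OF \<nu> continuous_on_coordinate cont(1)])
  also have "\<bar>\<dots>\<bar> \<le> \<nu> (\<lambda>y. \<bar>y x - (\<Sum>i\<in>I. c i * f i y)\<bar>)"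
    by (rule states_abs[OF \<nu>]) (intro continuous_on_diff continuous_on_coordinate cont)
  also have "\<dots> \<le> \<nu> (\<lambda>y. \<Sum>i\<in>I. f i y * \<bar>y x - c i\<bar>)"
  proof (rule states_mono[OF \<nu>])
    show "continuous_on K (\<lambda>y. \<bar>y x - (\<Sum>i\<in>I. c i * f i y)\<bar>)"
      by (intro continuous_on_rabs continuous_on_diff continuous_on_coordinate cont)
    fix y assume y: "y \<in> K"
    have "y x - (\<Sum>i\<in>I. c i * f i y) = (\<Sum>i\<in>I. f i y) * y x - (\<Sum>i\<in>I. c i * f i y)"
      using f(3)[OF y] by simp
    also have "\<dots> = (\<Sum>i\<in>I. f i y * (y x - c i))"
      unfolding sum_distrib_right sum_subtractf[symmetric]
      by (intro sum.cong) (auto simp: algebra_simps)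
    also have "\<bar>\<dots>\<bar> \<le> (\<Sum>i\<in>I. \<bar>f i y * (y x - c i)\<bar>)"
      by (rule sum_abs)
    also have "\<dots> = (\<Sum>i\<in>I. f i y * \<bar>y x - c i\<bar>)"
      using f(2)[OF _ y] by (intro sum.cong) (auto simp: abs_mult)
    finally show "\<bar>y x - (\<Sum>i\<in>I. c i * f i y)\<bar> \<le> (\<Sum>i\<in>I. f i y * \<bar>y x - c i\<bar>)" .
  qed (rule cont(2))
  finally show ?thesis .
qed

text \<open>The condition \<open>P\<close> may depend on the centre of the neighbourhood, and each
  member of the partition has to remember that centre: its index is a triple of centre, coordinates
  and radius, and \<open>fst p\<close> is the node. The functions are normalised tents.\<close>

lemma compact_partition_of_unity:
  fixes K :: "('i \<Rightarrow> real) set"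
  assumes "compact K" and P: "\<And>y. y \<in> K \<Longrightarrow> \<exists>U. open U \<and> y \<in> U \<and> P y U"
  obtains I :: "(('i \<Rightarrow> real) \<times> 'i set \<times> real) set"
    and f :: "('i \<Rightarrow> real) \<times> 'i set \<times> real \<Rightarrow> ('i \<Rightarrow> real) \<Rightarrow> real"
  where "finite I" "\<And>p. p \<in> I \<Longrightarrow> fst p \<in> K" "\<And>p. p \<in> I \<Longrightarrow> continuous_on K (f p)"
    "\<And>p y. p \<in> I \<Longrightarrow> y \<in> K \<Longrightarrow> 0 \<le> f p y" "\<And>y. y \<in> K \<Longrightarrow> (\<Sum>p\<in>I. f p y) = 1"
    "\<And>p y. p \<in> I \<Longrightarrow> y \<in> K \<Longrightarrow> 0 < f p y \<Longrightarrow> \<exists>U. P (fst p) U \<and> y \<in> U"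
proof -
  define J where "J = {(y, F, r). y \<in> K \<and> finite F \<and> r > 0 \<and>
    (\<exists>U. P y U \<and> {z. \<forall>x\<in>F. \<bar>z x - y x\<bar> < r} \<subseteq> U)}"
  define b where "b = (\<lambda>(y :: 'i \<Rightarrow> real, F, r :: real) z. max 0 (1 - (\<Sum>x\<in>F. \<bar>z x - y x\<bar>) / r))"
  have b_cont: "continuous_on X (b p)" if "p \<in> J" for p X
    using that by (auto simp: b_def J_def intro!: continuous_intros)
  have b_in: "\<exists>U. P (fst p) U \<and> z \<in> U" if p: "p \<in> J" "0 < b p z" for p z
  proof -
    obtain y F r where pe: "p = (y, F, r)"
      by (rule prod_cases3)
    have J: "finite F" "r > 0" "\<exists>U. P y U \<and> {z. \<forall>x\<in>F. \<bar>z x - y x\<bar> < r} \<subseteq> U"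
      using p(1) by (auto simp: J_def pe)
    have lt: "(\<Sum>x\<in>F. \<bar>z x - y x\<bar>) < r"
      using p(2) J(2) by (simp add: b_def pe less_max_iff_disj)
    have "\<bar>z x - y x\<bar> < r" if "x \<in> F" for x
    proof -
      have "\<bar>z x - y x\<bar> \<le> (\<Sum>x\<in>F. \<bar>z x - y x\<bar>)"
        using J(1) that by (intro member_le_sum) auto
      then show ?thesis
        using lt by simp
    qed
    then show ?thesis
      using J(3) unfolding pe fst_conv by blast
  qed
  have "open {z. 0 < b p z}" if "p \<in> J" for p
    by (intro open_Collect_less continuous_on_const b_cont that)
  moreover have "K \<subseteq> (\<Union>p\<in>J. {z. 0 < b p z})"
  proof
    fix y assume "y \<in> K"
    then obtain U where U: "open U" "y \<in> U" "P y U"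
      using P by blast
    obtain F r where "finite F" "r > 0" "{z. \<forall>x\<in>F. \<bar>z x - y x\<bar> < r} \<subseteq> U"
      by (rule open_fun_box[OF U(1,2)])
    then have "(y, F, r) \<in> J" "y \<in> {z. 0 < b (y, F, r) z}"
      using \<open>y \<in> K\<close> U(3) by (auto simp: J_def b_def)
    then show "y \<in> (\<Union>p\<in>J. {z. 0 < b p z})"
      by (rule UN_I)
  qed
  ultimately obtain I where I: "I \<subseteq> J" "finite I" "K \<subseteq> (\<Union>p\<in>I. {z. 0 < b p z})"
    by (rule compactE_image[OF assms(1)])
  define tot where "tot z = (\<Sum>p\<in>I. b p z)" for z
  have b0: "0 \<le> b p z" for p z
    by (simp add: b_def split: prod.split)
  have tot: "0 < tot z" if "z \<in> K" for z
  proof -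
    obtain p where "p \<in> I" "0 < b p z"
      using I(3) \<open>z \<in> K\<close> by auto
    then show ?thesis
      unfolding tot_def using I(2) b0 by (intro sum_pos2) auto
  qed
  show ?thesis
  proof (rule that[of I "\<lambda>p z. b p z / tot z"])
    show "fst p \<in> K" if "p \<in> I" for p
      using that I(1) by (auto simp: J_def)
    show "continuous_on K (\<lambda>z. b p z / tot z)" if "p \<in> I" for p
      unfolding tot_def
    proof (intro continuous_on_divide continuous_on_sum b_cont)
      show "\<forall>y\<in>K. (\<Sum>p\<in>I. b p y) \<noteq> 0"
        using tot unfolding tot_def by force
    qed (use I(1) that in auto)
    show "0 \<le> b p z / tot z" if "z \<in> K" for p z
      using b0 tot[OF that] by simp
    show "(\<Sum>p\<in>I. b p z / tot z) = 1" if "z \<in> K" for z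
      using tot[OF that] unfolding sum_divide_distrib[symmetric] by (simp add: tot_def)
    show "\<exists>U. P (fst p) U \<and> z \<in> U" if "p \<in> I" "z \<in> K" "0 < b p z / tot z" for p z
    proof (rule b_in)
      show "0 < b p z"
        using that(3) tot[OF that(2)] by (simp add: zero_less_divide_iff)
    qed (use that I(1) in auto)
  qed (rule I(2))
qed

text \<open>The compact upper level sets express upper semicontinuity. The inclusion starts at level
  1, so that rank 0 can mark points about whose derivations nothing is known.\<close>

definition rank_admissible ::
    "('i \<Rightarrow> real) set \<Rightarrow> 'i set \<Rightarrow> real \<Rightarrow> 'u ordinal \<Rightarrow> nat \<Rightarrow> (('i \<Rightarrow> real) \<Rightarrow> nat) \<Rightarrow> bool" where
  "rank_admissible K B \<delta> \<zeta> n \<rho> \<longleftrightarrow> (\<forall>y\<in>K. \<rho> y \<le> n) \<and> (\<forall>k. compact {y \<in> K. k \<le> \<rho> y}) \<and>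
     (\<forall>k\<ge>1. iterated_deriv (sder B \<delta>) {y \<in> K. k \<le> \<rho> y} (omega_power \<zeta>) \<subseteq> {y \<in> K. Suc k \<le> \<rho> y})"

lemma continuous_on_less_open:
  assumes "continuous_on K h"
  obtains W where "open W" "W \<inter> K = {y \<in> K. (c :: real) < h y}"
proof -
  obtain W where W: "open W" "W \<inter> K = h -` {c<..} \<inter> K"
    using assms[unfolded continuous_on_open_invariant, rule_format, of "{c<..}"] by auto
  moreover have "h -` {c<..} \<inter> K = {y \<in> K. c < h y}"
    by auto
  ultimately show ?thesis
    using that by simp
qed

text \<open>Below, a state \<open>\<nu>\<close> close to \<open>\<mu>\<close> gives little mass to the set where the rank is smaller than
  its upper semicontinuous envelope around \<open>\<mu>\<close>; on the rest, the points of \<open>K\<close> are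
  norm-close to the nodes of a partition of unity, so that the barycentre of \<open>\<nu>\<close> is
  controlled.\<close>

lemma state_der_rank_step:
  fixes K :: "('i \<Rightarrow> real) set" and \<zeta> :: "'u ordinal"
  assumes K: "compact K" and bnd: "\<And>y x. y \<in> K \<Longrightarrow> x \<in> B \<Longrightarrow> \<bar>y x\<bar> \<le> R"
    and pos: "R > 0" "e > 0" "4 * \<delta> \<le> e" "32 * R * c0 \<le> e" "\<delta> > 0"
    and adm: "rank_admissible K B \<delta> (0 :: 'u ordinal) n \<rho>"
    and M: "M \<subseteq> states K" and G: "continuous_on K G"
    and hyp: "\<And>\<nu> h. \<nu> \<in> M \<Longrightarrow> continuous_on K h \<Longrightarrow> (\<And>y. y \<in> K \<Longrightarrow> real (\<rho> y) \<le> h y) \<Longrightarrow>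
        1 \<le> \<nu> (\<lambda>y. h y + G y)"
    and \<mu>: "\<mu> \<in> state_der B e M"
    and h: "continuous_on K h" "\<And>y. y \<in> K \<Longrightarrow> 0 \<le> h y" "\<And>y. y \<in> K \<Longrightarrow> real (\<rho> y) - 1 \<le> h y"
  shows "c0 \<le> \<mu> (\<lambda>y. h y + G y)"
proof (rule ccontr)
  assume "\<not> ?thesis"
  then have less: "\<mu> (\<lambda>y. h y + G y) < c0"
    by simp
  define \<tau> where "\<tau> = e / (32 * R)"
  have \<tau>: "\<tau> > 0" "32 * R * \<tau> = e"
    using pos by (auto simp: \<tau>_def)
  \<comment> \<open>Bounds the distance of \<open>y'\<close> from a node \<open>y\<close> nearby.
    Where \<open>y'\<close> has the rank of \<open>y\<close> and this is positive, the distance is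
    at most \<delta>; where the rank drops, and at rank zero, the bracket is at least 1 and the
    trivial bound 2R is available. The slack \<tau> makes the condition on \<open>h\<close>
    open.\<close>
  define w where "w y = \<delta> + 2 * R * (h y + 1 + \<tau> - real (\<rho> y))" for y
  define P where "P y U \<longleftrightarrow> (\<forall>y'\<in>U \<inter> K. \<forall>x\<in>B. \<bar>y' x - y x\<bar> \<le> w y')" for y U
  have "\<exists>U. open U \<and> y \<in> U \<and> P y U" if y: "y \<in> K" for y
  proof -
    define k where "k = \<rho> y"
    define U1 where "U1 = - {y' \<in> K. Suc k \<le> \<rho> y'}"
    have U1: "open U1" "y \<in> U1" "\<And>y'. y' \<in> U1 \<inter> K \<Longrightarrow> \<rho> y' \<le> k"
      using adm unfolding U1_def rank_admissible_def
      by (auto simp: k_def open_Compl compact_imp_closed)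
    have diff: "\<bar>y' x - y x\<bar> \<le> 2 * R" if "y' \<in> K" "x \<in> B" for y' x
      using bnd[of y' x] bnd[OF y, of x] that by force
    show ?thesis
    proof (cases "k = 0")
      case True
      have "P y U1"
        unfolding P_def
      proof (intro ballI)
        fix y' x assume a: "y' \<in> U1 \<inter> K" "x \<in> B"
        then have "2 * R * 1 \<le> 2 * R * (h y' + 1 + \<tau> - real (\<rho> y'))"
          using U1(3)[of y'] True h(2)[of y'] pos(1) \<tau>(1) by (intro mult_left_mono) auto
        then show "\<bar>y' x - y x\<bar> \<le> w y'"
          using diff[of y' x] a pos(5) by (auto simp: w_def)
      qed
      then show ?thesis
        using U1 by blast
    next
      case False
      have "sder B \<delta> {y \<in> K. k \<le> \<rho> y} \<subseteq> {y \<in> K. Suc k \<le> \<rho> y}"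
        using adm False
        by (auto simp: rank_admissible_def one_ordinal_def iterated_deriv_0 iterated_deriv_osuc)
      then have "y \<notin> sder B \<delta> {y \<in> K. k \<le> \<rho> y}"
        by (auto simp: k_def)
      then obtain U2 where U2: "open U2" "y \<in> U2" "small B \<delta> (U2 \<inter> {y \<in> K. k \<le> \<rho> y})"
        using y by (auto simp: sder_def k_def)
      obtain W where W: "open W" "W \<inter> K = {y' \<in> K. real k - 1 - \<tau> < h y'}"
        using continuous_on_less_open[OF h(1)] by blast
      have "real k - 1 - \<tau> < h y"
        using h(3)[OF y] \<tau>(1) by (simp add: k_def)
      then have "y \<in> W"
        using W(2) y by blast
      have "P y (U1 \<inter> U2 \<inter> W)"
        unfolding P_def
      proof (intro ballI)
        fix y' x assume a: "y' \<in> U1 \<inter> U2 \<inter> W \<inter> K" and x: "x \<in> B"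
        then have "y' \<in> W \<inter> K"
          by auto
        then have hy: "real k - 1 - \<tau> < h y'"
          unfolding W(2) by auto
        show "\<bar>y' x - y x\<bar> \<le> w y'"
        proof (cases "\<rho> y' = k")
          case True
          then have "y' x - y x \<le> \<delta>" "y x - y' x \<le> \<delta>"
            using U2 a x y unfolding small_def by (auto simp: k_def)
          moreover have "0 \<le> 2 * R * (h y' + 1 + \<tau> - real (\<rho> y'))"
            using hy True pos(1) by (intro mult_nonneg_nonneg) auto
          ultimately show ?thesis
            by (auto simp: w_def)
        next
          case False
          then have "real (\<rho> y') \<le> real k - 1"
            using U1(3)[of y'] a by auto
          then have "h y' + 1 + \<tau> - real (\<rho> y') \<ge> 1"
            using hy by linarith
          then have "2 * R * 1 \<le> 2 * R * (h y' + 1 + \<tau> - real (\<rho> y'))"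
            using pos(1) by (intro mult_left_mono) auto
          then show ?thesis
            using diff[of y' x] a x pos(5) by (auto simp: w_def)
        qed
      qed
      then show ?thesis
        using U1 U2 W \<open>y \<in> W\<close> by (intro exI[of _ "U1 \<inter> U2 \<inter> W"]) auto
    qed
  qed
  then obtain I :: "(('i \<Rightarrow> real) \<times> 'i set \<times> real) set"
    and f :: "('i \<Rightarrow> real) \<times> 'i set \<times> real \<Rightarrow> ('i \<Rightarrow> real) \<Rightarrow> real" where I: "finite I" "\<And>p. p \<in> I \<Longrightarrow> fst p \<in> K"
    and f: "\<And>p. p \<in> I \<Longrightarrow> continuous_on K (f p)" "\<And>p y. p \<in> I \<Longrightarrow> y \<in> K \<Longrightarrow> 0 \<le> f p y"
      "\<And>y. y \<in> K \<Longrightarrow> (\<Sum>p\<in>I. f p y) = 1"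
    and fP: "\<And>p y. p \<in> I \<Longrightarrow> y \<in> K \<Longrightarrow> 0 < f p y \<Longrightarrow> \<exists>U. P (fst p) U \<and> y \<in> U"
    using compact_partition_of_unity[OF K, of P] by blast
  define u where "u x y = (\<Sum>p\<in>I. f p y * \<bar>y x - fst p x\<bar>)" for x and y :: "'i \<Rightarrow> real"
  have u_cont: "continuous_on K (u x)" for x
    unfolding u_def using f(1) by (auto intro!: continuous_intros)
  have u_le: "u x y \<le> w y" if "y \<in> K" "x \<in> B" for x y
  proof -
    have "f p y * \<bar>y x - fst p x\<bar> \<le> f p y * w y" if p: "p \<in> I" for p
    proof (cases "f p y = 0")
      case False
      then have "0 < f p y"
        using f(2)[OF p \<open>y \<in> K\<close>] by simp
      then have "\<bar>y x - fst p x\<bar> \<le> w y"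
        using fP[OF p \<open>y \<in> K\<close>] \<open>y \<in> K\<close> \<open>x \<in> B\<close> by (auto simp: P_def)
      then show ?thesis
        using \<open>0 < f p y\<close> by simp
    qed simp
    then have "u x y \<le> (\<Sum>p\<in>I. f p y * w y)"
      unfolding u_def by (rule sum_mono)
    also have "\<dots> = w y"
      unfolding sum_distrib_right[symmetric] using f(3)[OF \<open>y \<in> K\<close>] by simp
    finally show ?thesis .
  qed
  have nu_u: "\<nu> (u x) \<le> \<delta> + 2 * R * (\<nu> (\<lambda>y. h y + G y) + \<tau>)" if n: "\<nu> \<in> M" and x: "x \<in> B" for \<nu> x
  proof -
    have st: "\<nu> \<in> states K"
      using n M by auto
    \<comment> \<open>\<open>w\<close> contains the rank and need not be continuous, so \<nu> cannot
      be applied to it. Solving \<open>u x y \<le> w y\<close> for the rank produces a continuous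
      majorant, to which \<open>hyp\<close> applies.\<close>
    define h' where "h' y = h y + 1 + \<tau> - (u x y - \<delta>) / (2 * R)" for y
    have "continuous_on K h'"
      unfolding h'_def using h(1) u_cont pos(1) by (auto intro!: continuous_intros)
    moreover have "real (\<rho> y) \<le> h' y" if "y \<in> K" for y
    proof -
      have "u x y - \<delta> \<le> 2 * R * (h y + 1 + \<tau> - real (\<rho> y))"
        using u_le[OF that x] by (simp add: w_def)
      then have "(u x y - \<delta>) / (2 * R) \<le> h y + 1 + \<tau> - real (\<rho> y)"
        using pos(1) by (simp add: pos_divide_le_eq mult.commute)
      then show ?thesis
        by (simp add: h'_def)
    qed
    ultimately have "1 \<le> \<nu> (\<lambda>y. h' y + G y)"
      using hyp[OF n] by blast
    also have "(\<lambda>y. h' y + G y) =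
        (\<lambda>y. ((h y + G y) + (1 + \<tau> + \<delta> / (2 * R))) + (- 1 / (2 * R)) * u x y)"
      by (auto simp: h'_def diff_divide_distrib)
    also have "\<nu> \<dots> = \<nu> (\<lambda>y. h y + G y) + (1 + \<tau> + \<delta> / (2 * R)) + (- 1 / (2 * R)) * \<nu> (u x)"
    proof -
      have c: "continuous_on K (\<lambda>y. h y + G y)"
        by (intro continuous_intros h G)
      have "\<nu> (\<lambda>y. (h y + G y) + (1 + \<tau> + \<delta> / (2 * R))) = \<nu> (\<lambda>y. h y + G y) + (1 + \<tau> + \<delta> / (2 * R))"
        using states_add[OF st c continuous_on_const] states_const[OF st] by simp
      moreover have "\<nu> (\<lambda>y. (- 1 / (2 * R)) * u x y) = (- 1 / (2 * R)) * \<nu> (u x)"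
        by (rule states_cmult[OF st u_cont])
      moreover have "\<nu> (\<lambda>y. ((h y + G y) + (1 + \<tau> + \<delta> / (2 * R))) + (- 1 / (2 * R)) * u x y) =
         \<nu> (\<lambda>y. (h y + G y) + (1 + \<tau> + \<delta> / (2 * R))) + \<nu> (\<lambda>y. (- 1 / (2 * R)) * u x y)"
        by (intro states_add[OF st] continuous_intros c u_cont)
      ultimately show ?thesis
        by simp
    qed
    finally have "\<nu> (u x) / (2 * R) \<le> \<nu> (\<lambda>y. h y + G y) + \<tau> + \<delta> / (2 * R)"
      by simp
    then have "\<nu> (u x) \<le> (\<nu> (\<lambda>y. h y + G y) + \<tau> + \<delta> / (2 * R)) * (2 * R)"
      using pos(1) by (simp only: pos_divide_le_eq)
    also have "\<dots> = \<delta> + 2 * R * (\<nu> (\<lambda>y. h y + G y) + \<tau>)"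
      using pos(1) by (simp add: field_simps)
    finally show ?thesis .
  qed
  \<comment> \<open>The terms \<open>2 * R * c0\<close> and \<open>2 * R * \<tau>\<close> are at
    most e/16 each and \<delta> at most e/4, so two barycentres use up 3e/4. The choice of \<sigma>
    keeps the difference of the finite sums within e/8, and the added 1 covers an empty
    \<open>I\<close>.\<close>
  define \<sigma> where "\<sigma> = e / (16 * R * (real (card I) + 1))"
  have \<sigma>: "\<sigma> > 0"
    using pos by (auto simp: \<sigma>_def)
  have "2 * R * \<sigma> * real (card I) \<le> 2 * R * \<sigma> * (real (card I) + 1)"
    using \<sigma> pos(1) by simp
  also have "\<dots> = e / 8"
  proof -
    have "2 * R * (e / (16 * R * N)) * N = e / 8" if "N > 0" for N
      using pos(1) that by simp
    from this[of "real (card I) + 1"] show ?thesis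
      unfolding \<sigma>_def by linarith
  qed
  finally have \<sigma>_card: "2 * R * \<sigma> * real (card I) \<le> e / 8" .
  define U where "U = {\<nu>. \<nu> (\<lambda>y. h y + G y) < c0} \<inter> (\<Inter>p\<in>I. {\<nu>. \<bar>\<nu> (f p) - \<mu> (f p)\<bar> < \<sigma>})"
  have "open U"
    unfolding U_def by (intro open_Int open_INT I ballI open_Collect_less continuous_intros)
  moreover have "\<mu> \<in> U"
    using less \<sigma> by (auto simp: U_def)
  moreover have "small B e (bary ` (U \<inter> M))"
  proof -
    have "bary \<nu> x - bary \<nu>' x \<le> e" if n: "\<nu> \<in> U \<inter> M" "\<nu>' \<in> U \<inter> M" and x: "x \<in> B" for \<nu> \<nu>' x
    proof -
      have near: "\<bar>bary \<nu> x - (\<Sum>p\<in>I. fst p x * \<nu> (f p))\<bar> \<le> \<delta> + 2 * R * (c0 + \<tau>)"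
        if n: "\<nu> \<in> U \<inter> M" for \<nu>
      proof -
        have "\<bar>bary \<nu> x - (\<Sum>p\<in>I. fst p x * \<nu> (f p))\<bar> \<le> \<nu> (u x)"
          unfolding u_def by (rule states_bary_near) (use n M I f in auto)
        also have "\<dots> \<le> \<delta> + 2 * R * (\<nu> (\<lambda>y. h y + G y) + \<tau>)"
          using n x by (intro nu_u) auto
        also have "\<dots> \<le> \<delta> + 2 * R * (c0 + \<tau>)"
          using n pos(1) by (auto simp: U_def)
        finally show ?thesis .
      qed
      have "(\<Sum>p\<in>I. fst p x * \<nu> (f p)) - (\<Sum>p\<in>I. fst p x * \<nu>' (f p)) =
          (\<Sum>p\<in>I. fst p x * (\<nu> (f p) - \<nu>' (f p)))"
        unfolding sum_subtractf[symmetric] by (simp add: right_diff_distrib)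
      also have "\<dots> \<le> (\<Sum>p\<in>I. R * (2 * \<sigma>))"
      proof (rule sum_mono)
        fix p assume p: "p \<in> I"
        have "\<bar>\<nu> (f p) - \<mu> (f p)\<bar> < \<sigma>" "\<bar>\<nu>' (f p) - \<mu> (f p)\<bar> < \<sigma>"
          using n p by (auto simp: U_def)
        then have "\<bar>\<nu> (f p) - \<nu>' (f p)\<bar> \<le> 2 * \<sigma>"
          by linarith
        then have "\<bar>fst p x\<bar> * \<bar>\<nu> (f p) - \<nu>' (f p)\<bar> \<le> R * (2 * \<sigma>)"
          using bnd[OF I(2)[OF p] x] pos(1) by (intro mult_mono) auto
        then show "fst p x * (\<nu> (f p) - \<nu>' (f p)) \<le> R * (2 * \<sigma>)"
          unfolding abs_mult[symmetric] by linarith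
      qed
      also have "\<dots> \<le> e / 8"
        using \<sigma>_card by (simp add: mult_ac)
      finally have "(\<Sum>p\<in>I. fst p x * \<nu> (f p)) - (\<Sum>p\<in>I. fst p x * \<nu>' (f p)) \<le> e / 8" .
      moreover have "2 * R * (c0 + \<tau>) \<le> e / 8"
        using pos(4) \<tau>(2) by (simp add: algebra_simps)
      ultimately show ?thesis
        using near[OF n(1)] near[OF n(2)] pos(2,3) by linarith
    qed
    then show ?thesis
      by (auto simp: small_def)
  qed
  ultimately show False
    using \<mu> by (auto simp: state_der_def)
qed

text \<open>Near a point of one piece the other pieces are invisible, since their finite union is
  closed.\<close>

lemma sder_disjoint_UN:
  fixes A :: "nat \<Rightarrow> ('i \<Rightarrow> real) set"
  assumes "finite I" "\<And>k. k \<in> I \<Longrightarrow> compact (A k)"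
    and disj: "\<And>j k. j \<in> I \<Longrightarrow> k \<in> I \<Longrightarrow> j \<noteq> k \<Longrightarrow> A j \<inter> A k = {}"
  shows "sder B e (\<Union>k\<in>I. A k) \<subseteq> (\<Union>k\<in>I. sder B e (A k))"
proof
  fix y assume y: "y \<in> sder B e (\<Union>k\<in>I. A k)"
  then obtain k where k: "k \<in> I" "y \<in> A k"
    by (auto simp: sder_def)
  have "y \<in> sder B e (A k)"
  proof (rule ccontr)
    assume "y \<notin> sder B e (A k)"
    then obtain U where U: "open U" "y \<in> U" "small B e (U \<inter> A k)"
      using k by (auto simp: sder_def)
    define C where "C = (\<Union>j\<in>I - {k}. A j)"
    have "closed C"
      unfolding C_def using assms(1,2) by (intro closed_UN) (auto intro: compact_imp_closed)
    moreover have "y \<notin> C"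
      using disj k by (auto simp: C_def)
    moreover have "small B e ((U \<inter> - C) \<inter> (\<Union>k\<in>I. A k))"
      by (rule small_mono[OF U(3)]) (auto simp: C_def)
    ultimately have "open (U \<inter> - C)" "y \<in> U \<inter> - C" "small B e ((U \<inter> - C) \<inter> (\<Union>k\<in>I. A k))"
      using U by (auto simp: open_Compl open_Int)
    then show False
      using y by (auto simp: sder_def)
  qed
  then show "y \<in> (\<Union>k\<in>I. sder B e (A k))"
    using k by blast
qed

lemma iterated_sder_disjoint_UN:
  fixes A :: "nat \<Rightarrow> ('i \<Rightarrow> real) set"
  assumes I: "finite I" "\<And>k. k \<in> I \<Longrightarrow> compact (A k)"
    and disj: "\<And>j k. j \<in> I \<Longrightarrow> k \<in> I \<Longrightarrow> j \<noteq> k \<Longrightarrow> A j \<inter> A k = {}"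
  shows "iterated_deriv (sder B e) (\<Union>k\<in>I. A k) \<alpha> \<subseteq> (\<Union>k\<in>I. iterated_deriv (sder B e) (A k) \<alpha>)"
proof (induction \<alpha> rule: ordinal_induct)
  case zero
  then show ?case
    by (simp add: iterated_deriv_0)
next
  case (osuc \<beta>)
  let ?A = "\<lambda>k. iterated_deriv (sder B e) (A k) \<beta>"
  have sub: "?A k \<subseteq> A k" for k
    by (rule iterated_deriv_subset[OF sder_subset])
  have "sder B e (iterated_deriv (sder B e) (\<Union>k\<in>I. A k) \<beta>) \<subseteq> sder B e (\<Union>k\<in>I. ?A k)"
    by (rule sder_mono[OF osuc])
  also have "\<dots> \<subseteq> (\<Union>k\<in>I. sder B e (?A k))"
  proof (rule sder_disjoint_UN[OF I(1)])
    show "compact (?A k)" if "k \<in> I" for k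
      by (rule compact_iterated_deriv[OF compact_sder I(2)[OF that]])
    show "?A j \<inter> ?A k = {}" if "j \<in> I" "k \<in> I" "j \<noteq> k" for j k
      using disj[OF that] sub[of j] sub[of k] by blast
  qed
  finally show ?case
    by (simp add: iterated_deriv_osuc)
next
  case (limit \<kappa>)
  let ?A = "\<lambda>k \<beta>. iterated_deriv (sder B e) (A k) \<beta>"
  show ?case
  proof
    fix y assume y: "y \<in> iterated_deriv (sder B e) (\<Union>k\<in>I. A k) \<kappa>"
    then have ex: "\<exists>k\<in>I. y \<in> ?A k \<beta>" if "\<beta> < \<kappa>" for \<beta>
      using limit(2)[OF that] that by (auto simp: iterated_deriv_limit[OF limit(1)])
    have sub: "?A k \<beta> \<subseteq> A k" for k \<beta>
      by (rule iterated_deriv_subset[OF sder_subset])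
    obtain k where k: "k \<in> I" "y \<in> A k"
      using ex[OF limit_ordinal_gr_0[OF limit(1)]] sub by blast
    \<comment> \<open>Disjointness forces the same piece at all stages below \<kappa>.\<close>
    have "y \<in> ?A k \<beta>" if \<beta>: "\<beta> < \<kappa>" for \<beta>
    proof -
      obtain j where j: "j \<in> I" "y \<in> ?A j \<beta>"
        using ex[OF \<beta>] by blast
      then have "j = k"
        using disj[of j k] k sub[of j \<beta>] by blast
      then show ?thesis
        using j by simp
    qed
    then show "y \<in> (\<Union>k\<in>I. ?A k \<kappa>)"
      using k by (auto simp: iterated_deriv_limit[OF limit(1)])
  qed
qed

lemma compact_Int_continuous_le:
  fixes h :: "'s::t2_space \<Rightarrow> real"
  assumes "compact K" "continuous_on K h" "compact C" "C \<subseteq> K"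
  shows "compact {y \<in> C. h y \<le> c}"
proof -
  have "closed (K \<inter> h -` {..c})"
    by (intro continuous_closed_preimage assms(2) compact_imp_closed[OF assms(1)] closed_atMost)
  then have "compact (C \<inter> (K \<inter> h -` {..c}))"
    by (rule compact_Int_closed[OF assms(3)])
  moreover have "C \<inter> (K \<inter> h -` {..c}) = {y \<in> C. h y \<le> c}"
    using assms(4) by auto
  ultimately show ?thesis
    by simp
qed

text \<open>Each \<open>\<omega>\<^bsup>\<zeta>\<^esup>\<close> steps of the hull derivation raise the integral of a rank that is adapted to
  \<open>\<omega>\<^bsup>\<zeta>\<^esup>\<close> steps of the Szlenk derivation by \<open>c0\<close>, up to the mass counted by the continuous
  correction \<open>G\<close>. Integrals of upper semicontinuous ranks are expressed through continuous
  majorants. In the induction step, the deficit of \<open>h\<close> with respect to \<open>\<rho>\<close> is carried by a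
  compact set \<open>L\<close> of smaller Szlenk rank; the ranks coming from \<open>L\<close> are bounded, hence
  infinitely many steps force the correction itself to be at least \<open>c0\<close>. The constant \<open>c0\<close>
  does not deteriorate.\<close>

lemma iterated_hull_der_rank_step:
  fixes K :: "('i \<Rightarrow> real) set" and \<zeta> :: "'u ordinal"
  assumes K: "compact K" and bnd: "\<And>y x. y \<in> K \<Longrightarrow> x \<in> B \<Longrightarrow> \<bar>y x\<bar> \<le> R"
    and pos: "R > 0" "e > 0" "4 * \<delta> \<le> e" "32 * R * c0 \<le> e" "\<delta> > 0"
    and "rank_admissible K B \<delta> \<zeta> n \<rho>"
    and "M \<subseteq> states K" and "continuous_on K G"
    and "\<And>\<nu> h. \<nu> \<in> M \<Longrightarrow> continuous_on K h \<Longrightarrow> (\<And>y. y \<in> K \<Longrightarrow> real (\<rho> y) \<le> h y) \<Longrightarrow>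
        1 \<le> \<nu> (\<lambda>y. h y + G y)"
    and "\<nu> \<in> iterated_deriv (hull_der K B e) M (omega_power \<zeta>)"
    and "continuous_on K h" "\<And>y. y \<in> K \<Longrightarrow> 0 \<le> h y" "\<And>y. y \<in> K \<Longrightarrow> real (\<rho> y) - 1 \<le> h y"
  shows "c0 \<le> \<nu> (\<lambda>y. h y + G y)"
  using assms(8-)
proof (induction \<zeta> arbitrary: n \<rho> M G \<nu> h rule: less_induct)
  case (less \<zeta>)
  note adm = less.prems(1) and M = less.prems(2) and G = less.prems(3) and hyp = less.prems(4)
    and \<nu> = less.prems(5) and h = less.prems(6-8)
  have Q_cont: "continuous_on K (\<lambda>y. h y + G y)"
    by (intro continuous_intros h G)
  show ?case
  proof (cases "\<zeta> = 0")
    case True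
    have "\<nu> \<in> hull_der K B e M"
      using \<nu> True by (simp add: one_ordinal_def iterated_deriv_0 iterated_deriv_osuc)
    then show ?thesis
    proof (rule hull_der_ge[OF M Q_cont, rotated])
      fix \<mu> assume \<mu>: "\<mu> \<in> state_der B e M"
      show "c0 \<le> \<mu> (\<lambda>y. h y + G y)"
        by (rule state_der_rank_step[where K = K and B = B and R = R and M = M and \<rho> = \<rho> and G = G
              and h = h and e = e and \<delta> = \<delta>, OF K _ pos adm[unfolded True] M G _ \<mu> h(1)])
          (use bnd hyp h in auto)
    qed
  next
    case False
    have rank_le: "\<rho> y \<le> n" if "y \<in> K" for y
      using adm that by (simp add: rank_admissible_def)
    have "c0 \<le> \<nu> (\<lambda>y. h y + G y) + \<tau>" if \<tau>: "\<tau> > 0" for \<tau>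
    proof -
      \<comment> \<open>Points whose deficit \<rho> - h is at least \<tau>. Since \<open>h\<close>
        is at least \<rho> - 1, a point of \<open>A k\<close> has rank exactly \<open>k\<close>;
        thanks to \<tau> this part of an exact level is nevertheless compact, and \<omega>^\<zeta>
        derivations empty it.\<close>
      define A where "A k = {y \<in> {y \<in> K. k \<le> \<rho> y}. h y \<le> real k - \<tau>}" for k
      define L where "L = (\<Union>k\<in>{1..n}. A k)"
      have A_rank: "\<rho> y = k" if "y \<in> A k" for y k
      proof (rule ccontr)
        assume "\<rho> y \<noteq> k"
        then have "real k + 1 \<le> real (\<rho> y)"
          using that by (auto simp: A_def)
        then show False
          using that h(3)[of y] \<tau> by (auto simp: A_def)
      qed
      have A_compact: "compact (A k)" for k
        unfolding A_def using adm
        by (intro compact_Int_continuous_le[OF K h(1)]) (auto simp: rank_admissible_def)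
      have "iterated_deriv (sder B \<delta>) (A k) (omega_power \<zeta>) = {}" if "k \<in> {1..n}" for k
      proof -
        have "iterated_deriv (sder B \<delta>) (A k) (omega_power \<zeta>) \<subseteq>
            iterated_deriv (sder B \<delta>) {y \<in> K. k \<le> \<rho> y} (omega_power \<zeta>)"
          by (rule iterated_deriv_mono[OF sder_mono]) (auto simp: A_def)
        also have "\<dots> \<subseteq> {y \<in> K. Suc k \<le> \<rho> y}"
          using adm that by (auto simp: rank_admissible_def)
        finally show ?thesis
          using iterated_deriv_subset[of "sder B \<delta>", OF sder_subset, of "A k" "omega_power \<zeta>"] A_rank
          by fastforce
      qed
      moreover have "iterated_deriv (sder B \<delta>) L (omega_power \<zeta>) \<subseteq>
          (\<Union>k\<in>{1..n}. iterated_deriv (sder B \<delta>) (A k) (omega_power \<zeta>))"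
        unfolding L_def using A_rank
        by (intro iterated_sder_disjoint_UN A_compact) auto
      ultimately have "iterated_deriv (sder B \<delta>) L (omega_power \<zeta>) = {}"
        by auto
      moreover have L_compact: "compact L"
        unfolding L_def by (intro compact_UN A_compact) auto
      ultimately obtain \<alpha> where \<alpha>: "\<alpha> < omega_power \<zeta>" "iterated_deriv (sder B \<delta>) L \<alpha> = {}"
        using iterated_deriv_limit_empty[of "sder B \<delta>", OF sder_subset compact_sder L_compact
            limit_ordinal_omega_power[OF False]]
        by metis
      then obtain \<zeta>' n' where z: "\<zeta>' < \<zeta>" "\<alpha> \<le> omega_power \<zeta>' * (osuc ^^ n') 0"
        using less_omega_powerE[OF _ False] by blast
      define E where "E j = iterated_deriv (sder B \<delta>) L (omega_power \<zeta>' * (osuc ^^ j) 0)" for j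
      have E_last: "E n' = {}"
        using iterated_deriv_antimono[of "sder B \<delta>", OF sder_subset z(2), of L] \<alpha>(2)
        by (simp add: E_def)
      have E_0: "E 0 = L"
        by (simp add: E_def iterated_deriv_0)
      have E_Suc: "E (Suc j) = iterated_deriv (sder B \<delta>) (E j) (omega_power \<zeta>')" for j
        unfolding E_def by (simp add: iterated_deriv_add[of "sder B \<delta>", OF sder_subset])
      have E_sub: "E (Suc j) \<subseteq> E j" for j
        unfolding E_Suc by (rule iterated_deriv_subset[OF sder_subset])
      have E_anti: "E k \<subseteq> E j" if "j \<le> k" for j k
        using that by (induction rule: dec_induct) (use E_sub in auto)
      have L_sub: "L \<subseteq> K"
        by (auto simp: L_def A_def)
      \<comment> \<open>The number of sets \<open>E j\<close> containing \<open>y\<close>: it is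
        positive exactly on \<open>L\<close>, and \<open>E k\<close> is the level
        \<open>Suc k\<close>, not \<open>k\<close>.\<close>
      define \<rho>' where "\<rho>' y = (LEAST j. y \<notin> E j)" for y
      have less_rank': "k < \<rho>' y \<longleftrightarrow> y \<in> E k" for k y
      proof
        show "y \<in> E k" if "k < \<rho>' y"
          using not_less_Least[of k "\<lambda>j. y \<notin> E j"] that by (auto simp: \<rho>'_def)
        have "y \<notin> E (\<rho>' y)"
          unfolding \<rho>'_def by (rule LeastI[of _ n']) (simp add: E_last)
        then show "k < \<rho>' y" if "y \<in> E k"
          using E_anti[of "\<rho>' y" k] that by (meson not_le subsetD)
      qed
      have level: "{y \<in> K. Suc k \<le> \<rho>' y} = E k" for k
        using less_rank' E_anti[of 0 k] L_sub by (auto simp: Suc_le_eq E_0)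
      have adm': "rank_admissible K B \<delta> \<zeta>' n' \<rho>'"
        unfolding rank_admissible_def
      proof (intro conjI allI impI ballI)
        show "\<rho>' y \<le> n'" for y
          using less_rank'[of n' y] E_last by simp
        show "compact {y \<in> K. k \<le> \<rho>' y}" for k
        proof (cases k)
          case 0
          then show ?thesis
            using K by simp
        next
          case (Suc j)
          have "compact (E j)"
            unfolding E_def by (rule compact_iterated_deriv[OF compact_sder L_compact])
          then show ?thesis
            using level Suc by simp
        qed
        show "iterated_deriv (sder B \<delta>) {y \<in> K. k \<le> \<rho>' y} (omega_power \<zeta>') \<subseteq> {y \<in> K. Suc k \<le> \<rho>' y}"
          if "1 \<le> k" for k
        proof -
          have "k \<noteq> 0"
            using that by simp
          then obtain j where "k = Suc j"
            by (rule not0_implies_Suc[THEN exE])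
          then show ?thesis
            using level E_Suc[of j] by simp
        qed
      qed
      define Q where "Q y = h y + G y + \<tau>" for y
      have Q: "continuous_on K Q"
        unfolding Q_def by (intro continuous_intros h G)
      define N where "N j = iterated_deriv (hull_der K B e) M (omega_power \<zeta>' * (osuc ^^ j) 0)" for j
      have N_M: "N j \<subseteq> M" for j
        unfolding N_def by (rule iterated_deriv_subset[OF hull_der_subset])
      have N_Suc: "N (Suc j) = iterated_deriv (hull_der K B e) (N j) (omega_power \<zeta>')" for j
        unfolding N_def by (simp add: iterated_deriv_add[of "hull_der K B e", OF hull_der_subset])
      \<comment> \<open>A majorant capped at 1 is enough, because the deficit of \<open>h\<close>
        never exceeds 1: on \<open>L\<close> the cap is attained, and off \<open>L\<close> the slack
        \<tau> inside \<open>Q\<close> covers the deficit.\<close>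
      have Q_hyp: "1 \<le> \<mu> (\<lambda>y. min (f y) 1 + Q y)"
        if \<mu>: "\<mu> \<in> M" and f: "continuous_on K f" "\<And>y. y \<in> K \<Longrightarrow> real (\<rho>' y) \<le> f y" for \<mu> f
      proof -
        have c: "continuous_on K (\<lambda>y. h y + \<tau> + min (f y) 1)"
          by (intro continuous_intros h f)
        have le: "real (\<rho> y) \<le> h y + \<tau> + min (f y) 1" if y: "y \<in> K" for y
        proof (cases "y \<in> L")
          case True
          then have "1 \<le> real (\<rho>' y)"
            using less_rank'[of 0 y] by (simp add: E_0)
          then have "min (f y) 1 = 1"
            using f(2)[OF y] by simp
          then show ?thesis
            using h(3)[OF y] \<tau> by simp
        next
          case F: False
          have "0 \<le> min (f y) 1"
            using f(2)[OF y] by (meson min.boundedI of_nat_0_le_iff order_trans zero_le_one)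
          moreover have "real (\<rho> y) \<le> h y + \<tau>"
          proof (cases "\<rho> y = 0")
            case True
            then show ?thesis
              using h(2)[OF y] \<tau> by simp
          next
            case False
            then have "y \<notin> A (\<rho> y)" "\<rho> y \<in> {1..n}"
              using F rank_le[OF y] by (auto simp: L_def)
            then show ?thesis
              using y by (auto simp: A_def)
          qed
          ultimately show ?thesis
            by simp
        qed
        have "1 \<le> \<mu> (\<lambda>y. (h y + \<tau> + min (f y) 1) + G y)"
          by (rule hyp[OF \<mu> c le])
        also have "(\<lambda>y. (h y + \<tau> + min (f y) 1) + G y) = (\<lambda>y. min (f y) 1 + Q y)"
          by (auto simp: Q_def)
        finally show ?thesis .
      qed
      have claim: "real j * c0 \<le> \<mu> (\<lambda>y. f y + real j * Q y)"
        if "\<mu> \<in> N j" "continuous_on K f" "\<And>y. y \<in> K \<Longrightarrow> 0 \<le> f y" "\<And>y. y \<in> K \<Longrightarrow> real (\<rho>' y) - 1 \<le> f y"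
        for j \<mu> f
        using that
      proof (induction j arbitrary: \<mu> f)
        case 0
        then have "\<mu> \<in> states K"
          using N_M[of 0] M by blast
        then show ?case
          using states_nonneg[of \<mu> K f] 0 by simp
      next
        case (Suc j)
        \<comment> \<open>A majorant \<open>g\<close> of the new rank splits into
          \<open>max (g y - 1) 0\<close> and \<open>min (g y) 1\<close>. The first part needs
          \<open>j\<close> copies of \<open>Q\<close> for the claim at \<open>j\<close>, the second
          one more copy for \<open>Q_hyp\<close>; subtracting the gain \<open>j * c0\<close>
          normalises the total to 1.\<close>
        define G' where "G' y = real j * Q y - real j * c0 + Q y" for y
        have G': "continuous_on K G'"
          unfolding G'_def by (intro continuous_intros Q)
        have mu: "\<mu> \<in> states K"
          using N_M[of "Suc j"] Suc.prems(1) M by blast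
        have hyp': "1 \<le> \<mu>' (\<lambda>y. g y + G' y)"
          if \<mu>': "\<mu>' \<in> N j" and g: "continuous_on K g" "\<And>y. y \<in> K \<Longrightarrow> real (\<rho>' y) \<le> g y" for \<mu>' g
        proof -
          have st: "\<mu>' \<in> states K"
            using N_M \<mu>' M by blast
          have c: "continuous_on K (\<lambda>y. max (g y - 1) 0 + real j * Q y)"
            "continuous_on K (\<lambda>y. min (g y) 1 + Q y)"
            by (intro continuous_intros g Q)+
          have "real j * c0 \<le> \<mu>' (\<lambda>y. max (g y - 1) 0 + real j * Q y)"
          proof (rule Suc.IH[OF \<mu>'])
            show "continuous_on K (\<lambda>y. max (g y - 1) 0)"
              by (intro continuous_intros g)
            show "real (\<rho>' y) - 1 \<le> max (g y - 1) 0" if "y \<in> K" for y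
              using g(2)[OF that] by simp
          qed simp
          moreover have "1 \<le> \<mu>' (\<lambda>y. min (g y) 1 + Q y)"
            using N_M \<mu>' by (intro Q_hyp g) auto
          moreover have "\<mu>' (\<lambda>y. g y + G' y) = \<mu>' (\<lambda>y. (max (g y - 1) 0 + real j * Q y) +
              (min (g y) 1 + Q y)) - real j * c0"
          proof -
            have "(\<lambda>y. g y + G' y) = (\<lambda>y. ((max (g y - 1) 0 + real j * Q y) +
                (min (g y) 1 + Q y)) - real j * c0)"
              by (auto simp: G'_def max_def min_def)
            then show ?thesis
              using states_diff[OF st continuous_on_add[OF c] continuous_on_const, of "real j * c0"]
                states_const[OF st, of "real j * c0"] by simp
          qed
          moreover have "\<mu>' (\<lambda>y. (max (g y - 1) 0 + real j * Q y) + (min (g y) 1 + Q y)) =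
              \<mu>' (\<lambda>y. max (g y - 1) 0 + real j * Q y) + \<mu>' (\<lambda>y. min (g y) 1 + Q y)"
            by (rule states_add[OF st c])
          ultimately show ?thesis
            by linarith
        qed
        have "c0 \<le> \<mu> (\<lambda>y. f y + G' y)"
        proof (rule less.IH[OF z(1) adm' order_trans[OF N_M M] G'])
          show "\<mu> \<in> iterated_deriv (hull_der K B e) (N j) (omega_power \<zeta>')"
            using Suc.prems(1) N_Suc by simp
          show "1 \<le> \<mu>' (\<lambda>y. g y + G' y)"
            if "\<mu>' \<in> N j" "continuous_on K g" "\<And>y. y \<in> K \<Longrightarrow> real (\<rho>' y) \<le> g y" for \<mu>' g
            by (rule hyp'[OF that])
        qed (use Suc.prems in auto)
        also have "(\<lambda>y. f y + G' y) = (\<lambda>y. (f y + real (Suc j) * Q y) - real j * c0)"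
          by (auto simp: G'_def algebra_simps)
        also have "\<mu> \<dots> = \<mu> (\<lambda>y. f y + real (Suc j) * Q y) - real j * c0"
          using states_const[OF mu, of "real j * c0"]
          by (subst states_diff[OF mu]) (auto intro!: continuous_intros Suc.prems Q)
        finally show ?case
          by (simp add: algebra_simps)
      qed
      have st: "\<nu> \<in> states K"
        using \<nu> M iterated_deriv_subset[of "hull_der K B e", OF hull_der_subset] by blast
      \<comment> \<open>The same constant \<open>n'\<close> majorizes the rank for all
        \<open>j\<close>, and \<nu> lies in every \<open>N j\<close>.\<close>
      have bound: "real j * (c0 - \<nu> Q) \<le> real n'" for j
      proof -
        have "\<nu> \<in> N j"
          using \<nu> iterated_deriv_antimono[of "hull_der K B e", OF hull_der_subset
              less_imp_le[OF omega_power_mult_nat_less[OF z(1)]]]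
          unfolding N_def by blast
        then have "real j * c0 \<le> \<nu> (\<lambda>y. real n' + real j * Q y)"
        proof (rule claim)
          show "real (\<rho>' y) - 1 \<le> real n'" for y
            using adm'[unfolded rank_admissible_def] less_rank'[of n' y] E_last by auto
        qed (auto intro: continuous_on_const)
        also have "\<dots> = real n' + real j * \<nu> Q"
          using states_add[OF st continuous_on_const continuous_on_mult_left[OF Q]]
            states_const[OF st] states_cmult[OF st Q] by simp
        finally show ?thesis
          by (simp add: algebra_simps)
      qed
      have "c0 \<le> \<nu> Q"
      proof (rule ccontr)
        assume "\<not> ?thesis"
        then obtain j where "real n' < real j * (c0 - \<nu> Q)"
          using reals_Archimedean3[of "c0 - \<nu> Q"] by auto
        then show False
          using bound[of j] by simp
      qed
      also have "\<nu> Q = \<nu> (\<lambda>y. h y + G y) + \<tau>"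
        unfolding Q_def using states_add[OF st Q_cont continuous_on_const] states_const[OF st] by simp
      finally show ?thesis .
    qed
    then show ?thesis
      by (rule field_le_epsilon)
  qed
qed

lemma iterated_dder_empty:
  fixes K :: "('i \<Rightarrow> real) set" and \<xi> :: "'u ordinal"
  assumes K: "compact K" and bnd: "\<And>y x. y \<in> K \<Longrightarrow> x \<in> B \<Longrightarrow> \<bar>y x\<bar> \<le> R"
    and sz: "\<And>\<epsilon>. \<epsilon> > 0 \<Longrightarrow> iterated_deriv (sder B \<epsilon>) K (omega_power \<xi>) = {}"
    and "\<epsilon> > 0"
  shows "iterated_deriv (dder B \<epsilon>) K (omega * omega_power \<xi>) = {}"
proof -
  define e where "e = \<epsilon> / 2"
  \<comment> \<open>\<open>R\<close> may be zero or negative, whereas the constants divide by the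
    bound.\<close>
  define R' where "R' = max R 1"
  have pos: "R' > 0" "e > 0" "4 * (e / 4) \<le> e" "32 * R' * (e / (32 * R')) \<le> e" "e / 4 > 0"
    using assms(4) by (auto simp: e_def R'_def)
  have bnd': "\<bar>y x\<bar> \<le> R'" if "y \<in> K" "x \<in> B" for y x
    using bnd[OF that] by (simp add: R'_def)
  have adm: "rank_admissible K B (e / 4) \<xi> 1 (\<lambda>_. 1)"
    unfolding rank_admissible_def
  proof (intro conjI allI impI ballI)
    show "compact {y \<in> K. k \<le> 1}" for k :: nat
      using K by (cases "k \<le> 1") auto
    show "iterated_deriv (sder B (e / 4)) {y \<in> K. k \<le> 1} (omega_power \<xi>) \<subseteq> {y \<in> K. Suc k \<le> 1}"
      if "1 \<le> k" for k :: nat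
    proof (cases "k = 1")
      case True
      then show ?thesis
        using sz[OF pos(5)] by simp
    next
      case False
      then have empty: "{y \<in> K. k \<le> 1} = {}"
        using that by simp
      show ?thesis
        unfolding empty
        using iterated_deriv_subset[of "sder B (e / 4)", OF sder_subset, of "{}" "omega_power \<xi>"]
        by simp
    qed
  qed simp
  have "\<nu> \<notin> iterated_deriv (hull_der K B e) (states K) (omega_power \<xi>)" for \<nu>
  proof
    assume \<nu>: "\<nu> \<in> iterated_deriv (hull_der K B e) (states K) (omega_power \<xi>)"
    have "e / (32 * R') \<le> \<nu> (\<lambda>y. 0 + 0)"
    proof (rule iterated_hull_der_rank_step[where K = K and B = B and R = R' and M = "states K"
          and \<rho> = "\<lambda>_. 1" and G = "\<lambda>_. 0" and h = "\<lambda>_. 0" and e = e and \<delta> = "e / 4" and \<zeta> = \<xi>,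
          OF K _ pos adm order_refl continuous_on_const _ \<nu>])
      fix \<mu> h assume a: "\<mu> \<in> states K" "continuous_on K h" "\<And>y. y \<in> K \<Longrightarrow> real 1 \<le> h y"
      have "\<mu> (\<lambda>_. 1) \<le> \<mu> h"
        by (rule states_mono[OF a(1) continuous_on_const a(2)]) (use a(3) in auto)
      then show "1 \<le> \<mu> (\<lambda>y. h y + 0)"
        using states_one[OF a(1)] by simp
    qed (use bnd' in \<open>auto intro: continuous_on_const\<close>)
    moreover have "\<nu> (\<lambda>y. 0 + 0) = 0"
      using \<nu> iterated_deriv_subset[of "hull_der K B e", OF hull_der_subset] states_const[of \<nu> K 0]
      by auto
    moreover have "0 < e / (32 * R')"
      using pos by simp
    ultimately show False
      by simp
  qed
  then have "iterated_deriv (hull_der K B e) (states K) (omega_power \<xi>) = {}"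
    by auto
  then have "iterated_deriv (dder B (2 * e)) (bary ` states K) (omega * omega_power \<xi>) = {}"
    using iterated_dder_bary_subset[OF compact_states[OF K] mix_closed_states, of B e "omega_power \<xi>" K]
    by auto
  then show ?thesis
    using iterated_deriv_mono[of "dder B \<epsilon>" "dder B \<epsilon>", OF dder_mono subset_bary_states[of K]]
    by (auto simp: e_def)
qed

section \<open>Midpoint-convex sets\<close>

definition midp :: "('i \<Rightarrow> real) \<Rightarrow> ('i \<Rightarrow> real) \<Rightarrow> 'i \<Rightarrow> real" where
  "midp z w = (\<lambda>x. (w x + z x) / 2)"

text \<open>Contraction towards \<open>z\<close> is continuous and halves all differences, so the
  preimage of an e/2-small neighbourhood is e-small.\<close>

lemma midp_sder_subset:
  assumes "midp z ` A \<subseteq> A'"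
  shows "midp z ` sder B e A \<subseteq> sder B (e / 2) A'"
proof
  fix v assume "v \<in> midp z ` sder B e A"
  then obtain y where y: "y \<in> sder B e A" "v = midp z y"
    by auto
  have "\<not> small B (e / 2) (U \<inter> A')" if U: "open U" "v \<in> U" for U
  proof
    assume s: "small B (e / 2) (U \<inter> A')"
    have "continuous_on UNIV (midp z)"
      unfolding midp_def by (intro continuous_intros) simp_all
    then have "open (midp z -` U)"
      using U(1) by (rule open_vimage[rotated])
    moreover have "y \<in> midp z -` U"
      using U(2) y(2) by simp
    moreover have "small B e (midp z -` U \<inter> A)"
      unfolding small_def
    proof (intro ballI)
      fix y1 y2 x assume a: "y1 \<in> midp z -` U \<inter> A" "y2 \<in> midp z -` U \<inter> A" "x \<in> B"
      then have "midp z y1 \<in> U \<inter> A'" "midp z y2 \<in> U \<inter> A'"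
        using assms by auto
      then have "midp z y1 x - midp z y2 x \<le> e / 2"
        using s a(3) by (simp add: small_def)
      then show "y1 x - y2 x \<le> e"
        by (simp add: midp_def field_simps)
    qed
    ultimately show False
      using y(1) by (auto simp: sder_def)
  qed
  moreover have "v \<in> A'"
    using y assms by (auto simp: sder_def)
  ultimately show "v \<in> sder B (e / 2) A'"
    by (auto simp: sder_def)
qed

lemma midp_iterated_sder_subset:
  assumes "midp z ` A \<subseteq> A'"
  shows "midp z ` iterated_deriv (sder B e) A \<alpha> \<subseteq> iterated_deriv (sder B (e / 2)) A' \<alpha>"
proof (induction \<alpha> rule: ordinal_induct)
  case zero
  then show ?case
    using assms by (simp add: iterated_deriv_0)
next
  case (osuc \<beta>)
  then show ?case
    unfolding iterated_deriv_osuc by (rule midp_sder_subset)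
next
  case (limit \<kappa>)
  then show ?case
    by (auto simp: iterated_deriv_limit)
qed

text \<open>If \<open>y\<close> survives \<open>\<alpha>\<close> derivations, then so does the half-size copy of \<open>K\<close> centred at \<open>y\<close>.\<close>

lemma iterated_sder_double:
  assumes mid: "\<And>y z. y \<in> K \<Longrightarrow> z \<in> K \<Longrightarrow> midp y z \<in> K"
    and "iterated_deriv (sder B e) K \<alpha> \<noteq> {}"
  shows "iterated_deriv (sder B (e / 2)) K (\<alpha> + \<alpha>) \<noteq> {}"
proof -
  obtain y where y: "y \<in> iterated_deriv (sder B e) K \<alpha>"
    using assms(2) by auto
  let ?A = "iterated_deriv (sder B (e / 2)) K \<alpha>"
  \<comment> \<open>The roles are exchanged here: contracting towards each \<open>z\<close> of
    \<open>K\<close> carries the survivor \<open>y\<close> into \<open>?A\<close>, and the points so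
    obtained form the contraction of \<open>K\<close> towards \<open>y\<close>.\<close>
  have "midp y z \<in> ?A" if z: "z \<in> K" for z
  proof -
    have "midp z ` K \<subseteq> K"
      using mid z by auto
    then have "midp z y \<in> ?A"
      using imageI[OF y] by (rule subsetD[OF midp_iterated_sder_subset])
    moreover have "midp z y = midp y z"
      by (auto simp: midp_def)
    ultimately show ?thesis
      by simp
  qed
  then have "midp y ` K \<subseteq> ?A"
    by auto
  then have "midp y ` iterated_deriv (sder B e) K \<alpha> \<subseteq> iterated_deriv (sder B (e / 2)) ?A \<alpha>"
    by (rule midp_iterated_sder_subset)
  then show ?thesis
    using y by (auto simp: iterated_deriv_add[of "sder B (e / 2)", OF sder_subset])
qed

section \<open>The dual space as a space of real functions\<close>

lemma re_part_add: "re_part (c + d) = re_part c + re_part d"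
  and re_part_diff: "re_part (c - d) = re_part c - re_part d"
  and re_part_scaleR: "re_part (r *\<^sub>R c) = r * re_part c"
  and re_part_sum: "re_part (\<Sum>i\<in>I. f i) = (\<Sum>i\<in>I. re_part (f i))"
  by (simp_all add: re_part_def inner_add_left inner_diff_left inner_sum_left)

lemma re_part_of_real: "re_part (of_real r) = r"
proof -
  have "(1 :: 'a) \<bullet> 1 = 1"
    by (simp add: dot_square_norm)
  then show ?thesis
    by (simp add: re_part_def of_real_def)
qed

lemma re_part_le_norm: "re_part c \<le> norm c"
  unfolding re_part_def using norm_cauchy_schwarz[of c 1] by simp

lemma continuous_on_re_part [continuous_intros]:
  "continuous_on S f \<Longrightarrow> continuous_on S (\<lambda>x. re_part (f x))"
  unfolding re_part_def by (intro continuous_intros)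

lemma ex_rotation: "\<exists>c. norm c = 1 \<and> re_part (c * k) = norm k"
proof (cases "k = 0")
  case True
  then show ?thesis
    by (intro exI[of _ 1]) (simp add: re_part_def)
next
  case False
  then show ?thesis
    by (intro exI[of _ "of_real (norm k) / k"]) (simp add: norm_divide re_part_of_real)
qed

text \<open>Each real coordinate of a scalar is the real part of one of its multiples, because
  \<open>(c, k) \<mapsto> re_part (c * k)\<close> is a nondegenerate bilinear form.\<close>

lemma ex_coordinate_multiplier:
  fixes b :: "'k::{real_normed_field,euclidean_space}"
  shows "\<exists>c. \<forall>k. re_part (c * k) = k \<bullet> b"
proof -
  define \<phi> where "\<phi> c = (\<Sum>b'\<in>Basis. re_part (c * b') *\<^sub>R b')" for c :: 'k
  have rep: "re_part (c * k) = k \<bullet> \<phi> c" for c k :: 'k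
  proof -
    have "re_part (c * k) = re_part (c * (\<Sum>b'\<in>Basis. (k \<bullet> b') *\<^sub>R b'))"
      by (simp add: euclidean_representation)
    also have "\<dots> = (\<Sum>b'\<in>Basis. (k \<bullet> b') * re_part (c * b'))"
      by (simp add: sum_distrib_left re_part_sum re_part_scaleR)
    also have "\<dots> = k \<bullet> \<phi> c"
      by (simp add: \<phi>_def inner_sum_right mult.commute)
    finally show ?thesis .
  qed
  have "linear \<phi>"
    by (rule linearI)
      (simp_all add: \<phi>_def distrib_right re_part_add re_part_scaleR scaleR_add_left sum.distrib
        scaleR_sum_right)
  moreover have "inj \<phi>"
    unfolding linear_injective_0[OF \<open>linear \<phi>\<close>]
  proof (intro allI impI)
    fix c assume "\<phi> c = 0"
    then have "re_part (c * k) = 0" for k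
      by (simp add: rep)
    then show "c = 0"
      using ex_rotation[of c] by (metis mult.commute norm_eq_zero)
  qed
  ultimately have "surj \<phi>"
    by (rule linear_injective_imp_surjective) simp
  then obtain c where "\<phi> c = b"
    by (metis surjD)
  then show ?thesis
    using rep by auto
qed

definition re_functional :: "('a::banach \<Rightarrow>\<^sub>L 'k::{real_normed_field,euclidean_space}) \<Rightarrow> 'a \<Rightarrow> real" where
  "re_functional y x = re_part (blinfun_apply y x)"

context
  fixes sm :: "'k::{real_normed_field,euclidean_space} \<Rightarrow> 'a::banach \<Rightarrow> 'a"
  assumes sm: "scalar_mult sm"
begin

lemma norm_sm: "norm (sm c x) = norm c * norm x"
  using sm by (simp add: scalar_mult_def)

lemma dual_space_apply: "y \<in> dual_space sm \<Longrightarrow> blinfun_apply y (sm c x) = c * blinfun_apply y x"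
  by (simp add: dual_space_def)

text \<open>The unit ball is invariant under scalars of modulus 1, and a rotation of
  \<open>x\<close> turns the modulus of a value into its real part. Hence real parts determine the
  dual norm.\<close>

lemma norm_diff_le_iff:
  assumes "y \<in> dual_space sm" "z \<in> dual_space sm" "0 \<le> e"
  shows "norm (y - z) \<le> e \<longleftrightarrow> (\<forall>x\<in>cball 0 1. re_functional y x - re_functional z x \<le> e)"
proof
  assume le: "norm (y - z) \<le> e"
  show "\<forall>x\<in>cball 0 1. re_functional y x - re_functional z x \<le> e"
  proof
    fix x :: 'a assume x: "x \<in> cball 0 1"
    have "re_functional y x - re_functional z x = re_part (blinfun_apply (y - z) x)"
      by (simp add: re_functional_def re_part_diff blinfun.diff_left)
    also have "\<dots> \<le> norm (blinfun_apply (y - z) x)"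
      by (rule re_part_le_norm)
    also have "\<dots> \<le> norm (y - z) * norm x"
      by (rule norm_blinfun)
    also have "\<dots> \<le> e * 1"
      using le x assms(3) by (intro mult_mono) auto
    finally show "re_functional y x - re_functional z x \<le> e"
      by simp
  qed
next
  assume H: "\<forall>x\<in>cball 0 1. re_functional y x - re_functional z x \<le> e"
  have le: "norm (blinfun_apply (y - z) x) \<le> e" if "norm x = 1" for x
  proof -
    obtain c where c: "norm c = 1" "re_part (c * blinfun_apply (y - z) x) = norm (blinfun_apply (y - z) x)"
      using ex_rotation by blast
    have "c * blinfun_apply (y - z) x = blinfun_apply y (sm c x) - blinfun_apply z (sm c x)"
      using assms by (simp add: dual_space_apply blinfun.diff_left right_diff_distrib)
    then have "norm (blinfun_apply (y - z) x) = re_functional y (sm c x) - re_functional z (sm c x)"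
      using c(2) by (simp add: re_functional_def re_part_diff)
    also have "\<dots> \<le> e"
      using H that c(1) by (simp add: norm_sm)
    finally show ?thesis .
  qed
  show "norm (y - z) \<le> e"
  proof (rule norm_blinfun_bound[OF assms(3)])
    fix x
    show "norm (blinfun_apply (y - z) x) \<le> e * norm x"
    proof (cases "x = 0")
      case False
      have "norm (blinfun_apply (y - z) (x /\<^sub>R norm x)) \<le> e"
        using False by (intro le) simp
      then have "norm (blinfun_apply (y - z) x) / norm x \<le> e"
        by (simp add: blinfun.scaleR_right divide_inverse mult.commute)
      then show ?thesis
        using False by (simp add: pos_divide_le_eq)
    qed simp
  qed
qed

lemma inj_on_re_functional: "inj_on re_functional (dual_space sm)"
proof (rule inj_onI)
  fix y z assume "y \<in> dual_space sm" "z \<in> dual_space sm" "re_functional y = re_functional z"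
  then show "y = z"
    using norm_diff_le_iff[of y z 0] by simp
qed

lemma small_re_functional_iff:
  assumes "A \<subseteq> dual_space sm" "bounded A" "0 \<le> e"
  shows "small (cball 0 1) e (re_functional ` A) \<longleftrightarrow> \<not> diameter A > e"
proof -
  have "small (cball 0 1) e (re_functional ` A) \<longleftrightarrow> (\<forall>y\<in>A. \<forall>z\<in>A. norm (y - z) \<le> e)"
  proof -
    have "norm (y - z) \<le> e \<longleftrightarrow> (\<forall>x\<in>cball 0 1. re_functional y x - re_functional z x \<le> e)"
      if "y \<in> A" "z \<in> A" for y z
      using that assms by (intro norm_diff_le_iff) auto
    then show ?thesis
      unfolding small_def by auto
  qed
  also have "\<dots> \<longleftrightarrow> diameter A \<le> e"
  proof
    show "diameter A \<le> e" if "\<forall>y\<in>A. \<forall>z\<in>A. norm (y - z) \<le> e"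
      using that assms(3) by (intro diameter_le) auto
    show "\<forall>y\<in>A. \<forall>z\<in>A. norm (y - z) \<le> e" if "diameter A \<le> e"
      using that diameter_bounded_bound[OF assms(2)] by (force simp: dist_norm)
  qed
  finally show ?thesis
    by (simp add: not_less)
qed

lemma continuous_map_re_functional:
  "continuous_map weak_star euclidean (re_functional :: ('a \<Rightarrow>\<^sub>L 'k) \<Rightarrow> _)"
proof -
  have "continuous_map weak_star euclidean (\<lambda>y :: 'a \<Rightarrow>\<^sub>L 'k. re_functional y x)" for x
  proof -
    have "continuous_map weak_star euclidean (re_part \<circ> (\<lambda>y :: 'a \<Rightarrow>\<^sub>L 'k. blinfun_apply y x))"
      by (rule continuous_map_compose[OF strong_operator_topology_continuous_evaluation])
        (simp add: continuous_intros)
    then show ?thesis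
      by (simp add: re_functional_def comp_def)
  qed
  then have "continuous_map weak_star (product_topology (\<lambda>_. euclidean) UNIV)
      (re_functional :: ('a \<Rightarrow>\<^sub>L 'k) \<Rightarrow> _)"
    unfolding continuous_map_componentwise_UNIV by blast
  then show ?thesis
    by (simp add: euclidean_product_topology)
qed

text \<open>A scalar-linear functional is recovered from its real part: each coordinate of its value
  at \<open>x\<close> is a real part of its value at a multiple of \<open>x\<close>. The recovery
  map \<Theta> is continuous for pointwise convergence, so passing to real parts loses no weak-star
  open sets.\<close>

lemma weak_star_open_preimage:
  assumes "openin weak_star U" "y \<in> U" "y \<in> dual_space sm"
  obtains V where "open V" "re_functional y \<in> V"
    "\<And>z. z \<in> dual_space sm \<Longrightarrow> re_functional z \<in> V \<Longrightarrow> z \<in> U"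
proof -
  obtain m :: "'k \<Rightarrow> 'k" where m: "\<And>b k. re_part (m b * k) = k \<bullet> b"
    using ex_coordinate_multiplier by metis
  define \<Theta> where "\<Theta> w x = (\<Sum>b\<in>Basis. w (sm (m b) x) *\<^sub>R b)" for w :: "'a \<Rightarrow> real" and x
  have \<Theta>: "\<Theta> (re_functional z) = blinfun_apply z" if "z \<in> dual_space sm" for z
    using that by (auto simp: \<Theta>_def re_functional_def dual_space_apply m euclidean_representation)
  have cont: "continuous_on UNIV \<Theta>"
    unfolding \<Theta>_def by (intro continuous_intros)
  obtain W where W: "open W" "U = blinfun_apply -` W"
    using assms(1) by (auto simp: strong_operator_topology_def openin_pullback_topology)
  show ?thesis
  proof (rule that[of "\<Theta> -` W"])
    show "open (\<Theta> -` W)"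
      by (rule open_vimage[OF W(1) cont])
  qed (use assms W \<Theta> in auto)
qed

lemma re_functional_szlenk_deriv:
  assumes A: "A \<subseteq> dual_space sm" "bounded A" and e: "0 \<le> e"
  shows "re_functional ` szlenk_deriv e A = sder (cball 0 1) e (re_functional ` A)"
proof -
  have small: "small (cball 0 1) e (re_functional ` (V \<inter> A)) \<longleftrightarrow> \<not> diameter (V \<inter> A) > e" for V
    using A e by (intro small_re_functional_iff) (auto intro: bounded_subset)
  have "(\<forall>V. weak_star_nbhd y V \<longrightarrow> diameter (V \<inter> A) > e) \<longleftrightarrow>
      (\<forall>U. open U \<and> re_functional y \<in> U \<longrightarrow> \<not> small (cball 0 1) e (U \<inter> re_functional ` A))"
    if y: "y \<in> A" for y
  proof (intro iffI allI impI)
    fix U assume H: "\<forall>V. weak_star_nbhd y V \<longrightarrow> diameter (V \<inter> A) > e"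
      and U: "open U \<and> re_functional y \<in> U"
    have "openin weak_star (re_functional -` U :: ('a \<Rightarrow>\<^sub>L 'k) set)"
      using openin_continuous_map_preimage[OF continuous_map_re_functional, of U] U
      by (simp add: strong_operator_topology_topspace vimage_def)
    then have "weak_star_nbhd y (re_functional -` U)"
      using U by (auto simp: weak_star_nbhd_def)
    then have "\<not> small (cball 0 1) e (re_functional ` (re_functional -` U \<inter> A))"
      using H small by blast
    moreover have "re_functional ` (re_functional -` U \<inter> A) = U \<inter> re_functional ` A"
      by auto
    ultimately show "\<not> small (cball 0 1) e (U \<inter> re_functional ` A)"
      by simp
  next
    fix V assume H: "\<forall>U. open U \<and> re_functional y \<in> U \<longrightarrow> \<not> small (cball 0 1) e (U \<inter> re_functional ` A)"
      and "weak_star_nbhd y V"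
    then obtain U' where U': "openin weak_star U'" "y \<in> U'" "U' \<subseteq> V"
      by (auto simp: weak_star_nbhd_def)
    have "y \<in> dual_space sm"
      using y A by auto
    then obtain U where U: "open U" "re_functional y \<in> U"
      "\<And>z. z \<in> dual_space sm \<Longrightarrow> re_functional z \<in> U \<Longrightarrow> z \<in> U'"
      using weak_star_open_preimage[OF U'(1,2)] by metis
    have "U \<inter> re_functional ` A \<subseteq> re_functional ` (V \<inter> A)"
      using U(3) U'(3) A(1) by auto
    moreover have "\<not> small (cball 0 1) e (U \<inter> re_functional ` A)"
      using H U(1,2) by simp
    ultimately have "\<not> small (cball 0 1) e (re_functional ` (V \<inter> A))"
      by (auto dest: small_mono[OF _ _ order_refl])
    then show "diameter (V \<inter> A) > e"
      using small by simp
  qed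
  then show ?thesis
    by (auto simp: szlenk_deriv_def sder_def)
qed

lemma re_functional_dent_deriv:
  assumes A: "A \<subseteq> dual_space sm" "bounded A" and e: "0 \<le> e"
  shows "re_functional ` dent_deriv e A = dder (cball 0 1) e (re_functional ` A)"
proof -
  have small: "small (cball 0 1) e (re_functional ` (V \<inter> A)) \<longleftrightarrow> \<not> diameter (V \<inter> A) > e" for V
    using A e by (intro small_re_functional_iff) (auto intro: bounded_subset)
  \<comment> \<open>By linearity a finite combination of coordinates is a single evaluation, so both
    notions of slice agree on the dual.\<close>
  have comb: "(\<Sum>x\<in>F. t x * re_functional y x) = re_part (blinfun_apply y (\<Sum>x\<in>F. t x *\<^sub>R x))"
    for F t and y :: "'a \<Rightarrow>\<^sub>L 'k"
    by (simp add: re_functional_def blinfun.sum_right blinfun.scaleR_right re_part_sum re_part_scaleR)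
  have "(\<forall>S. weak_star_slice S \<and> y \<in> S \<longrightarrow> diameter (S \<inter> A) > e) \<longleftrightarrow>
      (\<forall>F t a. finite F \<and> re_functional y \<in> slice F t a \<longrightarrow>
         \<not> small (cball 0 1) e (slice F t a \<inter> re_functional ` A))"
    for y
  proof (intro iffI allI impI)
    fix F t a assume H: "\<forall>S. weak_star_slice S \<and> y \<in> S \<longrightarrow> diameter (S \<inter> A) > e"
      and F: "finite F \<and> re_functional y \<in> slice F t a"
    define S where "S = {y :: 'a \<Rightarrow>\<^sub>L 'k. re_part (blinfun_apply y (\<Sum>x\<in>F. t x *\<^sub>R x)) > a}"
    have S: "y \<in> S \<longleftrightarrow> re_functional y \<in> slice F t a" for y
      by (simp add: S_def slice_def comb)
    have "weak_star_slice S"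
      unfolding weak_star_slice_def S_def by blast
    then have "\<not> small (cball 0 1) e (re_functional ` (S \<inter> A))"
      using H F S small by blast
    moreover have "re_functional ` (S \<inter> A) = slice F t a \<inter> re_functional ` A"
      using S by auto
    ultimately show "\<not> small (cball 0 1) e (slice F t a \<inter> re_functional ` A)"
      by simp
  next
    fix S assume H: "\<forall>F t a. finite F \<and> re_functional y \<in> slice F t a \<longrightarrow>
         \<not> small (cball 0 1) e (slice F t a \<inter> re_functional ` A)"
      and "weak_star_slice S \<and> y \<in> S"
    then obtain x a where S: "S = {f. re_part (blinfun_apply f x) > a}" "y \<in> S"
      by (auto simp: weak_star_slice_def)
    have iff: "y \<in> S \<longleftrightarrow> re_functional y \<in> slice {x} (\<lambda>_. 1) a" for y
      by (simp add: S(1) slice_def re_functional_def)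
    then have "slice {x} (\<lambda>_. 1) a \<inter> re_functional ` A = re_functional ` (S \<inter> A)"
      by auto
    moreover have "\<not> small (cball 0 1) e (slice {x} (\<lambda>_. 1) a \<inter> re_functional ` A)"
      using H iff S(2) by blast
    ultimately show "diameter (S \<inter> A) > e"
      using small by simp
  qed
  then show ?thesis
    by (auto simp: dent_deriv_def dder_def)
qed

lemma re_functional_iterated_deriv:
  assumes A: "A \<subseteq> dual_space sm" "bounded A"
    and D: "\<And>A. D A \<subseteq> A"
    and D': "\<And>A. A \<subseteq> dual_space sm \<Longrightarrow> bounded A \<Longrightarrow> re_functional ` D A = D' (re_functional ` A)"
  shows "re_functional ` iterated_deriv D A \<alpha> = iterated_deriv D' (re_functional ` A) \<alpha>"
proof (induction \<alpha> rule: ordinal_induct)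
  case zero
  then show ?case
    by (simp add: iterated_deriv_0)
next
  case (osuc \<beta>)
  have "iterated_deriv D A \<beta> \<subseteq> A"
    by (rule iterated_deriv_subset[OF D])
  then have "re_functional ` D (iterated_deriv D A \<beta>) = D' (re_functional ` iterated_deriv D A \<beta>)"
    using A by (intro D') (auto intro: bounded_subset)
  then show ?case
    by (simp add: iterated_deriv_osuc osuc)
next
  case (limit \<kappa>)
  have sub: "iterated_deriv D A \<beta> \<subseteq> dual_space sm" for \<beta> :: "'b ordinal"
    using iterated_deriv_subset[OF D] A(1) by blast
  \<comment> \<open>Injectivity on the dual space is what lets the image commute with this nonempty
    intersection.\<close>
  have "re_functional ` (\<Inter>\<zeta>\<in>{..<\<kappa>}. iterated_deriv D A \<zeta>) =
      (\<Inter>\<zeta>\<in>{..<\<kappa>}. re_functional ` iterated_deriv D A \<zeta>)"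
    using limit_ordinal_gr_0[OF limit(1)]
    by (intro image_INT[OF inj_on_re_functional]) (auto simp: sub)
  then show ?case
    using limit by (simp add: iterated_deriv_limit)
qed

end

text \<open>The uniform boundedness principle by Baire category: one of the closed sets
  \<open>C n\<close> contains a ball, and differences of its points reach every direction.
  Boundedness makes \<open>diameter\<close> meaningful.\<close>

lemma weak_star_compact_bounded:
  fixes K :: "('a::banach \<Rightarrow>\<^sub>L 'k::{real_normed_field,euclidean_space}) set"
  assumes "compactin weak_star K"
  shows "bounded K"
proof -
  have pt: "\<exists>b. \<forall>y\<in>K. norm (blinfun_apply y x) \<le> b" for x
  proof -
    have "compactin euclidean ((\<lambda>y. blinfun_apply y x) ` K)"
      by (rule image_compactin[OF assms strong_operator_topology_continuous_evaluation])
    then have "bounded ((\<lambda>y. blinfun_apply y x) ` K)"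
      by (simp add: compact_imp_bounded)
    then show ?thesis
      by (auto simp: bounded_iff)
  qed
  define C where "C n = (\<Inter>y\<in>K. {x. norm (blinfun_apply y x) \<le> real n})" for n :: nat
  have C_closed: "closed (C n)" for n
    unfolding C_def by (intro closed_INT ballI closed_Collect_le continuous_intros)
  have "x \<in> (\<Union>n. C n)" for x
  proof -
    obtain b where b: "\<forall>y\<in>K. norm (blinfun_apply y x) \<le> b"
      using pt by blast
    obtain n where "b \<le> real n"
      using real_arch_simple by blast
    then have "x \<in> C n"
      using b by (auto simp: C_def)
    then show ?thesis
      by blast
  qed
  then have "(\<Union>n. C n) = UNIV"
    by blast
  then have "interior (\<Union>(range C)) \<noteq> {}"
    by simp
  then have "\<exists>n. interior (C n) \<noteq> {}"
    using Baire_category_alt[of "euclidean :: 'a topology" "range C"] C_closed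
    by (auto simp: completely_metrizable_space_euclidean)
  then obtain n x0 where "x0 \<in> interior (C n)"
    by blast
  then obtain r where r: "r > 0" "cball x0 r \<subseteq> C n"
    by (meson mem_interior_cball)
  have bd: "norm (blinfun_apply y x) \<le> real n" if "x \<in> cball x0 r" "y \<in> K" for x y
    using r(2) that by (auto simp: C_def)
  have "norm y \<le> 2 * real n / r" if y: "y \<in> K" for y
  proof (rule norm_blinfun_bound)
    show "0 \<le> 2 * real n / r"
      using r(1) by simp
    fix x
    show "norm (blinfun_apply y x) \<le> 2 * real n / r * norm x"
    proof (cases "x = 0")
      case False
      define s where "s = r / norm x"
      have s: "s > 0"
        using r(1) False by (simp add: s_def)
      have "x0 + s *\<^sub>R x \<in> cball x0 r" "x0 \<in> cball x0 r"
        using r(1) False by (auto simp: dist_norm s_def)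
      then have "norm (blinfun_apply y (x0 + s *\<^sub>R x)) \<le> real n" "norm (blinfun_apply y x0) \<le> real n"
        using bd y by auto
      moreover have "s *\<^sub>R blinfun_apply y x = blinfun_apply y (x0 + s *\<^sub>R x) - blinfun_apply y x0"
        by (simp add: blinfun.add_right blinfun.scaleR_right)
      ultimately have "norm (s *\<^sub>R blinfun_apply y x) \<le> 2 * real n"
        using norm_triangle_ineq4[of "blinfun_apply y (x0 + s *\<^sub>R x)" "blinfun_apply y x0"] by simp
      then have "s * norm (blinfun_apply y x) \<le> 2 * real n"
        using s by simp
      then have "norm (blinfun_apply y x) \<le> 2 * real n / s"
        using s by (simp add: pos_le_divide_eq mult.commute)
      then show ?thesis
        by (simp add: s_def)
    qed simp
  qed
  then show ?thesis
    by (auto simp: bounded_iff)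
qed

section \<open>The indices\<close>

lemma vanishing_index_le_iff:
  assumes "\<And>A. D A \<subseteq> A"
  shows "vanishing_index D K \<le> Ord \<gamma> \<longleftrightarrow> iterated_deriv D K \<gamma> = {}"
proof
  assume le: "vanishing_index D K \<le> Ord \<gamma>"
  then have ex: "\<exists>\<xi> :: 'b ordinal. iterated_deriv D K \<xi> = {}"
    by (auto simp: vanishing_index_def split: if_splits)
  then have "(LEAST \<xi>. iterated_deriv D K \<xi> = {}) \<le> \<gamma>"
    using le by (simp add: vanishing_index_def)
  moreover have "iterated_deriv D K (LEAST \<xi> :: 'b ordinal. iterated_deriv D K \<xi> = {}) = {}"
    using ex by (rule LeastI_ex)
  ultimately show "iterated_deriv D K \<gamma> = {}"
    using iterated_deriv_antimono[OF assms] by blast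
next
  assume "iterated_deriv D K \<gamma> = {}"
  then show "vanishing_index D K \<le> Ord \<gamma>"
    by (auto simp: vanishing_index_def intro: Least_le)
qed

lemma szlenk_deriv_subset: "szlenk_deriv e A \<subseteq> A"
  by (auto simp: szlenk_deriv_def)

lemma dent_deriv_subset: "dent_deriv e A \<subseteq> A"
  by (auto simp: dent_deriv_def)

lemma Szlenk_index_le_iff:
  "(Szlenk_index K :: ('o + ('a::banach \<Rightarrow>\<^sub>L 'k::{real_normed_field,euclidean_space})) xordinal) \<le> Ord \<gamma>
    \<longleftrightarrow> (\<forall>\<epsilon>>0. iterated_deriv (szlenk_deriv \<epsilon>) K \<gamma> = {})"
  by (auto simp: Szlenk_index_def SUP_le_iff Szlenk_index_at_def
      vanishing_index_le_iff[OF szlenk_deriv_subset])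

lemma dentability_index_le_iff:
  "(dentability_index K :: ('o + ('a::banach \<Rightarrow>\<^sub>L 'k::{real_normed_field,euclidean_space})) xordinal) \<le> Ord \<gamma>
    \<longleftrightarrow> (\<forall>\<epsilon>>0. iterated_deriv (dent_deriv \<epsilon>) K \<gamma> = {})"
  by (auto simp: dentability_index_def SUP_le_iff dentability_index_at_def
      vanishing_index_le_iff[OF dent_deriv_subset])

theorem theorem1:
  fixes sm :: "'k::{real_normed_field,euclidean_space} \<Rightarrow> 'a::banach \<Rightarrow> 'a"
    and K :: "('a \<Rightarrow>\<^sub>L 'k) set"
    and \<xi> :: "('o + ('a \<Rightarrow>\<^sub>L 'k)) ordinal"
  assumes "scalar_mult sm"
    and "K \<subseteq> dual_space sm"
    and "compactin weak_star K"
  shows "(Szlenk_index K \<le> Ord (omega_power \<xi>) \<longrightarrow>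
            dentability_index K \<le> Ord (omega_power (1 + \<xi>))) \<and>
         (convex K \<longrightarrow>
            dentability_index K \<le> omega_times (Szlenk_index K :: ('o + ('a \<Rightarrow>\<^sub>L 'k)) xordinal) \<and>
            ((Szlenk_index K :: ('o + ('a \<Rightarrow>\<^sub>L 'k)) xordinal) \<ge> Ord (omega_power omega) \<longrightarrow>
               dentability_index K = (Szlenk_index K :: ('o + ('a \<Rightarrow>\<^sub>L 'k)) xordinal)))"
proof -
  let ?Sz = "Szlenk_index K :: ('o + ('a \<Rightarrow>\<^sub>L 'k)) xordinal"
  let ?Dz = "dentability_index K :: ('o + ('a \<Rightarrow>\<^sub>L 'k)) xordinal"
  let ?B = "cball 0 1 :: 'a set"
  define L where "L = (re_functional ` K :: ('a \<Rightarrow> real) set)"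
  have bounded: "bounded K"
    using assms(3) by (rule weak_star_compact_bounded)
  have "compactin euclidean L"
    unfolding L_def by (rule image_compactin[OF assms(3) continuous_map_re_functional[OF assms(1)]])
  then have L: "compact L"
    by simp
  obtain R where R: "\<And>y. y \<in> K \<Longrightarrow> norm y \<le> R"
    using bounded by (auto simp: bounded_iff)
  have L_bound: "\<bar>y x\<bar> \<le> R" if "y \<in> L" "x \<in> ?B" for y x
  proof -
    obtain z where z: "z \<in> K" "y = re_functional z"
      using \<open>y \<in> L\<close> by (auto simp: L_def)
    have "\<bar>y x\<bar> \<le> norm (blinfun_apply z x)"
      using Cauchy_Schwarz_ineq2[of "blinfun_apply z x" 1] by (simp add: z re_functional_def re_part_def)
    also have "\<dots> \<le> norm z * norm x"
      by (rule norm_blinfun)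
    also have "\<dots> \<le> R * 1"
      using R[OF z(1)] \<open>x \<in> ?B\<close> by (intro mult_mono) (auto intro: order_trans[OF norm_ge_zero])
    finally show ?thesis
      by simp
  qed
  have Sz_iff: "?Sz \<le> Ord \<gamma> \<longleftrightarrow> (\<forall>\<epsilon>>0. iterated_deriv (sder ?B \<epsilon>) L \<gamma> = {})" for \<gamma>
  proof -
    have "iterated_deriv (sder ?B \<epsilon>) L \<gamma> = re_functional ` iterated_deriv (szlenk_deriv \<epsilon>) K \<gamma>"
      if "\<epsilon> > 0" for \<epsilon>
      unfolding L_def using that
      by (intro re_functional_iterated_deriv[symmetric, OF assms(1,2) bounded] szlenk_deriv_subset
          re_functional_szlenk_deriv[OF assms(1)]) auto
    then show ?thesis
      by (simp add: Szlenk_index_le_iff)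
  qed
  have Dz_iff: "?Dz \<le> Ord \<gamma> \<longleftrightarrow> (\<forall>\<epsilon>>0. iterated_deriv (dder ?B \<epsilon>) L \<gamma> = {})" for \<gamma>
  proof -
    have "iterated_deriv (dder ?B \<epsilon>) L \<gamma> = re_functional ` iterated_deriv (dent_deriv \<epsilon>) K \<gamma>"
      if "\<epsilon> > 0" for \<epsilon>
      unfolding L_def using that
      by (intro re_functional_iterated_deriv[symmetric, OF assms(1,2) bounded] dent_deriv_subset
          re_functional_dent_deriv[OF assms(1)]) auto
    then show ?thesis
      by (simp add: dentability_index_le_iff)
  qed
  have main: "?Dz \<le> Ord (omega * omega_power \<zeta>)" if "?Sz \<le> Ord (omega_power \<zeta>)" for \<zeta>
    unfolding Dz_iff
  proof (intro allI impI)
    fix \<epsilon> :: real assume "\<epsilon> > 0"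
    show "iterated_deriv (dder ?B \<epsilon>) L (omega * omega_power \<zeta>) = {}"
    proof (rule iterated_dder_empty[OF L])
      show "\<bar>y x\<bar> \<le> R" if "y \<in> L" "x \<in> ?B" for y x
        by (rule L_bound[OF that])
      show "iterated_deriv (sder ?B \<epsilon>) L (omega_power \<zeta>) = {}" if "\<epsilon> > 0" for \<epsilon>
        using \<open>?Sz \<le> Ord (omega_power \<zeta>)\<close> that unfolding Sz_iff by blast
    qed (rule \<open>\<epsilon> > 0\<close>)
  qed
  have Sz_le_Dz: "?Sz \<le> ?Dz"
  proof (cases ?Dz)
    case (Ord \<gamma>)
    have "iterated_deriv (sder ?B \<epsilon>) L \<gamma> \<subseteq> iterated_deriv (dder ?B \<epsilon>) L \<gamma>" for \<epsilon>
      by (rule iterated_deriv_mono[OF sder_subset_dder]) auto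
    moreover have "\<forall>\<epsilon>>0. iterated_deriv (dder ?B \<epsilon>) L \<gamma> = {}"
      using Ord Dz_iff[of \<gamma>] by simp
    ultimately show ?thesis
      unfolding Ord Sz_iff by blast
  qed simp
  have convex_case: "?Dz \<le> omega_times ?Sz \<and> (?Sz \<ge> Ord (omega_power omega) \<longrightarrow> ?Dz = ?Sz)"
    if "convex K"
  proof (cases ?Sz)
    case Infty
    then show ?thesis
      using Sz_le_Dz by (simp add: order_antisym)
  next
    case (Ord \<eta>)
    show ?thesis
    \<comment> \<open>The index of the empty set is 0, which is not a power of \<omega>.\<close>
    proof (cases "\<eta> = 0")
      case True
      then have "iterated_deriv (sder ?B 1) L (0 :: ('o + ('a \<Rightarrow>\<^sub>L 'k)) ordinal) = {}"
        using Ord Sz_iff[of 0] by simp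
      then have "L = {}"
        by (simp add: iterated_deriv_0)
      then have "?Dz \<le> Ord 0"
        by (simp add: Dz_iff iterated_deriv_0)
      moreover have "\<not> omega_power omega \<le> (0 :: ('o + ('a \<Rightarrow>\<^sub>L 'k)) ordinal)"
        using omega_power_gr_0 not_le by blast
      ultimately show ?thesis
        using Ord True by simp
    next
      case False
      have mid: "midp y z \<in> L" if y: "y \<in> L" and z: "z \<in> L" for y z
      proof -
        obtain y' z' where yz: "y' \<in> K" "z' \<in> K" "y = re_functional y'" "z = re_functional z'"
          using y z by (auto simp: L_def)
        have "(1/2) *\<^sub>R y' + (1/2) *\<^sub>R z' \<in> K"
          using \<open>convex K\<close> yz(1,2) by (rule convexD) auto
        moreover have "re_functional ((1/2) *\<^sub>R y' + (1/2) *\<^sub>R z') = midp y z"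
          by (auto simp: yz midp_def re_functional_def blinfun.add_left blinfun.scaleR_left
              re_part_add re_part_scaleR)
        ultimately show ?thesis
          unfolding L_def by (metis imageI)
      qed
      \<comment> \<open>Doubling the stage halves \<epsilon>, which is harmless because the index is
        a supremum over all \<epsilon>.\<close>
      have "\<alpha> + \<alpha> < \<eta>" if "\<alpha> < \<eta>" for \<alpha>
      proof -
        have "\<not> ?Sz \<le> Ord \<alpha>"
          using Ord that by simp
        then obtain \<epsilon> where "\<epsilon> > 0" "iterated_deriv (sder ?B \<epsilon>) L \<alpha> \<noteq> {}"
          unfolding Sz_iff by blast
        then have "iterated_deriv (sder ?B (\<epsilon> / 2)) L (\<alpha> + \<alpha>) \<noteq> {}" "\<epsilon> / 2 > 0"
          using iterated_sder_double[where K = L, OF mid] by auto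
        then have "\<not> ?Sz \<le> Ord (\<alpha> + \<alpha>)"
          unfolding Sz_iff by blast
        then show ?thesis
          using Ord by simp
      qed
      then obtain \<zeta> where \<zeta>: "\<eta> = omega_power \<zeta>"
        using additively_indecomposable_imp_omega_power[OF False] by blast
      have le: "?Dz \<le> Ord (omega * \<eta>)"
        using main[of \<zeta>] Ord \<zeta> by simp
      have "?Dz = ?Sz" if "Ord (omega_power omega) \<le> ?Sz"
      proof (rule antisym)
        have "\<not> \<zeta> < omega"
          using that omega_power_strict_mono[of \<zeta> omega] unfolding Ord \<zeta> by (auto simp: not_le)
        then have "omega * \<eta> = \<eta>"
          by (simp add: \<zeta> omega_mult_omega_power one_add_absorb not_less)
        then show "?Dz \<le> ?Sz"
          using le Ord by simp
      qed (rule Sz_le_Dz)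
      then show ?thesis
        using le Ord by simp
    qed
  qed
  show ?thesis
    using main[of \<xi>] convex_case by (auto simp: omega_mult_omega_power)
qed

end
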